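(* Let $m=2$, $g:\mathbb{R}^d\to\mathbb{R}^m$, and let $\Omega$, $G$, $F_x$, $F$, $U$, $P_w$, $y^\alpha$, the mean-field equation with parameters $\lambda,\sigma,\alpha>0$, $\tau\ge 0$, the average $\ell_2$-error $\mathbb{E}_{f}[|x-\bar x(w)|^2]$ and the Generational Distance $GD$ be as defined in the context. Assume: (1) (Uniqueness) For every $w\in\Omega$ the problem $\min_{x\in\mathbb{R}^d}G(x,w)$ admits a unique solution $\bar x(w)$, with $\bar x(w)\in F_x$, and $\bar x\in\mathcal{C}^1(\Omega,\mathbb{R}^d)$. (2) (Stability at the minimizer) There exist a radius $R>0$, exponents $p>2$, $q>1$ and constants $c_1,c_2,c_3>0$ such that for all $w\in\Omega$ $$c_1|x-\bar x(w)|^p\le G(x,w)-\min_{y\in\mathbb{R}^d}G(y,w)\le c_2|x-\bar x(w)|^{1/q}\quad\text{for all } x \text{ with } |x-\bar x(w)|\le R,$$ $$c_3\le G(x,w)-\min_{y\in\mathbb{R}^d}G(y,w)\quad\text{for all } x \text{ with } |x-\bar x(w)|\ge R.$$ (3) (Boundedness and initial datum) The set $F_x$ is contained in a bounded open set $H\subset\mathbb{R}^d$ with $|H|>0$, and the initial datum is $f_0=\rho_0\otimes\mu_0$ with $\rho_0=\mathrm{Unif}(H)$ and some $\mu_0\in\mathcal{P}(\Omega)$. (4) $\nabla U\in L^\infty(\mathbb{R}^m)$. (5) $g$ is Lipschitz continuous with Lipschitz constant $\mathrm{Lip}(g)$. Let $\kappa=d$ if isotropic diffusion is used and $\kappa=1$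 if anisotropic diffusion is used, and set $$C:=\sqrt2\,\|\nabla U\|_{L^\infty(\mathbb{R}^m)}\,\|\nabla_w\bar x\|_{L^\infty(\Omega,\mathbb{R}^d)}.$$ Let $0<\varepsilon<\mathbb{E}_{f_0}[|x-\bar x(w)|^2]$ and assume $$\kappa\sigma^2+C\frac{\tau}{\sqrt\varepsilon}<\lambda .$$ Then, if $\alpha$ is sufficiently large (i.e. there is $\alpha_0>0$ such that the following holds for all $\alpha\ge\alpha_0$), for every solution $f\in\mathcal{C}([0,\infty),\mathcal{P}_2(\mathbb{R}^d\times\Omega))$ of the mean-field equation with initial datum $f_0$, with first marginal $\rho(t)\in\mathcal{P}(\mathbb{R}^d)$ of $f(t)$, there exists a time $T>0$ with $\mathbb{E}_{f(T)}[|x-\bar x(w)|^2]=\varepsilon$ such that $$GD[\rho(T)]\le\mathrm{Lip}(g)\sqrt{\varepsilon}$$ and, for all $t\in[0,T]$, $$GD[\rho(t)]\le\mathrm{Lip}(g)\,\sqrt{\mathbb{E}_{f_0}\left[|x-\bar x(w)|^2\right]}\;\exp\left(-\frac{\lambda-\kappa\sigma^2-C\tau/\sqrt\varepsilon}{2}\,t\right).$$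
   Context: Notation: $|\cdot|$ is the Euclidean norm of a vector, or the Lebesgue measure of a Borel set; $(a)_l$ is the $l$-th component of a vector $a$; $\mathcal{P}(E)$ denotes the Borel probability measures on $E$ and $\mathcal{P}_2(E)$ those with finite second moment; $\mathrm{Unif}(H)$ is the uniform distribution on $H$. Multi-objective problem: $g=(g_1,\dots,g_m):\mathbb{R}^d\to\mathbb{R}^m$. A point $\bar x\in\mathbb{R}^d$ is Edgeworth-Pareto (EP) optimal if there is no $x\in\mathbb{R}^d$ with $g_i(x)\le g_i(\bar x)$ for all $i=1,\dots,m$ and $g(x)\ne g(\bar x)$. $F_x=\{\bar x\in\mathbb{R}^d:\bar x\text{ is EP optimal}\}$ and the Pareto front is $F=\{g(\bar x):\bar x\text{ is EP optimal}\}\subset\mathbb{R}^m$. Scalarization: $\Omega=\{w\in\mathbb{R}^m_{\ge0}:\sum_{i=1}^m w_i=1\}$ and, for $w\in\Omega$, $G(x,w)=\max_{k\in\{1,\dots,m\}}w_k|g_k(x)|$. Potential and projection: $U:\mathbb{R}^m\to(-\infty,\infty]$ with $U\in\mathcal{C}^1(\mathbb{R}^m\setminus\{0\})$; if $U$ is singular at $0$, one sets $\nabla U(0)=0$. For $w\in\Omega$, $T(w,\Omega)$ is the tangent cone to the convex set $\Omega$ at $w$, and $P_w(h)$ is the Euclidean projection of $h\in\mathbb{R}^m$ onto $T(w,\Omega)$. Attracting point: for $\rho\in\mathcal{P}(\mathbb{R}^d)$ and $w\in\Omega$, $$y^\alpha(\rho,w)=\frac{\int x\,e^{-\alpha G(x,w)}\,d\rho(x)}{\int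 e^{-\alpha G(x,w)}\,d\rho(x)}.$$ Mean-field equation: with parameters $\alpha,\lambda,\sigma>0$, $\tau\ge0$, $f(t)\in\mathcal{P}(\mathbb{R}^d\times\Omega)$ with first marginal $\rho(t)\in\mathcal{P}(\mathbb{R}^d)$ solves $$\partial_t f=-\lambda\nabla_x\cdot\big((y^\alpha(\rho(t),w)-x)f\big)+\frac{\sigma^2}{2}\sum_{l=1}^d\partial^2_{x_lx_l}\big(d_l(x,\rho(t),w)\,f\big)-\tau\nabla_w\cdot\Big(P_w\Big(\int\nabla U(g(x)-g(y))\,d\rho(t,y)\Big)f\Big),$$ with $f(0)=f_0$, understood in the weak sense (against smooth compactly supported test functions of $(x,w)\in\mathbb{R}^d\times\mathbb{R}^m$, with $f(t)$ supported in $\mathbb{R}^d\times\Omega$). Here $d_l(x,\rho,w)=|x-y^\alpha(\rho,w)|^2$ for all $l$ in the case of isotropic diffusion, and $d_l(x,\rho,w)=(x-y^\alpha(\rho,w))_l^2$ in the case of anisotropic diffusion. It is the Fokker–Planck equation of the process $dX_t=\lambda(y^\alpha(\rho(t),W_t)-X_t)dt+\sigma D\,dB_t$, $dW_t=\tau P_{W_t}(\int\nabla U(g(X_t)-g(x))\,d\rho(t,x))\,dt$, with $D=|X_t-y^\alpha(\rho(t),W_t)|I_d$ (isotropic) or $D=\mathrm{diag}(X_t-y^\alpha(\rho(t),W_t))$ (anisotropic). Errors: $\mathbb{E}_{f(t)}[|x-\bar x(w)|^2]=\int|x-\bar x(w)|^2\,df(t,x,w)$, and $$GD[\rho(t)]=\Big(\int\mathrm{dist}(g(x),F)^2\,d\rho(t,x)\Big)^{1/2}.$$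 *)

theory Defs
  imports "HOL-Probability.Probability"
begin

section \<open>Multi-objective problem and scalarization\<close>

definition EP_optimal :: "('a \<Rightarrow> real^'m) \<Rightarrow> 'a \<Rightarrow> bool" where
  "EP_optimal g xb \<longleftrightarrow> \<not> (\<exists>x. (\<forall>i. g x $ i \<le> g xb $ i) \<and> g x \<noteq> g xb)"

definition EP_points :: "('a \<Rightarrow> real^'m) \<Rightarrow> 'a set" where
  "EP_points g = {xb. EP_optimal g xb}"

definition Pareto_front :: "('a \<Rightarrow> real^'m) \<Rightarrow> (real^'m) set" where
  "Pareto_front g = g ` EP_points g"

definition Omega :: "(real^'m) set" where
  "Omega = {w. (\<forall>i. 0 \<le> w $ i) \<and> (\<Sum>i\<in>UNIV. w $ i) = 1}"

definition scalarized :: "('a \<Rightarrow> real^'m) \<Rightarrow> 'a \<Rightarrow> real^'m \<Rightarrow> real" where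
  "scalarized g x w = (MAX k. w $ k * \<bar>g x $ k\<bar>)"


section \<open>Regularity and essentially bounded functions\<close>

text \<open>On a set \<open>S\<close> with empty interior such as \<^term>\<open>Omega\<close>, the derivative
  \<open>D w\<close> is determined only on directions tangent to \<open>S\<close>; some continuous choice is required.\<close>

definition C1_on :: "'a::real_normed_vector set \<Rightarrow> ('a \<Rightarrow> 'b::real_normed_vector) \<Rightarrow> bool" where
  "C1_on S h \<longleftrightarrow> (\<exists>D :: 'a \<Rightarrow> 'a \<Rightarrow>\<^sub>L 'b. continuous_on S D \<and>
     (\<forall>w\<in>S. (h has_derivative blinfun_apply (D w)) (at w within S)))"

definition in_Linf :: "'a measure \<Rightarrow> ('a \<Rightarrow> 'b::real_normed_vector) \<Rightarrow> bool" where
  "in_Linf M h \<longleftrightarrow> h \<in> borel_measurable M \<and> esssup M (\<lambda>x. ereal (norm (h x))) < \<infinity>"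

definition Linf_norm :: "'a measure \<Rightarrow> ('a \<Rightarrow> 'b::real_normed_vector) \<Rightarrow> real" where
  "Linf_norm M h = real_of_ereal (esssup M (\<lambda>x. ereal (norm (h x))))"

text \<open>For two objectives \<^term>\<open>Omega\<close> is the segment from \<open>(0,1)\<close> to \<open>(1,0)\<close>.
  It is parametrized by arc length, so that the derivative along the parametrization is the
  gradient of a map on the segment with respect to the Euclidean metric of the plane
  (one-sided at the end points).\<close>

definition Omega_arc :: "real \<Rightarrow> real^2" where
  "Omega_arc s = vector [s / sqrt 2, 1 - s / sqrt 2]"

definition Omega_grad_Linf_norm :: "(real^2 \<Rightarrow> 'a::real_normed_vector) \<Rightarrow> real" where
  "Omega_grad_Linf_norm h = Linf_norm (restrict_space lborel {0..sqrt 2})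
     (\<lambda>s. vector_derivative (\<lambda>r. h (Omega_arc r)) (at s within {0..sqrt 2}))"


section \<open>Potential and projection on the tangent cone\<close>

text \<open>The gradient is set to \<open>0\<close> where the potential is singular, i.e. infinite
  or not differentiable.\<close>

definition potential_grad :: "('a::euclidean_space \<Rightarrow> ereal) \<Rightarrow> 'a \<Rightarrow> 'a" where
  "potential_grad U y =
     (if \<bar>U y\<bar> \<noteq> \<infinity> \<and> (\<exists>D. GDERIV (\<lambda>v. real_of_ereal (U v)) y :> D)
      then (THE D. GDERIV (\<lambda>v. real_of_ereal (U v)) y :> D) else 0)"

definition is_potential :: "('a::euclidean_space \<Rightarrow> ereal) \<Rightarrow> bool" where
  "is_potential U \<longleftrightarrow>
     (\<forall>y. U y \<noteq> -\<infinity>) \<and>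
     (\<forall>y. y \<noteq> 0 \<longrightarrow> U y \<noteq> \<infinity> \<and> (\<exists>D. GDERIV (\<lambda>v. real_of_ereal (U v)) y :> D)) \<and>
     continuous_on (- {0}) (potential_grad U)"

text \<open>Tangent cone to a convex set.\<close>

definition tangent_cone :: "'a::real_normed_vector \<Rightarrow> 'a set \<Rightarrow> 'a set" where
  "tangent_cone w S = closure {s *\<^sub>R (v - w) | s v. 0 \<le> s \<and> v \<in> S}"

definition tangent_proj :: "real^'m \<Rightarrow> real^'m \<Rightarrow> real^'m" where
  "tangent_proj w h = closest_point (tangent_cone w Omega) h"


section \<open>The space of probability measures with finite second moment\<close>

definition prob_on :: "'a::topological_space set \<Rightarrow> 'a measure \<Rightarrow> bool" where
  "prob_on S M \<longleftrightarrow> prob_space M \<and> sets M = sets borel \<and> (AE z in M. z \<in> S)"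

definition prob2_on :: "'a::real_normed_vector set \<Rightarrow> 'a measure \<Rightarrow> bool" where
  "prob2_on S M \<longleftrightarrow> prob_on S M \<and> integrable M (\<lambda>z. (norm z)\<^sup>2)"

definition couplings :: "'a::topological_space measure \<Rightarrow> 'a measure \<Rightarrow> ('a \<times> 'a) measure set" where
  "couplings M N = {K. sets K = sets borel \<and> distr K borel fst = M \<and> distr K borel snd = N}"

text \<open>Square of the 2-Wasserstein distance.\<close>

definition W2_sq :: "'a::metric_space measure \<Rightarrow> 'a measure \<Rightarrow> ennreal" where
  "W2_sq M N = (INF K\<in>couplings M N. \<integral>\<^sup>+ z. ennreal ((dist (fst z) (snd z))\<^sup>2) \<partial>K)"

definition continuous_prob2 ::
  "'a::real_normed_vector set \<Rightarrow> (real \<Rightarrow> 'a measure) \<Rightarrow> bool" where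
  "continuous_prob2 S f \<longleftrightarrow> (\<forall>t\<ge>0. prob2_on S (f t)) \<and>
     (\<forall>t\<ge>0. ((\<lambda>s. W2_sq (f s) (f t)) \<longlongrightarrow> 0) (at t within {0..}))"

definition x_marginal :: "(('a::topological_space) \<times> ('b::topological_space)) measure \<Rightarrow> 'a measure" where
  "x_marginal M = distr M borel fst"


section \<open>Mean-field equation\<close>

definition attracting_point ::
  "(real^'d \<Rightarrow> real^'m) \<Rightarrow> real \<Rightarrow> (real^'d) measure \<Rightarrow> real^'m \<Rightarrow> real^'d" where
  "attracting_point g \<alpha> \<rho> w =
     (\<integral>x. exp (- \<alpha> * scalarized g x w) *\<^sub>R x \<partial>\<rho>) /\<^sub>R
     (\<integral>x. exp (- \<alpha> * scalarized g x w) \<partial>\<rho>)"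

datatype diffusion = Isotropic | Anisotropic

fun diffusion_coeff :: "diffusion \<Rightarrow> 'd \<Rightarrow> real^'d \<Rightarrow> real" where
  "diffusion_coeff Isotropic l v = (norm v)\<^sup>2"
| "diffusion_coeff Anisotropic l v = (v $ l)\<^sup>2"

fun diffusion_const :: "diffusion \<Rightarrow> 'd::finite itself \<Rightarrow> real" where
  "diffusion_const Isotropic _ = real CARD('d)"
| "diffusion_const Anisotropic _ = 1"

primrec C_k :: "nat \<Rightarrow> ('a::euclidean_space \<Rightarrow> real) \<Rightarrow> bool" where
  "C_k 0 \<phi> \<longleftrightarrow> continuous_on UNIV \<phi>"
| "C_k (Suc n) \<phi> \<longleftrightarrow> (\<forall>z. \<phi> differentiable (at z)) \<and>
     (\<forall>v. C_k n (\<lambda>z. frechet_derivative \<phi> (at z) v))"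

definition test_function :: "('a::euclidean_space \<Rightarrow> real) \<Rightarrow> bool" where
  "test_function \<phi> \<longleftrightarrow> (\<forall>n. C_k n \<phi>) \<and> compact (closure {z. \<phi> z \<noteq> 0})"

definition w_drift ::
  "(real^'d \<Rightarrow> real^'m) \<Rightarrow> (real^'m \<Rightarrow> ereal) \<Rightarrow> (real^'d) measure \<Rightarrow> real^'d \<Rightarrow> real^'m \<Rightarrow> real^'m" where
  "w_drift g U \<rho> x w = tangent_proj w (\<integral>y. potential_grad U (g x - g y) \<partial>\<rho>)"

text \<open>Formal adjoint of the right-hand side of the mean-field equation, applied to a test
  function \<open>\<phi>\<close>; the terms \<open>\<nabla>\<^sub>x \<phi> \<bullet> v\<close> and \<open>\<nabla>\<^sub>w \<phi> \<bullet> v\<close> are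
  the derivatives of \<open>\<phi>\<close> in the directions \<open>(v, 0)\<close> and \<open>(0, v)\<close>.\<close>

definition generator ::
  "diffusion \<Rightarrow> (real^'d \<Rightarrow> real^'m) \<Rightarrow> (real^'m \<Rightarrow> ereal) \<Rightarrow> real \<Rightarrow> real \<Rightarrow> real \<Rightarrow> real \<Rightarrow>
   (real^'d) measure \<Rightarrow> ((real^'d) \<times> (real^'m) \<Rightarrow> real) \<Rightarrow> (real^'d) \<times> (real^'m) \<Rightarrow> real" where
  "generator dif g U \<alpha> lam \<sigma> \<tau> \<rho> \<phi> z =
     (let x = fst z; w = snd z; y = attracting_point g \<alpha> \<rho> w in
        lam * frechet_derivative \<phi> (at z) (y - x, 0)
      + \<sigma>\<^sup>2 / 2 * (\<Sum>l\<in>UNIV. diffusion_coeff dif l (x - y) *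
          frechet_derivative (\<lambda>z'. frechet_derivative \<phi> (at z') (axis l 1, 0)) (at z) (axis l 1, 0))
      + \<tau> * frechet_derivative \<phi> (at z) (0, w_drift g U \<rho> x w))"

text \<open>Weak solutions, in the form integrated in time. The generator is integrated over
  \<^term>\<open>UNIV \<times> Omega\<close>, which carries \<^term>\<open>f s\<close>, because the \<open>w\<close>-drift
  has a meaning only for \<open>w\<close> in \<^term>\<open>Omega\<close>.\<close>

definition mean_field_solution ::
  "diffusion \<Rightarrow> (real^'d \<Rightarrow> real^'m) \<Rightarrow> (real^'m \<Rightarrow> ereal) \<Rightarrow> real \<Rightarrow> real \<Rightarrow> real \<Rightarrow> real \<Rightarrow>
   ((real^'d) \<times> (real^'m)) measure \<Rightarrow> (real \<Rightarrow> ((real^'d) \<times> (real^'m)) measure) \<Rightarrow> bool" where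
  "mean_field_solution dif g U \<alpha> lam \<sigma> \<tau> f0 f \<longleftrightarrow>
     continuous_prob2 (UNIV \<times> Omega) f \<and> f 0 = f0 \<and>
     (\<forall>\<phi>. test_function \<phi> \<longrightarrow> (\<forall>t\<ge>0.
        ((\<lambda>s. LINT z:UNIV \<times> Omega|f s. generator dif g U \<alpha> lam \<sigma> \<tau> (x_marginal (f s)) \<phi> z)
          has_integral ((\<integral>z. \<phi> z \<partial>f t) - (\<integral>z. \<phi> z \<partial>f 0))) {0..t}))"


section \<open>Errors\<close>

text \<open>The integral is restricted to \<^term>\<open>UNIV \<times> Omega\<close> since the values of
  \<open>xbar\<close> outside \<^term>\<open>Omega\<close> are arbitrary, possibly not measurable.\<close>

definition l2_error :: "(real^'m \<Rightarrow> real^'d) \<Rightarrow> ((real^'d) \<times> (real^'m)) measure \<Rightarrow> real" where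
  "l2_error xbar M = (LINT z:UNIV \<times> Omega|M. (norm (fst z - xbar (snd z)))\<^sup>2)"

definition generational_distance :: "(real^'d \<Rightarrow> real^'m) \<Rightarrow> (real^'d) measure \<Rightarrow> real" where
  "generational_distance g \<rho> = sqrt (\<integral>x. (infdist (g x) (Pareto_front g))\<^sup>2 \<partial>\<rho>)"

end

theory Submission
  imports Defs
begin

text \<open>Let \<open>V t\<close> be the expectation of \<open>|x - xbar w|\<^sup>2\<close> under \<open>f t\<close>. As long as the attracting point stays
  within a small distance \<open>\<delta>\<close> of \<open>xbar w\<close> for all \<open>w\<close> and \<open>V \<ge> \<epsilon>\<close>, testing the equation with
  \<open>|x - xbar w|\<^sup>2\<close> gives \<open>V' \<le> - \<nu> V\<close> with \<open>\<nu> = lam - \<kappa> \<sigma>\<^sup>2 - C \<tau> / sqrt \<epsilon>\<close>; hence \<open>V\<close> reaches \<open>\<epsilon>\<close> before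
  a time that depends only on the data. The distance of the attracting point is controlled by the
  Laplace principle, which needs a lower bound on the mass of \<open>\<rho> t\<close> near \<open>xbar w\<close>. Such a bound
  decays at most exponentially in time, at a rate independent of \<open>\<alpha>\<close>, because the diffusion beats
  any bounded drift near the boundary of the support of a smooth bump. For large \<open>\<alpha>\<close> the Laplace
  principle then improves the bound \<open>\<delta>\<close> to \<open>3 \<delta> / 4\<close>, and a continuation argument, based on the
  continuity of the attracting point in time, closes the loop. The generational distance is at
  most \<open>L\<close> times the square root of \<open>V\<close>.\<close>

section \<open>Smooth functions\<close>

text \<open>The obstacle is a circular dependence: proximity of the attracting points to the
  minimizers requires \<alpha> large relative to the mass near the minimizers, while that mass
  evolves under a drift that itself depends on \<alpha>. Two kinds of estimates are therefore kept
  apart. Bounds that degenerate as \<alpha> grows (the a priori size of the attracting point, its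
  modulus of continuity in time) only justify integrability, limits and continuity at fixed
  \<alpha>. Every quantitative constant is fixed before \<alpha>: \<delta> from the slack in the
  rate condition, a time horizon from \<nu>, a radius from the stability bounds, and the least mass
  up to the horizon.

  The slack exists because the energy dissipates at rate
  \<open>2 * lam - \<kappa> * \<sigma>\<^sup>2\<close>, which exceeds the claimed \<nu> by more than
  \<open>lam\<close>. As long as the energy is at least \<epsilon>, its square root is at most a
  constant times itself, so error terms that are linear in the distance can be paid for. The energy
  is neither compactly supported nor smooth, hence the two approximations: cutoffs in space and
  polynomials along the curve.\<close>

definition flat_exp :: "nat \<Rightarrow> real \<Rightarrow> real" where
  "flat_exp k t = (if t \<le> 0 then 0 else exp (- (1 / t)) / t ^ k)"

lemma flat_exp_nonneg: "0 \<le> flat_exp k t"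
  by (simp add: flat_exp_def)

lemma exp_ge_power_div_fact:
  fixes x :: real
  assumes "0 \<le> x"
  shows "x ^ n / fact n \<le> exp x"
proof -
  have "sum (\<lambda>n. x ^ n /\<^sub>R fact n) {n} \<le> exp x"
    unfolding exp_def using assms by (intro sum_le_suminf summable_exp_generic) auto
  then show ?thesis by (simp add: divide_inverse mult.commute)
qed

text \<open>\<open>exp (1 / t)\<close> dominates the single term of order \<open>k + n\<close> of
  its series, which cancels the pole of order \<open>k\<close> and leaves \<open>n\<close> powers of
  \<open>t\<close>. The case \<open>n = 0\<close> bounds the function, and \<open>n = 2\<close>
  makes it differentiable at the origin.\<close>

lemma flat_exp_le: "0 \<le> t \<Longrightarrow> flat_exp k t \<le> fact (k + n) * t ^ n"
proof (cases "t = 0")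
  case False
  assume "0 \<le> t"
  with False have t: "0 < t" by simp
  have "(1 / t) ^ (k + n) / fact (k + n) \<le> exp (1 / t)"
    using t by (intro exp_ge_power_div_fact) simp
  then have "1 \<le> exp (1 / t) * (fact (k + n) * t ^ (k + n))"
    using t by (simp add: field_simps power_one_over)
  then show ?thesis
    using t by (simp add: flat_exp_def exp_minus field_simps power_add)
qed (simp add: flat_exp_def)

lemma flat_exp_bounded: "\<bar>flat_exp k t\<bar> \<le> fact k"
  using flat_exp_le[of t k 0] by (cases "t \<le> 0") (auto simp: flat_exp_nonneg, simp add: flat_exp_def)

text \<open>The index \<open>k\<close> exists for this formula: differentiating
  \<open>exp (- (1 / t)) / t ^ k\<close> only produces higher powers in the denominator, so the
  family is closed under differentiation up to linear combinations.\<close>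

lemma flat_exp_has_real_derivative:
  "(flat_exp k has_real_derivative flat_exp (k + 2) t - real k * flat_exp (k + 1) t) (at t)"
proof -
  consider "t < 0" | "t = 0" | "t > 0" by linarith
  then show ?thesis
  proof cases
    case 1
    have "((\<lambda>_. 0) has_real_derivative 0) (at t)" by simp
    then have "(flat_exp k has_real_derivative 0) (at t)"
      by (rule has_field_derivative_transform_within_open[where S = "{..<0}"])
        (use 1 in \<open>auto simp: flat_exp_def\<close>)
    then show ?thesis using 1 by (simp add: flat_exp_def)
  next
    case 2
    have "((\<lambda>h. flat_exp k h / h) \<longlongrightarrow> 0) (at 0)"
    proof (rule Lim_null_comparison)
      show "\<forall>\<^sub>F h in at 0. norm (flat_exp k h / h) \<le> fact (k + 2) * \<bar>h\<bar>"
      proof (rule always_eventually, rule allI)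
        fix h :: real
        have "0 \<le> fact (k + 2) * \<bar>h\<bar>" by (intro mult_nonneg_nonneg) auto
        then show "norm (flat_exp k h / h) \<le> fact (k + 2) * \<bar>h\<bar>"
        proof (cases "h \<le> 0")
          case False
          then show ?thesis using flat_exp_le[of h k 2] flat_exp_nonneg[of k h]
            by (simp add: field_simps power2_eq_square)
        qed (simp add: flat_exp_def)
      qed
      show "((\<lambda>h::real. fact (k + 2) * \<bar>h\<bar>) \<longlongrightarrow> 0) (at 0)"
        by (auto intro!: tendsto_eq_intros)
    qed
    then show ?thesis using 2 by (simp add: flat_exp_def DERIV_def)
  next
    case 3
    \<comment> \<open>In the variable \<open>1 / t\<close> the function is a power times a decaying
      exponential, so no negative exponents occur.\<close>
    have w: "((\<lambda>t. 1 / t) has_real_derivative - ((1 / t)\<^sup>2)) (at t)"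
      using 3 by (auto intro!: derivative_eq_intros simp: power2_eq_square)
    have g: "((\<lambda>w. exp (- w) * w ^ k) has_real_derivative
        (real k * w ^ (k - 1) - w ^ k) * exp (- w)) (at w)" for w :: real
      by (auto intro!: derivative_eq_intros simp: algebra_simps)
    have "((\<lambda>t. exp (- (1 / t)) * (1 / t) ^ k) has_real_derivative
        (real k * (1 / t) ^ (k - 1) - (1 / t) ^ k) * exp (- (1 / t)) * - ((1 / t)\<^sup>2)) (at t)"
      using DERIV_chain2[OF g w] .
    moreover have "(real k * v ^ (k - 1) - v ^ k) * exp (- v) * - (v\<^sup>2) =
        exp (- v) * v ^ (k + 2) - real k * (exp (- v) * v ^ (k + 1))" for v :: real
      by (cases k) (simp_all add: algebra_simps power2_eq_square)
    ultimately have "((\<lambda>t. exp (- (1 / t)) * (1 / t) ^ k) has_real_derivative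
        exp (- (1 / t)) * (1 / t) ^ (k + 2) - real k * (exp (- (1 / t)) * (1 / t) ^ (k + 1))) (at t)"
      by metis
    then have "((\<lambda>t. exp (- (1 / t)) / t ^ k) has_real_derivative
        exp (- (1 / t)) / t ^ (k + 2) - real k * (exp (- (1 / t)) / t ^ (k + 1))) (at t)"
      by (simp add: power_one_over)
    then have "(flat_exp k has_real_derivative
        exp (- (1 / t)) / t ^ (k + 2) - real k * (exp (- (1 / t)) / t ^ (k + 1))) (at t)"
      by (rule has_field_derivative_transform_within_open[where S = "{0<..}"])
        (use 3 in \<open>auto simp: flat_exp_def\<close>)
    then show ?thesis using 3 by (simp add: flat_exp_def)
  qed
qed

text \<open>This class is closed under directional derivatives, so its members are infinitely
  differentiable.\<close>

inductive smooth_fun :: "('a::euclidean_space \<Rightarrow> real) \<Rightarrow> bool" where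
  const: "smooth_fun (\<lambda>_. c)"
| inner: "smooth_fun (\<lambda>z. z \<bullet> b)"
| add: "smooth_fun u \<Longrightarrow> smooth_fun v \<Longrightarrow> smooth_fun (\<lambda>z. u z + v z)"
| mult: "smooth_fun u \<Longrightarrow> smooth_fun v \<Longrightarrow> smooth_fun (\<lambda>z. u z * v z)"
| flat: "smooth_fun u \<Longrightarrow> smooth_fun (\<lambda>z. flat_exp k (u z))"

text \<open>One derivative field has to serve both claims: it is the derivative at every point, and
  each of its directional components is again in the class. Differentiability of all orders then
  follows by iteration.\<close>

lemma smooth_fun_has_derivative:
  assumes "smooth_fun \<phi>"
  shows "\<exists>D. (\<forall>z. (\<phi> has_derivative D z) (at z)) \<and> (\<forall>v. smooth_fun (\<lambda>z. D z v))"
  using assms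
proof induction
  case (const c)
  show ?case by (rule exI[of _ "\<lambda>_ _. 0"]) (auto intro: smooth_fun.const)
next
  case (inner b)
  show ?case by (rule exI[of _ "\<lambda>_ v. v \<bullet> b"])
      (auto intro!: smooth_fun.const derivative_eq_intros)
next
  case (add u v)
  then obtain D E where D: "\<forall>z. (u has_derivative D z) (at z)" "\<forall>w. smooth_fun (\<lambda>z. D z w)"
    and E: "\<forall>z. (v has_derivative E z) (at z)" "\<forall>w. smooth_fun (\<lambda>z. E z w)" by blast
  show ?case
  proof (intro exI[of _ "\<lambda>z w. D z w + E z w"] conjI allI)
    show "((\<lambda>z. u z + v z) has_derivative (\<lambda>w. D z w + E z w)) (at z)" for z
      using has_derivative_add[OF D(1)[rule_format] E(1)[rule_format]] .
    show "smooth_fun (\<lambda>z. D z w + E z w)" for w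
      using smooth_fun.add[OF D(2)[rule_format] E(2)[rule_format]] .
  qed
next
  case (mult u v)
  then obtain D E where D: "\<forall>z. (u has_derivative D z) (at z)" "\<forall>w. smooth_fun (\<lambda>z. D z w)"
    and E: "\<forall>z. (v has_derivative E z) (at z)" "\<forall>w. smooth_fun (\<lambda>z. E z w)" by blast
  show ?case
  proof (intro exI[of _ "\<lambda>z w. u z * E z w + D z w * v z"] conjI allI)
    show "((\<lambda>z. u z * v z) has_derivative (\<lambda>w. u z * E z w + D z w * v z)) (at z)" for z
      using has_derivative_mult[OF D(1)[rule_format] E(1)[rule_format]] .
    show "smooth_fun (\<lambda>z. u z * E z w + D z w * v z)" for w
      using smooth_fun.add[OF smooth_fun.mult[OF mult.hyps(1) E(2)[rule_format]]
          smooth_fun.mult[OF D(2)[rule_format] mult.hyps(2)]] .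
  qed
next
  case (flat u k)
  then obtain D where D: "\<forall>z. (u has_derivative D z) (at z)" "\<forall>w. smooth_fun (\<lambda>z. D z w)"
    by blast
  let ?F = "\<lambda>z. flat_exp (k + 2) (u z) + (- real k) * flat_exp (k + 1) (u z)"
  have "((\<lambda>z. flat_exp k (u z)) has_derivative (\<lambda>w. ?F z * D z w)) (at z)" for z
    using has_derivative_compose[OF D(1)[rule_format, of z]
        flat_exp_has_real_derivative[of k "u z", unfolded has_field_derivative_def]] by simp
  moreover have "smooth_fun ?F"
    using flat.hyps by (intro smooth_fun.add smooth_fun.mult smooth_fun.const smooth_fun.flat)
  then have "smooth_fun (\<lambda>z. ?F z * D z w)" for w
    using D(2) by (intro smooth_fun.mult) auto
  ultimately show ?case by (intro exI[of _ "\<lambda>z w. ?F z * D z w"] conjI allI)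
qed

lemma smooth_fun_differentiable:
  assumes "smooth_fun \<phi>"
  shows "\<phi> differentiable (at z)"
  using smooth_fun_has_derivative[OF assms] unfolding differentiable_def by blast

lemma smooth_fun_frechet:
  assumes "smooth_fun \<phi>"
  shows "smooth_fun (\<lambda>z. frechet_derivative \<phi> (at z) v)"
proof -
  obtain D where D: "\<forall>z. (\<phi> has_derivative D z) (at z)" "\<forall>v. smooth_fun (\<lambda>z. D z v)"
    using smooth_fun_has_derivative[OF assms] by blast
  then have "(\<lambda>z. frechet_derivative \<phi> (at z) v) = (\<lambda>z. D z v)"
    by (metis frechet_derivative_at)
  then show ?thesis using D by simp
qed

lemma smooth_fun_continuous: "smooth_fun \<phi> \<Longrightarrow> continuous_on S \<phi>"
  by (meson differentiable_imp_continuous_within continuous_at_imp_continuous_on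
      smooth_fun_differentiable)

lemma smooth_fun_C_k: "smooth_fun \<phi> \<Longrightarrow> C_k n \<phi>"
  by (induction n arbitrary: \<phi>)
    (auto simp: smooth_fun_continuous smooth_fun_differentiable smooth_fun_frechet)

lemma smooth_fun_diff: "smooth_fun u \<Longrightarrow> smooth_fun v \<Longrightarrow> smooth_fun (\<lambda>z. u z - v z)"
  using smooth_fun.add[OF _ smooth_fun.mult[OF smooth_fun.const[of "-1"]], of u v] by simp

lemma smooth_fun_sum:
  "(\<And>i. i \<in> I \<Longrightarrow> smooth_fun (u i)) \<Longrightarrow> smooth_fun (\<lambda>z. \<Sum>i\<in>I. u i z)"
  by (induction I rule: infinite_finite_induct) (auto intro: smooth_fun.intros)

lemma smooth_fun_prod:
  "(\<And>i. i \<in> I \<Longrightarrow> smooth_fun (u i)) \<Longrightarrow> smooth_fun (\<lambda>z. \<Prod>i\<in>I. u i z)"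
  by (induction I rule: infinite_finite_induct) (auto intro: smooth_fun.intros)

lemma smooth_fun_power: "smooth_fun u \<Longrightarrow> smooth_fun (\<lambda>z. u z ^ n)"
  by (induction n) (auto intro: smooth_fun.intros)

lemma smooth_fun_inner_self: "smooth_fun (\<lambda>z. z \<bullet> z)"
proof -
  have "(\<lambda>z::'a. z \<bullet> z) = (\<lambda>z. \<Sum>b\<in>Basis. (z \<bullet> b) * (z \<bullet> b))"
    by (simp add: euclidean_inner[symmetric])
  then show ?thesis by (auto intro!: smooth_fun_sum smooth_fun.intros)
qed

lemmas smooth_fun_intros = smooth_fun.intros smooth_fun_diff smooth_fun_sum smooth_fun_prod
  smooth_fun_power smooth_fun_inner_self

lemma smooth_fun_has_frechet_derivative:
  "smooth_fun \<phi> \<Longrightarrow> (\<phi> has_derivative frechet_derivative \<phi> (at z)) (at z)"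
  using smooth_fun_differentiable frechet_derivative_works by blast

lemma smooth_fun_frechet_linear: "smooth_fun \<phi> \<Longrightarrow> linear (frechet_derivative \<phi> (at z))"
  using smooth_fun_differentiable linear_frechet_derivative by blast

text \<open>Reduces the explicit computations for bumps and cutoffs to one-variable calculus along a
  line.\<close>

lemma frechet_derivative_eq_DERIV:
  assumes "smooth_fun \<phi>" "((\<lambda>t. \<phi> (z + t *\<^sub>R v)) has_real_derivative D) (at 0)"
  shows "frechet_derivative \<phi> (at z) v = D"
proof -
  have "((\<lambda>t::real. z + t *\<^sub>R v) has_derivative (\<lambda>t. t *\<^sub>R v)) (at 0)"
    by (auto intro!: derivative_eq_intros)
  from has_derivative_compose[OF this, of \<phi>] smooth_fun_has_frechet_derivative[OF assms(1), of z]
  have "((\<lambda>t. \<phi> (z + t *\<^sub>R v)) has_derivative (\<lambda>t. frechet_derivative \<phi> (at z) (t *\<^sub>R v))) (at 0)"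
    by simp
  moreover have "(\<lambda>t. frechet_derivative \<phi> (at z) (t *\<^sub>R v)) =
      (\<lambda>t. frechet_derivative \<phi> (at z) v * t)"
    using linear_scale[OF smooth_fun_frechet_linear[OF assms(1)]] by auto
  ultimately have "((\<lambda>t. \<phi> (z + t *\<^sub>R v)) has_real_derivative frechet_derivative \<phi> (at z) v) (at 0)"
    by (simp add: has_field_derivative_def)
  then show ?thesis using assms(2) DERIV_unique by blast
qed

lemma frechet_derivative_mult:
  assumes "smooth_fun u" "smooth_fun v"
  shows "frechet_derivative (\<lambda>z. u z * v z) (at z) h =
    u z * frechet_derivative v (at z) h + frechet_derivative u (at z) h * v z"
  using frechet_derivative_at[OF has_derivative_mult[OF smooth_fun_has_frechet_derivative[OF assms(1)]
      smooth_fun_has_frechet_derivative[OF assms(2)]], symmetric]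
  by (rule fun_cong)

lemma frechet_derivative_plus:
  assumes "smooth_fun u" "smooth_fun v"
  shows "frechet_derivative (\<lambda>z. u z + v z) (at z) h =
    frechet_derivative u (at z) h + frechet_derivative v (at z) h"
  using frechet_derivative_at[OF has_derivative_add[OF smooth_fun_has_frechet_derivative[OF assms(1)]
      smooth_fun_has_frechet_derivative[OF assms(2)]], symmetric]
  by (rule fun_cong)

text \<open>The direction may vary with the point; linearity reduces it to finitely many derivatives
  in fixed basis directions, which are continuous functions.\<close>

lemma smooth_fun_frechet_measurable:
  assumes "smooth_fun (\<phi> :: 'a::euclidean_space \<Rightarrow> real)"
    and v: "v \<in> borel_measurable M" and z: "z \<in> borel_measurable M"
  shows "(\<lambda>x. frechet_derivative \<phi> (at (z x)) (v x)) \<in> borel_measurable M"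
proof -
  have "frechet_derivative \<phi> (at (z x)) (v x) =
      (\<Sum>b\<in>Basis. (v x \<bullet> b) * frechet_derivative \<phi> (at (z x)) b)" for x
  proof -
    have "frechet_derivative \<phi> (at (z x)) (v x) =
        frechet_derivative \<phi> (at (z x)) (\<Sum>b\<in>Basis. (v x \<bullet> b) *\<^sub>R b)"
      by (simp add: euclidean_representation)
    then show ?thesis
      using smooth_fun_frechet_linear[OF assms(1), of "z x"]
      by (simp add: linear_sum linear_scale)
  qed
  moreover have "(\<lambda>x. frechet_derivative \<phi> (at (z x)) b) \<in> borel_measurable M" for b
    using measurable_compose[OF z borel_measurable_continuous_onI[OF
          smooth_fun_continuous[OF smooth_fun_frechet[OF assms(1), of b]]]] .
  ultimately show ?thesis using v by simp
qed

section \<open>Bump and cutoff functions\<close>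

text \<open>The standard mollifier \<open>exp (- 1 / (1 - x\<^sup>2))\<close>, not normalised. The
  next two definitions are its first and second derivative in closed form, so that their behaviour
  near the end points can be compared.\<close>

definition bump :: "real \<Rightarrow> real" where
  "bump x = flat_exp 0 (1 - x\<^sup>2)"

definition bump' :: "real \<Rightarrow> real" where
  "bump' x = - 2 * x * flat_exp 2 (1 - x\<^sup>2)"

definition bump'' :: "real \<Rightarrow> real" where
  "bump'' x = 4 * x\<^sup>2 * (flat_exp 4 (1 - x\<^sup>2) - 2 * flat_exp 3 (1 - x\<^sup>2)) - 2 * flat_exp 2 (1 - x\<^sup>2)"

lemma flat_exp_comp_DERIV:
  assumes "(u has_real_derivative u') (at x within S)"
  shows "((\<lambda>x. flat_exp k (u x)) has_real_derivative
    (flat_exp (k + 2) (u x) - real k * flat_exp (k + 1) (u x)) * u') (at x within S)"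
  using DERIV_chain2[OF flat_exp_has_real_derivative assms] .

lemma bump_DERIV: "(bump has_real_derivative bump' x) (at x)"
proof -
  have "((\<lambda>x. 1 - x\<^sup>2) has_real_derivative - 2 * x) (at x)"
    by (auto intro!: derivative_eq_intros)
  from flat_exp_comp_DERIV[OF this, of 0] show ?thesis
    by (simp add: bump_def[abs_def] bump'_def numeral_2_eq_2 mult.commute)
qed

lemma bump'_DERIV: "(bump' has_real_derivative bump'' x) (at x)"
proof -
  have 1: "((\<lambda>x. 1 - x\<^sup>2) has_real_derivative - 2 * x) (at x)"
    by (auto intro!: derivative_eq_intros)
  have 2: "((\<lambda>x. - 2 * x) has_real_derivative - 2) (at x)"
    by (auto intro!: derivative_eq_intros)
  have e: "2 + 2 = (4::nat)" "2 + 1 = (3::nat)" by simp_all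
  from DERIV_mult[OF 2 flat_exp_comp_DERIV[OF 1, of 2]] show ?thesis
    unfolding bump'_def[abs_def] bump''_def e
    by (rule DERIV_cong) (simp add: algebra_simps power2_eq_square)
qed

lemma bump_nonneg: "0 \<le> bump x"
  by (simp add: bump_def flat_exp_nonneg)

lemma bump_le_1: "bump x \<le> 1"
  using flat_exp_bounded[of 0 "1 - x\<^sup>2"] by (simp add: bump_def)

lemma bump_eq_0: "1 \<le> \<bar>x\<bar> \<Longrightarrow> bump x = 0" "1 \<le> \<bar>x\<bar> \<Longrightarrow> bump' x = 0" "1 \<le> \<bar>x\<bar> \<Longrightarrow> bump'' x = 0"
  by (auto simp: bump_def bump'_def bump''_def flat_exp_def abs_square_le_1 one_le_power
      dest: power_mono[of 1 "\<bar>x\<bar>" 2])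

lemma bump_half: "\<bar>x\<bar> \<le> 1 / 2 \<Longrightarrow> exp (- (4 / 3)) \<le> bump x"
proof -
  assume "\<bar>x\<bar> \<le> 1 / 2"
  then have x: "x\<^sup>2 \<le> 1 / 4"
    using power_mono[of "\<bar>x\<bar>" "1 / 2" 2] by (simp add: power_divide)
  then have "1 / (1 - x\<^sup>2) \<le> 4 / 3" by (simp add: field_simps)
  then show ?thesis using x by (simp add: bump_def flat_exp_def)
qed

text \<open>Near the boundary of its support the second derivative of the bump dominates the square of
  the first; this is what lets the diffusion compensate an arbitrary drift.\<close>

lemma bump_drift_diffusion:
  assumes "0 < \<sigma>" "u\<^sup>2 \<le> D" "D \<le> B" "0 < r" "\<bar>x\<bar> < 1"
  shows "- (lam\<^sup>2 / \<sigma>\<^sup>2 + 2500 * \<sigma>\<^sup>2 * B / r\<^sup>2) * bump x \<le>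
    - lam * u * (bump' x / r) + \<sigma>\<^sup>2 / 2 * D * (bump'' x / r\<^sup>2)"
proof -
  define s where "s = 1 - x\<^sup>2"
  have s: "0 < s" "s \<le> 1"
    using assms(5) by (auto simp: s_def abs_square_less_1)
  \<comment> \<open>The common factor \<open>E\<close> is the bump itself; \<open>v\<close> and
    \<open>k\<close> are the quotients of its first and second derivative by it. Both blow up as
    \<open>s\<close> tends to 0, but \<open>k\<close> does so at least as fast as a multiple of
    \<open>v\<^sup>2\<close>.\<close>
  define E where "E = exp (- (1 / s))"
  define v where "v = - 2 * x / s\<^sup>2"
  define k where "k = 4 * x\<^sup>2 / s ^ 4 - 8 * x\<^sup>2 / s ^ 3 - 2 / s\<^sup>2"
  have b: "bump x = E" "bump' x = E * v" "bump'' x = E * k"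
    using s by (auto simp: bump_def bump'_def bump''_def flat_exp_def E_def v_def k_def s_def[symmetric]
        algebra_simps)
  have x2: "x\<^sup>2 = 1 - s" by (simp add: s_def)
  \<comment> \<open>Origin of the constant 5000: multiplied by \<open>s ^ 4\<close>, the inequality
    \<open>v\<^sup>2 / 2 - 5000 \<le> k\<close> says that this polynomial is nonnegative. For
    \<open>s \<le> 1 / 5\<close> the term \<open>2 - 10 * s\<close> already is; beyond that
    \<open>5000 * s ^ 4 \<ge> 8\<close> outweighs it.\<close>
  have "0 \<le> 6 * s\<^sup>2" "0 \<le> 5000 * s ^ 4" using s by simp_all
  moreover have "8 \<le> 5000 * s ^ 4" if "1 / 5 < s"
    using power_mono[of "1 / 5" s 4] that by (simp add: power_divide)
  ultimately have "0 \<le> 2 - 10 * s + 6 * s\<^sup>2 + 5000 * s ^ 4"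
    using s by argo
  also have "2 - 10 * s + 6 * s\<^sup>2 + 5000 * s ^ 4 = (k + 5000 - v\<^sup>2 / 2) * s ^ 4"
  proof -
    have "k * s ^ 4 = 4 * x\<^sup>2 - 8 * x\<^sup>2 * s - 2 * s\<^sup>2"
      using s by (simp add: k_def left_diff_distrib power4_eq_xxxx power3_eq_cube power2_eq_square)
    moreover have "v\<^sup>2 * s ^ 4 = 4 * x\<^sup>2"
      using s by (simp add: v_def power_divide power_mult_distrib power4_eq_xxxx power2_eq_square)
    moreover have "(k + 5000 - v\<^sup>2 / 2) * s ^ 4 = k * s ^ 4 + 5000 * s ^ 4 - v\<^sup>2 * s ^ 4 / 2"
      by (simp add: algebra_simps)
    ultimately show ?thesis unfolding x2 by (simp add: algebra_simps power2_eq_square)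
  qed
  finally have k: "v\<^sup>2 / 2 - 5000 \<le> k"
    using s by (simp add: zero_le_mult_iff)
  define a where "a = u / r * v"
  have D: "(u / r)\<^sup>2 \<le> D / r\<^sup>2" "0 \<le> D" "D / r\<^sup>2 \<le> B / r\<^sup>2"
    using assms by (auto simp: power_divide divide_right_mono intro: order_trans[of 0 "u\<^sup>2"])
  \<comment> \<open>The hypothesis \<open>u\<^sup>2 \<le> D\<close> serves the quadratic term,
    \<open>D \<le> B\<close> the constant one.\<close>
  have "a\<^sup>2 / 2 - 5000 * (B / r\<^sup>2) \<le> D / r\<^sup>2 * (v\<^sup>2 / 2) - 5000 * (D / r\<^sup>2)"
  proof -
    have "a\<^sup>2 \<le> D / r\<^sup>2 * v\<^sup>2"
      using mult_right_mono[OF D(1), of "v\<^sup>2"]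
      unfolding a_def power_mult_distrib by simp
    then show ?thesis using D(3) by simp
  qed
  also have "\<dots> = D / r\<^sup>2 * (v\<^sup>2 / 2 - 5000)" by (simp add: algebra_simps)
  also have "\<dots> \<le> D / r\<^sup>2 * k" using k D by (intro mult_left_mono) auto
  finally have 1: "\<sigma>\<^sup>2 / 2 * (a\<^sup>2 / 2 - 5000 * (B / r\<^sup>2)) \<le> \<sigma>\<^sup>2 / 2 * (D / r\<^sup>2 * k)"
    by (intro mult_left_mono) auto
  \<comment> \<open>Completing the square: the drift costs
    \<open>lam\<^sup>2 / \<sigma>\<^sup>2\<close> plus
    \<open>\<sigma>\<^sup>2 / 4 * a\<^sup>2\<close>, and the latter is exactly what the diffusion
    supplies.\<close>
  have "0 \<le> (lam / \<sigma> - \<sigma> * a / 2)\<^sup>2" by simp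
  also have "(lam / \<sigma> - \<sigma> * a / 2)\<^sup>2 = lam\<^sup>2 / \<sigma>\<^sup>2 - lam * a + \<sigma>\<^sup>2 / 4 * a\<^sup>2"
    using assms(1) by (simp add: power2_eq_square field_simps)
  finally have "0 \<le> lam\<^sup>2 / \<sigma>\<^sup>2 - lam * a + \<sigma>\<^sup>2 / 4 * a\<^sup>2" .
  have "- (lam\<^sup>2 / \<sigma>\<^sup>2 + 2500 * \<sigma>\<^sup>2 * B / r\<^sup>2) \<le> - lam * a + \<sigma>\<^sup>2 / 2 * (D / r\<^sup>2 * k)"
  proof -
    have "\<sigma>\<^sup>2 / 2 * (a\<^sup>2 / 2 - 5000 * (B / r\<^sup>2)) = \<sigma>\<^sup>2 / 4 * a\<^sup>2 - 2500 * \<sigma>\<^sup>2 * B / r\<^sup>2"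
      by (simp add: algebra_simps)
    then show ?thesis using 1 \<open>0 \<le> lam\<^sup>2 / \<sigma>\<^sup>2 - lam * a + \<sigma>\<^sup>2 / 4 * a\<^sup>2\<close> by linarith
  qed
  then have "- (lam\<^sup>2 / \<sigma>\<^sup>2 + 2500 * \<sigma>\<^sup>2 * B / r\<^sup>2) * E \<le> (- lam * a + \<sigma>\<^sup>2 / 2 * (D / r\<^sup>2 * k)) * E"
    by (intro mult_right_mono) (auto simp: E_def)
  also have "\<dots> = - lam * u * (E * v / r) + \<sigma>\<^sup>2 / 2 * D * (E * k / r\<^sup>2)"
    by (simp add: a_def algebra_simps)
  finally show ?thesis unfolding b .
qed

text \<open>The product form lets coordinate \<open>l\<close> of the drift be compared with
  diffusion coefficient \<open>l\<close> alone, so that one scalar inequality covers both types of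
  noise. Independence of the second component keeps the drift in \<open>w\<close> out of the mass
  estimate.\<close>

definition box_bump :: "real^'d \<Rightarrow> real \<Rightarrow> (real^'d) \<times> 'b::euclidean_space \<Rightarrow> real" where
  "box_bump c r z = (\<Prod>l\<in>UNIV. bump ((fst z $ l - c $ l) / r))"

lemma smooth_fun_nth_fst: "smooth_fun (\<lambda>z :: (real^'d) \<times> 'b::euclidean_space. fst z $ l)"
proof -
  have "(\<lambda>z :: (real^'d) \<times> 'b. fst z $ l) = (\<lambda>z. z \<bullet> (axis l 1, 0))"
    by (auto simp: inner_axis inner_prod_def)
  then show ?thesis by (auto intro: smooth_fun_intros)
qed

lemma smooth_fun_scaled: "smooth_fun (\<lambda>z :: (real^'d) \<times> 'b::euclidean_space. (fst z $ l - c) / r)"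
  unfolding divide_inverse
  by (intro smooth_fun.mult smooth_fun_diff smooth_fun_nth_fst smooth_fun.const)

lemma smooth_fun_bump: "smooth_fun u \<Longrightarrow> smooth_fun (\<lambda>z. bump (u z))"
  unfolding bump_def by (intro smooth_fun_intros)

lemma smooth_fun_box_bump: "smooth_fun (box_bump c r :: (real^'d) \<times> 'b::euclidean_space \<Rightarrow> real)"
  unfolding box_bump_def[abs_def] by (intro smooth_fun_prod smooth_fun_bump smooth_fun_scaled)

lemma box_bump_nonneg: "0 \<le> box_bump c r z"
  by (simp add: box_bump_def prod_nonneg bump_nonneg)

lemma box_bump_le_1: "box_bump c r z \<le> 1"
  unfolding box_bump_def by (intro prod_le_1) (auto simp: bump_nonneg bump_le_1)

lemma box_bump_split:
  "box_bump c r z = bump ((fst z $ l - c $ l) / r) * (\<Prod>j\<in>UNIV - {l}. bump ((fst z $ j - c $ j) / r))"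
  unfolding box_bump_def by (rule prod.remove) auto

lemma box_bump_frechet:
  assumes "r \<noteq> 0"
  shows "frechet_derivative (box_bump c r) (at (z :: (real^'d) \<times> 'b::euclidean_space)) (axis l 1, 0) =
    bump' ((fst z $ l - c $ l) / r) / r * (\<Prod>j\<in>UNIV - {l}. bump ((fst z $ j - c $ j) / r))"
proof (rule frechet_derivative_eq_DERIV[OF smooth_fun_box_bump])
  let ?P = "\<Prod>j\<in>UNIV - {l}. bump ((fst z $ j - c $ j) / r)"
  have "box_bump c r (z + t *\<^sub>R (axis l 1, 0)) = bump ((fst z $ l + t - c $ l) / r) * ?P" for t
    unfolding box_bump_split[of _ _ _ l]
    by (auto simp: axis_def intro!: arg_cong2[where f = "(*)"] prod.cong)
  moreover have "((\<lambda>t. bump ((fst z $ l + t - c $ l) / r) * ?P) has_real_derivative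
      bump' ((fst z $ l - c $ l) / r) / r * ?P) (at 0)"
  proof -
    have "((\<lambda>t. (fst z $ l + t - c $ l) / r) has_real_derivative 1 / r) (at 0)"
      using assms by (auto intro!: derivative_eq_intros)
    from DERIV_chain2[OF bump_DERIV this] have "((\<lambda>t. bump ((fst z $ l + t - c $ l) / r))
      has_real_derivative bump' ((fst z $ l - c $ l) / r) / r) (at 0)" by simp
    from DERIV_cmult_right[OF this, of ?P] show ?thesis by simp
  qed
  ultimately show "((\<lambda>t. box_bump c r (z + t *\<^sub>R (axis l 1, 0))) has_real_derivative
      bump' ((fst z $ l - c $ l) / r) / r * ?P) (at 0)" by simp
qed

lemma box_bump_frechet2:
  assumes "r \<noteq> 0"
  shows "frechet_derivative (\<lambda>z'. frechet_derivative (box_bump c r) (at z') (axis l 1, 0))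
      (at (z :: (real^'d) \<times> 'b::euclidean_space)) (axis l 1, 0) =
    bump'' ((fst z $ l - c $ l) / r) / r\<^sup>2 * (\<Prod>j\<in>UNIV - {l}. bump ((fst z $ j - c $ j) / r))"
proof (rule frechet_derivative_eq_DERIV[OF smooth_fun_frechet[OF smooth_fun_box_bump]])
  let ?P = "\<Prod>j\<in>UNIV - {l}. bump ((fst z $ j - c $ j) / r)"
  have "frechet_derivative (box_bump c r) (at (z + t *\<^sub>R (axis l 1, 0))) (axis l 1, 0) =
      bump' ((fst z $ l + t - c $ l) / r) / r * ?P" for t
    unfolding box_bump_frechet[OF assms]
    by (auto simp: axis_def intro!: arg_cong2[where f = "(*)"] prod.cong)
  moreover have "((\<lambda>t. bump' ((fst z $ l + t - c $ l) / r) / r * ?P) has_real_derivative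
      bump'' ((fst z $ l - c $ l) / r) / r\<^sup>2 * ?P) (at 0)"
  proof -
    have "((\<lambda>t. (fst z $ l + t - c $ l) / r) has_real_derivative 1 / r) (at 0)"
      using assms by (auto intro!: derivative_eq_intros)
    from DERIV_chain2[OF bump'_DERIV this] have "((\<lambda>t. bump' ((fst z $ l + t - c $ l) / r))
      has_real_derivative bump'' ((fst z $ l - c $ l) / r) / r) (at 0)" by simp
    from DERIV_cmult_right[OF DERIV_cdivide[OF this, of r], of ?P] show ?thesis
      by (simp add: power2_eq_square)
  qed
  ultimately show "((\<lambda>t. frechet_derivative (box_bump c r) (at (z + t *\<^sub>R (axis l 1, 0))) (axis l 1, 0))
      has_real_derivative bump'' ((fst z $ l - c $ l) / r) / r\<^sup>2 * ?P) (at 0)" by simp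
qed

section \<open>Cutoffs at infinity\<close>

definition cutoff :: "real \<Rightarrow> 'a::euclidean_space \<Rightarrow> real" where
  "cutoff R z = exp 1 * flat_exp 0 (1 - z \<bullet> z / R\<^sup>2)"

lemma smooth_fun_cutoff: "smooth_fun (cutoff R)"
  unfolding cutoff_def[abs_def] divide_inverse by (intro smooth_fun_intros)

lemma norm_less_imp: "1 - z \<bullet> z / R\<^sup>2 \<le> 0" if "R \<le> norm z" "0 < R" for z :: "'a::euclidean_space"
  using power_mono[OF that(1), of 2] that(2) by (simp add: power2_norm_eq_inner)

text \<open>The factor \<open>exp 1\<close> normalises the value at the origin to 1, which is also
  the maximum, since \<open>1 / (1 - q) \<ge> 1\<close> for \<open>0 \<le> q < 1\<close>.\<close>

lemma cutoff_bounds: "0 \<le> cutoff R z" "cutoff R z \<le> 1"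
proof -
  show "0 \<le> cutoff R z" by (simp add: cutoff_def flat_exp_nonneg)
  have "exp 1 * flat_exp 0 (1 - q) \<le> 1" if "0 \<le> q" for q :: real
  proof (cases "1 - q \<le> 0")
    case False
    then have "1 \<le> 1 / (1 - q)" using that by (simp add: le_divide_eq)
    then have "exp (- (1 / (1 - q))) \<le> exp (- 1)" by simp
    then have "exp 1 * exp (- (1 / (1 - q))) \<le> exp 1 * exp (- 1)"
      by (intro mult_left_mono) auto
    then show ?thesis using False by (simp add: flat_exp_def exp_minus)
  qed (simp add: flat_exp_def)
  then show "cutoff R z \<le> 1" by (simp add: cutoff_def)
qed

lemma cutoff_eq_0: "R \<le> norm z \<Longrightarrow> 0 < R \<Longrightarrow> cutoff R z = 0"
  using norm_less_imp[of R z] by (simp add: cutoff_def flat_exp_def)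

lemma inner_self_line_DERIV:
  "((\<lambda>t. 1 - (z + t *\<^sub>R v) \<bullet> (z + t *\<^sub>R v) / R\<^sup>2) has_real_derivative - 2 * (z \<bullet> v) / R\<^sup>2) (at 0)"
proof -
  have "(\<lambda>t. 1 - (z + t *\<^sub>R v) \<bullet> (z + t *\<^sub>R v) / R\<^sup>2) =
      (\<lambda>t. 1 - (z \<bullet> z + t * (2 * (z \<bullet> v)) + t\<^sup>2 * (v \<bullet> v)) / R\<^sup>2)"
    by (auto simp: inner_add_left inner_add_right inner_commute power2_eq_square algebra_simps)
  moreover have "((\<lambda>t. 1 - (z \<bullet> z + t * (2 * (z \<bullet> v)) + t\<^sup>2 * (v \<bullet> v)) / R\<^sup>2)
      has_real_derivative - (2 * (z \<bullet> v)) / R\<^sup>2) (at 0)"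
    by (rule DERIV_cong[OF DERIV_diff[OF DERIV_const DERIV_cdivide[where D = "2 * (z \<bullet> v)"]]])
       (auto intro!: derivative_eq_intros)
  ultimately show ?thesis by simp
qed

lemma cutoff_frechet:
  "frechet_derivative (cutoff R) (at z) v =
    exp 1 * (flat_exp 2 (1 - z \<bullet> z / R\<^sup>2) * (- 2 * (z \<bullet> v) / R\<^sup>2))"
  using DERIV_cmult[OF flat_exp_comp_DERIV[OF inner_self_line_DERIV[of z v R], of 0], of "exp 1"]
  by (intro frechet_derivative_eq_DERIV[OF smooth_fun_cutoff]) (simp add: cutoff_def numeral_2_eq_2)

lemma cutoff_frechet2:
  "frechet_derivative (\<lambda>z'. frechet_derivative (cutoff R) (at z') v) (at z) v =
    exp 1 * ((flat_exp 4 (1 - z \<bullet> z / R\<^sup>2) - 2 * flat_exp 3 (1 - z \<bullet> z / R\<^sup>2)) * (2 * (z \<bullet> v) / R\<^sup>2)\<^sup>2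
      - flat_exp 2 (1 - z \<bullet> z / R\<^sup>2) * (2 * (v \<bullet> v) / R\<^sup>2))"
proof (rule frechet_derivative_eq_DERIV[OF smooth_fun_frechet[OF smooth_fun_cutoff]])
  have e: "2 + 2 = (4::nat)" "2 + 1 = (3::nat)" by simp_all
  have "((\<lambda>t. - 2 * ((z + t *\<^sub>R v) \<bullet> v) / R\<^sup>2) has_real_derivative - 2 * (v \<bullet> v) / R\<^sup>2) (at 0)"
  proof -
    have "(\<lambda>t. - 2 * ((z + t *\<^sub>R v) \<bullet> v) / R\<^sup>2) = (\<lambda>t. (- 2 * (z \<bullet> v) + t * (- 2 * (v \<bullet> v))) / R\<^sup>2)"
      by (auto simp: inner_add_left algebra_simps)
    moreover have "((\<lambda>t. (- 2 * (z \<bullet> v) + t * (- 2 * (v \<bullet> v))) / R\<^sup>2)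
        has_real_derivative - 2 * (v \<bullet> v) / R\<^sup>2) (at 0)"
      by (rule DERIV_cdivide) (auto intro!: derivative_eq_intros)
    ultimately show ?thesis by simp
  qed
  from DERIV_cmult[OF DERIV_mult[OF flat_exp_comp_DERIV[OF inner_self_line_DERIV[of z v R], of 2] this],
      of "exp 1"]
  show "((\<lambda>t. frechet_derivative (cutoff R) (at (z + t *\<^sub>R v)) v) has_real_derivative
    exp 1 * ((flat_exp 4 (1 - z \<bullet> z / R\<^sup>2) - 2 * flat_exp 3 (1 - z \<bullet> z / R\<^sup>2)) * (2 * (z \<bullet> v) / R\<^sup>2)\<^sup>2
      - flat_exp 2 (1 - z \<bullet> z / R\<^sup>2) * (2 * (v \<bullet> v) / R\<^sup>2))) (at 0)"
    unfolding cutoff_frechet e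
    by (rule DERIV_cong) (simp add: algebra_simps power2_eq_square)
qed

lemma inner_le_cutoff:
  assumes "norm z < R"
  shows "\<bar>2 * (z \<bullet> v) / R\<^sup>2\<bar> \<le> 2 * norm v / R"
proof -
  have R: "0 < R" using assms norm_ge_zero[of z] by linarith
  have "\<bar>z \<bullet> v\<bar> \<le> R * norm v"
    using Cauchy_Schwarz_ineq2[of z v] mult_right_mono[of "norm z" R "norm v"] assms by simp
  then show ?thesis using R by (simp add: field_simps power2_eq_square abs_mult)
qed

lemma cutoff_frechet_bound:
  assumes "0 < R"
  shows "\<bar>frechet_derivative (cutoff R) (at z) v\<bar> \<le> 12 * norm v / R"
    and "R \<le> norm z \<Longrightarrow> frechet_derivative (cutoff R) (at z) v = 0"
proof -
  show 0: "R \<le> norm z \<Longrightarrow> frechet_derivative (cutoff R) (at z) v = 0"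
    using norm_less_imp[OF _ assms, of z] by (simp add: cutoff_frechet flat_exp_def)
  show "\<bar>frechet_derivative (cutoff R) (at z) v\<bar> \<le> 12 * norm v / R"
  proof (cases "R \<le> norm z")
    case True
    then show ?thesis using 0 assms by simp
  next
    case False
    then have "\<bar>flat_exp 2 (1 - z \<bullet> z / R\<^sup>2) * (- 2 * (z \<bullet> v) / R\<^sup>2)\<bar> \<le> 2 * (2 * norm v / R)"
      unfolding abs_mult
      using flat_exp_bounded[of 2 "1 - z \<bullet> z / R\<^sup>2"] inner_le_cutoff[of z R v]
      by (intro mult_mono) (auto simp: numeral_2_eq_2)
    \<comment> \<open>The constant 12 is \<open>3 * 2 * 2\<close>: \<open>exp 1 \<le> 3\<close>,
      \<open>\<bar>flat_exp 2\<bar> \<le> fact 2\<close>, and the factor 2 from differentiating the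
      square.\<close>
    then have "\<bar>frechet_derivative (cutoff R) (at z) v\<bar> \<le> 3 * (2 * (2 * norm v / R))"
      unfolding cutoff_frechet abs_mult[of "exp 1"]
      using exp_le by (intro mult_mono) auto
    then show ?thesis by simp
  qed
qed

lemma cutoff_frechet2_bound:
  assumes "0 < R"
  shows "\<bar>frechet_derivative (\<lambda>z'. frechet_derivative (cutoff R) (at z') v) (at z) v\<bar> \<le>
      500 * (norm v)\<^sup>2 / R\<^sup>2"
    and "R \<le> norm z \<Longrightarrow> frechet_derivative (\<lambda>z'. frechet_derivative (cutoff R) (at z') v) (at z) v = 0"
proof -
  show 0: "R \<le> norm z \<Longrightarrow> frechet_derivative (\<lambda>z'. frechet_derivative (cutoff R) (at z') v) (at z) v = 0"
    using norm_less_imp[OF _ assms, of z] by (simp add: cutoff_frechet2 flat_exp_def)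
  show "\<bar>frechet_derivative (\<lambda>z'. frechet_derivative (cutoff R) (at z') v) (at z) v\<bar> \<le>
      500 * (norm v)\<^sup>2 / R\<^sup>2"
  proof (cases "R \<le> norm z")
    case True
    then show ?thesis using 0 assms by simp
  next
    case False
    let ?s = "1 - z \<bullet> z / R\<^sup>2"
    \<comment> \<open>The bound 36 is \<open>fact 4 + 2 * fact 3\<close>. In total this leads to
      \<open>3 * (36 * 4 + 4) = 444\<close>, rounded up to 500.\<close>
    have f: "\<bar>flat_exp 4 ?s - 2 * flat_exp 3 ?s\<bar> \<le> 36" "\<bar>flat_exp 2 ?s\<bar> \<le> 2"
      using flat_exp_bounded[of 4 ?s] flat_exp_bounded[of 3 ?s] flat_exp_bounded[of 2 ?s]
      by (auto simp: fact_numeral)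
    have "(2 * (z \<bullet> v) / R\<^sup>2)\<^sup>2 \<le> (2 * norm v / R)\<^sup>2"
      using inner_le_cutoff[of z R v] False assms by (simp add: abs_le_square_iff[symmetric])
    then have 1: "\<bar>(flat_exp 4 ?s - 2 * flat_exp 3 ?s) * (2 * (z \<bullet> v) / R\<^sup>2)\<^sup>2\<bar> \<le> 36 * (2 * norm v / R)\<^sup>2"
      unfolding abs_mult using f by (intro mult_mono) auto
    have 2: "\<bar>flat_exp 2 ?s * (2 * (v \<bullet> v) / R\<^sup>2)\<bar> \<le> 2 * (2 * (norm v)\<^sup>2 / R\<^sup>2)"
      unfolding abs_mult using f by (intro mult_mono) (auto simp: power2_norm_eq_inner)
    have "\<bar>(flat_exp 4 ?s - 2 * flat_exp 3 ?s) * (2 * (z \<bullet> v) / R\<^sup>2)\<^sup>2 - flat_exp 2 ?s * (2 * (v \<bullet> v) / R\<^sup>2)\<bar>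
        \<le> 36 * (2 * norm v / R)\<^sup>2 + 2 * (2 * (norm v)\<^sup>2 / R\<^sup>2)"
      using 1 2 by linarith
    also have "\<dots> = 148 * ((norm v)\<^sup>2 / R\<^sup>2)" by (simp add: power_divide power_mult_distrib)
    finally have "\<bar>frechet_derivative (\<lambda>z'. frechet_derivative (cutoff R) (at z') v) (at z) v\<bar> \<le>
        3 * (148 * ((norm v)\<^sup>2 / R\<^sup>2))"
      unfolding cutoff_frechet2 abs_mult[of "exp 1"]
      using exp_le by (intro mult_mono) auto
    also have "\<dots> \<le> 500 * (norm v)\<^sup>2 / R\<^sup>2" using assms by (simp add: divide_right_mono)
    finally show ?thesis .
  qed
qed

lemma cutoff_tendsto: "(\<lambda>n. cutoff (real (Suc n)) z) \<longlonglongrightarrow> 1"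
proof -
  have "(\<lambda>n. 1 / real (Suc n)) \<longlonglongrightarrow> 0"
    using LIMSEQ_inverse_real_of_nat by (simp add: inverse_eq_divide)
  then have "(\<lambda>n. 1 - z \<bullet> z * (1 / real (Suc n))\<^sup>2) \<longlonglongrightarrow> 1 - z \<bullet> z * 0\<^sup>2"
    by (intro tendsto_intros)
  then have "(\<lambda>n. 1 - z \<bullet> z / (real (Suc n))\<^sup>2) \<longlonglongrightarrow> 1" by (simp add: power_divide)
  moreover have "isCont (flat_exp 0) 1"
    using flat_exp_has_real_derivative DERIV_isCont by blast
  ultimately have "(\<lambda>n. flat_exp 0 (1 - z \<bullet> z / (real (Suc n))\<^sup>2)) \<longlonglongrightarrow> flat_exp 0 1"
    by (rule isCont_tendsto_compose[rotated])
  from tendsto_mult[OF tendsto_const[of "exp 1"] this] show ?thesis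
    by (simp add: cutoff_def flat_exp_def exp_minus)
qed

lemma test_function_mult_cutoff:
  assumes "smooth_fun \<phi>" "0 < R"
  shows "test_function (\<lambda>z. \<phi> z * cutoff R z)"
proof -
  have "closure {z. \<phi> z * cutoff R z \<noteq> 0} \<subseteq> cball 0 R"
    using cutoff_eq_0[OF _ assms(2)] by (intro closure_minimal subsetI) (force, simp)
  then have "compact (closure {z. \<phi> z * cutoff R z \<noteq> 0})"
    by (meson bounded_cball bounded_subset closed_closure compact_eq_bounded_closed)
  then show ?thesis
    unfolding test_function_def
    using smooth_fun_C_k[OF smooth_fun.mult[OF assms(1) smooth_fun_cutoff]] by blast
qed

section \<open>Wasserstein continuity and a Gronwall inequality\<close>

text \<open>Integrands whose local Lipschitz constant grows at most linearly; these are the ones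
  whose expectation is controlled by the 2-Wasserstein distance. Keeping the constant
  \<open>A\<close> explicit allows estimates that are uniform over families of integrands.\<close>

definition quad_lipschitz :: "'a::euclidean_space set \<Rightarrow> real \<Rightarrow> ('a \<Rightarrow> 'b::euclidean_space) \<Rightarrow> bool" where
  "quad_lipschitz S A h \<longleftrightarrow> 0 \<le> A \<and> h \<in> borel_measurable borel \<and>
     (\<forall>z\<in>S. \<forall>z'\<in>S. norm (h z - h z') \<le> A * (1 + norm z + norm z') * dist z z')"

lemma prob2_on_moments:
  assumes "prob2_on S (M :: 'a::euclidean_space measure)"
  shows "prob_space M" "sets M = sets borel" "AE z in M. z \<in> S"
    "integrable M (\<lambda>z. (norm z)\<^sup>2)" "integrable M (\<lambda>z. norm z)" "integrable M (\<lambda>z. z)"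
proof -
  show 1: "prob_space M" "sets M = sets borel" "AE z in M. z \<in> S" "integrable M (\<lambda>z. (norm z)\<^sup>2)"
    using assms by (auto simp: prob2_on_def prob_on_def)
  interpret prob_space M by fact
  have [measurable_cong]: "sets M = sets borel" by fact
  have "norm x \<le> 1 + (norm x)\<^sup>2" for x :: 'a
    using sum_squares_ge_zero[of "norm x - 1" "norm x"] by (simp add: power2_eq_square algebra_simps)
  then show "integrable M (\<lambda>z. norm z)"
    by (intro Bochner_Integration.integrable_bound[OF Bochner_Integration.integrable_add[OF
            integrable_const[of 1] 1(4)]]) auto
  then show "integrable M (\<lambda>z. z)"
    by (subst integrable_norm_iff[symmetric]) auto
qed

lemma integrable_quadratic_growth:
  assumes M: "prob2_on S (M :: 'a::euclidean_space measure)"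
    and h: "h \<in> borel_measurable M" "\<And>z. z \<in> S \<Longrightarrow> norm (h z) \<le> K * (1 + (norm z)\<^sup>2)"
  shows "integrable M (h :: 'a \<Rightarrow> 'b::euclidean_space)"
proof -
  note m = prob2_on_moments[OF M]
  interpret prob_space M by fact
  show ?thesis
  proof (rule Bochner_Integration.integrable_bound)
    show "integrable M (\<lambda>z. K * (1 + (norm z)\<^sup>2))"
      using m(4) by (intro integrable_mult_right Bochner_Integration.integrable_add integrable_const)
    show "AE z in M. norm (h z) \<le> norm (K * (1 + (norm z)\<^sup>2))"
      using m(3) by eventually_elim (use h(2) in fastforce)
  qed (rule h(1))
qed

lemma quad_lipschitz_integrable:
  assumes M: "prob2_on S (M :: 'a::euclidean_space measure)"
    and h: "quad_lipschitz S A h"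
  shows "integrable M (h :: 'a \<Rightarrow> 'b::euclidean_space)"
proof -
  note m = prob2_on_moments[OF M]
  interpret prob_space M by fact
  \<comment> \<open>A probability measure carried by \<open>S\<close> forces \<open>S\<close> to be
    nonempty; growth is then measured from any point of \<open>S\<close>.\<close>
  have "\<exists>z0. z0 \<in> S"
    using m(3) AE_False by (metis (mono_tags, lifting) eventually_mono)
  then obtain z0 where z0: "z0 \<in> S" by blast
  have A: "0 \<le> A" using h by (simp add: quad_lipschitz_def)
  define B where "B = (1 + norm z0)\<^sup>2"
  show ?thesis
  proof (rule integrable_quadratic_growth[OF M])
    show "h \<in> borel_measurable M"
      using h m(2) by (auto simp: quad_lipschitz_def cong: measurable_cong_sets)
    fix z assume z: "z \<in> S"
    have "norm (h z) \<le> norm (h z0) + norm (h z - h z0)" by norm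
    also have "norm (h z - h z0) \<le> A * (1 + norm z + norm z0) * dist z z0"
      using h z z0 by (auto simp: quad_lipschitz_def)
    also have "dist z z0 \<le> 1 + norm z + norm z0" by norm
    also have "A * (1 + norm z + norm z0) * (1 + norm z + norm z0) = A * (norm z + (1 + norm z0))\<^sup>2"
      by (simp add: power2_eq_square algebra_simps)
    also have "(norm z + (1 + norm z0))\<^sup>2 \<le> 2 * (norm z)\<^sup>2 + 2 * (1 + norm z0)\<^sup>2"
      using sum_squares_ge_zero[of "norm z - (1 + norm z0)" 0] by (simp add: power2_eq_square algebra_simps)
    also have "2 * (norm z)\<^sup>2 + 2 * (1 + norm z0)\<^sup>2 \<le> 2 * B * (1 + (norm z)\<^sup>2)"
    proof -
      have "1 \<le> B" by (simp add: B_def)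
      from mult_right_mono[OF this, of "(norm z)\<^sup>2"] show ?thesis by (simp add: B_def algebra_simps)
    qed
    also have "norm (h z0) + A * (2 * B * (1 + (norm z)\<^sup>2)) \<le> (norm (h z0) + 2 * A * B) * (1 + (norm z)\<^sup>2)"
      by (simp add: algebra_simps)
    finally show "norm (h z) \<le> (norm (h z0) + 2 * A * B) * (1 + (norm z)\<^sup>2)"
      using A by (simp add: mult_left_mono)
  qed
qed

text \<open>The definition of a coupling does not mention total mass; it is inherited from the first
  marginal, as are the supports from the respective marginals.\<close>

lemma couplings_D:
  assumes K: "K \<in> couplings M N"
    and M: "prob_on S (M :: 'a::euclidean_space measure)" and N: "prob_on S N"
  shows "prob_space K" "sets K = sets borel" "distr K borel fst = M" "distr K borel snd = N"
    "AE z in K. fst z \<in> S" "AE z in K. snd z \<in> S"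
    "fst \<in> measurable K borel" "snd \<in> measurable K borel"
proof -
  show 1: "sets K = sets borel" "distr K borel fst = M" "distr K borel snd = N"
    using K by (auto simp: couplings_def)
  show 2: "fst \<in> measurable K borel" "snd \<in> measurable K borel"
    by (auto simp: measurable_cong_sets[OF 1(1) refl] intro!: borel_measurable_continuous_onI continuous_intros)
  show "AE z in K. fst z \<in> S" "AE z in K. snd z \<in> S"
    using M N AE_distrD[OF 2(1)] AE_distrD[OF 2(2)] unfolding 1 prob_on_def by blast+
  have "emeasure M (space M) = 1"
    using M by (simp add: prob_on_def prob_space.emeasure_space_1)
  then have "emeasure K (fst -` space M \<inter> space K) = 1"
    using emeasure_distr[OF 2(1), of "space M"] unfolding 1(2)[symmetric] by simp
  moreover have "fst -` space M \<inter> space K = space K"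
    unfolding 1(2)[symmetric] by auto
  ultimately show "prob_space K" by (intro prob_spaceI) simp
qed

lemma young_inequality:
  fixes a b \<eta> :: real
  assumes "0 < \<eta>"
  shows "a * b \<le> \<eta> * a\<^sup>2 + b\<^sup>2 / (4 * \<eta>)"
proof -
  have "0 \<le> (2 * \<eta> * a - b)\<^sup>2" by simp
  then have "4 * \<eta> * (a * b) \<le> 4 * \<eta> * (\<eta> * a\<^sup>2 + b\<^sup>2 / (4 * \<eta>))"
    using assms by (simp add: power2_eq_square algebra_simps)
  then show ?thesis using assms by simp
qed

text \<open>The Lipschitz bound is integrated against a coupling of cost below \<open>c\<close>.
  Bounding the growth factor by \<open>1 + 2 * norm (snd z)\<close> plus the distance, and splitting
  the product by Young's inequality, leaves only a moment of \<open>N\<close>. No moment of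
  \<open>M\<close> enters, which permits \<open>N\<close> to be held fixed while \<open>M\<close>
  approaches it.\<close>

lemma integral_diff_W2:
  fixes h :: "'a::euclidean_space \<Rightarrow> 'b::euclidean_space"
  assumes M: "prob2_on S M" and N: "prob2_on S N"
    and W: "W2_sq M N < ennreal c" "0 \<le> c" and "0 < \<eta>"
    and h: "quad_lipschitz S A h"
  shows "norm ((\<integral>z. h z \<partial>M) - (\<integral>z. h z \<partial>N)) \<le>
    A * (\<eta> * (\<integral>z. (1 + 2 * norm z)\<^sup>2 \<partial>N) + (1 + 1 / (4 * \<eta>)) * c)"
proof -
  have A: "0 \<le> A" and h_meas: "h \<in> borel_measurable borel"
    and hd: "\<And>z z'. z \<in> S \<Longrightarrow> z' \<in> S \<Longrightarrow> norm (h z - h z') \<le> A * (1 + norm z + norm z') * dist z z'"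
    using h by (auto simp: quad_lipschitz_def)
  obtain K where K: "K \<in> couplings M N"
    and Kc: "(\<integral>\<^sup>+ z. ennreal ((dist (fst z) (snd z))\<^sup>2) \<partial>K) < ennreal c"
    using W(1) unfolding W2_sq_def by (auto simp: INF_less_iff)
  have MN: "prob_on S M" "prob_on S N" using M N by (auto simp: prob2_on_def)
  note k = couplings_D[OF K MN]
  interpret prob_space K by fact
  have D_meas: "(\<lambda>z. dist (fst z) (snd z)) \<in> borel_measurable K"
    by (auto simp: measurable_cong_sets[OF k(2) refl] intro!: borel_measurable_continuous_onI continuous_intros)
  have D_int: "integrable K (\<lambda>z. (dist (fst z) (snd z))\<^sup>2)"
    using D_meas Kc by (intro integrableI_nonneg) (auto intro: order.strict_trans)
  have D_le: "(\<integral>z. (dist (fst z) (snd z))\<^sup>2 \<partial>K) \<le> c"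
    using Kc nn_integral_eq_integral[OF D_int] W(2) by (simp add: ennreal_less_iff)
  have hM: "integrable K (\<lambda>z. h (fst z))"
    by (rule integrable_distr[OF k(7)]) (simp add: k(3) quad_lipschitz_integrable[OF M h])
  have hN: "integrable K (\<lambda>z. h (snd z))"
    by (rule integrable_distr[OF k(8)]) (simp add: k(4) quad_lipschitz_integrable[OF N h])
  have q_int: "integrable N (\<lambda>z. (1 + 2 * norm z)\<^sup>2)"
  proof (rule integrable_quadratic_growth[OF N])
    show "(\<lambda>z. (1 + 2 * norm z)\<^sup>2) \<in> borel_measurable N"
      by (subst measurable_cong_sets[OF prob2_on_moments(2)[OF N] refl]) measurable
    show "norm ((1 + 2 * norm z)\<^sup>2) \<le> 8 * (1 + (norm z)\<^sup>2)" for z :: 'a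
      using sum_squares_ge_zero[of "2 * norm z - 1" 1] by (simp add: power2_eq_square algebra_simps)
  qed
  then have qK: "integrable K (\<lambda>z. (1 + 2 * norm (snd z))\<^sup>2)"
    by (intro integrable_distr[OF k(8)]) (simp add: k(4))
  have "(\<integral>z. h z \<partial>M) - (\<integral>z. h z \<partial>N) = (\<integral>z. h (fst z) - h (snd z) \<partial>K)"
    using hM hN integral_distr[OF k(7) h_meas] integral_distr[OF k(8) h_meas] by (simp add: k(3,4))
  also have "norm \<dots> \<le> (\<integral>z. norm (h (fst z) - h (snd z)) \<partial>K)"
    by (rule integral_norm_bound)
  also have "\<dots> \<le> (\<integral>z. A * (\<eta> * (1 + 2 * norm (snd z))\<^sup>2 + (1 + 1 / (4 * \<eta>)) * (dist (fst z) (snd z))\<^sup>2) \<partial>K)"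
  proof (rule integral_mono_AE)
    show "integrable K (\<lambda>z. norm (h (fst z) - h (snd z)))" using hM hN by simp
    show "integrable K (\<lambda>z. A * (\<eta> * (1 + 2 * norm (snd z))\<^sup>2 + (1 + 1 / (4 * \<eta>)) * (dist (fst z) (snd z))\<^sup>2))"
      using qK D_int by simp
    show "AE z in K. norm (h (fst z) - h (snd z)) \<le>
        A * (\<eta> * (1 + 2 * norm (snd z))\<^sup>2 + (1 + 1 / (4 * \<eta>)) * (dist (fst z) (snd z))\<^sup>2)"
      using k(5,6)
    proof eventually_elim
      case (elim z)
      let ?D = "dist (fst z) (snd z)" and ?n = "1 + 2 * norm (snd z)"
      have "1 + norm (fst z) + norm (snd z) \<le> ?n + ?D" by norm
      then have "(1 + norm (fst z) + norm (snd z)) * ?D \<le> (?n + ?D) * ?D"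
        by (intro mult_right_mono) auto
      moreover have "?n * ?D \<le> \<eta> * ?n\<^sup>2 + ?D\<^sup>2 / (4 * \<eta>)"
        using young_inequality[OF assms(5)] .
      ultimately have "(1 + norm (fst z) + norm (snd z)) * ?D \<le> \<eta> * ?n\<^sup>2 + (1 + 1 / (4 * \<eta>)) * ?D\<^sup>2"
        by (simp add: algebra_simps power2_eq_square)
      from mult_left_mono[OF this A] hd[OF elim] show ?case by (simp add: mult.assoc)
    qed
  qed
  also have "\<dots> = A * (\<eta> * (\<integral>z. (1 + 2 * norm z)\<^sup>2 \<partial>N) + (1 + 1 / (4 * \<eta>)) * (\<integral>z. (dist (fst z) (snd z))\<^sup>2 \<partial>K))"
    using qK D_int integral_distr[OF k(8), of "\<lambda>z. (1 + 2 * norm z)\<^sup>2"] by (simp add: k(4))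
  also have "\<dots> \<le> A * (\<eta> * (\<integral>z. (1 + 2 * norm z)\<^sup>2 \<partial>N) + (1 + 1 / (4 * \<eta>)) * c)"
    using D_le A assms(5) by (intro mult_left_mono add_left_mono) auto
  finally show ?thesis .
qed

text \<open>The point is the order of quantifiers: \<open>d\<close> is chosen before the integrand,
  so one neighbourhood in time serves the integrands attached to all weights \<open>w\<close> at
  once.\<close>

lemma continuous_prob2_uniform:
  fixes f :: "real \<Rightarrow> 'a::euclidean_space measure"
  assumes f: "continuous_prob2 S f" and t: "0 \<le> t" and e: "0 < e"
  shows "\<exists>d>0. \<forall>s\<ge>0. \<bar>s - t\<bar> < d \<longrightarrow> (\<forall>A (h :: 'a \<Rightarrow> 'b::euclidean_space). quad_lipschitz S A h \<longrightarrow>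
    norm ((\<integral>z. h z \<partial>f s) - (\<integral>z. h z \<partial>f t)) \<le> A * e)"
proof -
  define Q where "Q = (\<integral>z. (1 + 2 * norm z)\<^sup>2 \<partial>f t)"
  have Q: "0 \<le> Q" by (simp add: Q_def)
  \<comment> \<open>The choices of \<eta> and \<open>c\<close> make each of the two terms in
    \<open>integral_diff_W2\<close> at most \<open>e / 2\<close>, up to the factor
    \<open>A\<close>.\<close>
  define \<eta> where "\<eta> = e / (2 * (Q + 1))"
  have \<eta>: "0 < \<eta>" "\<eta> * Q \<le> e / 2"
    using Q e by (auto simp: \<eta>_def field_simps)
  define c where "c = e / 2 / (1 + 1 / (4 * \<eta>))"
  have "0 < 1 + 1 / (4 * \<eta>)" using \<eta> by (simp add: add_pos_pos)
  then have c: "0 < c" "(1 + 1 / (4 * \<eta>)) * c = e / 2"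
    unfolding c_def using e by (auto simp del: divide_divide_eq_left divide_divide_eq_right)
  have "((\<lambda>s. W2_sq (f s) (f t)) \<longlongrightarrow> 0) (at t within {0..})"
    using f t by (auto simp: continuous_prob2_def)
  moreover have "0 < ennreal c" using c by simp
  ultimately have "\<forall>\<^sub>F s in at t within {0..}. W2_sq (f s) (f t) < ennreal c"
    by (rule order_tendstoD(2))
  then obtain d where d: "d > 0" "\<And>s. s \<ge> 0 \<Longrightarrow> s \<noteq> t \<Longrightarrow> dist s t < d \<Longrightarrow> W2_sq (f s) (f t) < ennreal c"
    by (auto simp: eventually_at)
  show ?thesis
  proof (intro exI[of _ d] conjI allI impI d(1))
    fix s :: real and A and h :: "'a \<Rightarrow> 'b"
    assume s: "0 \<le> s" "\<bar>s - t\<bar> < d" and h: "quad_lipschitz S A h"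
    then have A: "0 \<le> A" by (simp add: quad_lipschitz_def)
    show "norm ((\<integral>z. h z \<partial>f s) - (\<integral>z. h z \<partial>f t)) \<le> A * e"
    proof (cases "s = t")
      case False
      have "prob2_on S (f s)" "prob2_on S (f t)"
        using f t s by (auto simp: continuous_prob2_def)
      then have "norm ((\<integral>z. h z \<partial>f s) - (\<integral>z. h z \<partial>f t)) \<le> A * (\<eta> * Q + (1 + 1 / (4 * \<eta>)) * c)"
        unfolding Q_def using d(2)[of s] s False c \<eta>(1) h
        by (intro integral_diff_W2) (auto simp: dist_real_def)
      also have "\<dots> \<le> A * e" using \<eta>(2) c(2) A by (intro mult_left_mono) auto
      finally show ?thesis .
    qed (use A e in simp)
  qed
qed

lemma continuous_on_integral_quad_lipschitz:
  fixes h :: "'a::euclidean_space \<Rightarrow> 'b::euclidean_space"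
  assumes f: "continuous_prob2 S f" and h: "quad_lipschitz S A h"
  shows "continuous_on {0..} (\<lambda>t. \<integral>z. h z \<partial>f t)"
  unfolding continuous_on_iff
proof (intro ballI allI impI)
  fix t e :: real assume t: "t \<in> {0..}" and e: "0 < e"
  have A: "0 \<le> A" using h by (simp add: quad_lipschitz_def)
  define e' where "e' = e / (A + 1)"
  have e': "0 < e'" "A * e' < e" using e A by (auto simp: e'_def field_simps)
  then obtain d where d: "d > 0" "\<forall>s\<ge>0. \<bar>s - t\<bar> < d \<longrightarrow> (\<forall>A (h :: 'a \<Rightarrow> 'b). quad_lipschitz S A h \<longrightarrow>
      norm ((\<integral>z. h z \<partial>f s) - (\<integral>z. h z \<partial>f t)) \<le> A * e')"
    using continuous_prob2_uniform[OF f, of t e', where 'b = 'b] t by auto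
  have "norm ((\<integral>z. h z \<partial>f s) - (\<integral>z. h z \<partial>f t)) \<le> A * e'"
    if "0 \<le> s" "\<bar>s - t\<bar> < d" for s
    using d(2) h that by blast
  then show "\<exists>d>0. \<forall>s\<in>{0..}. dist s t < d \<longrightarrow> dist (\<integral>z. h z \<partial>f s) (\<integral>z. h z \<partial>f t) < e"
    using d(1) e'(2) by (intro exI[of _ d]) (fastforce simp: dist_real_def dist_norm)
qed

lemma quad_lipschitz_norm_sq: "quad_lipschitz S 1 (\<lambda>z::'a::euclidean_space. (norm z)\<^sup>2)"
  unfolding quad_lipschitz_def
proof (intro conjI ballI)
  fix z z' :: 'a
  have "(norm z)\<^sup>2 - (norm z')\<^sup>2 = (norm z + norm z') * (norm z - norm z')"
    by (simp add: power2_eq_square algebra_simps)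
  also have "\<bar>\<dots>\<bar> \<le> (1 + norm z + norm z') * dist z z'"
    unfolding abs_mult using norm_triangle_ineq3[of z z'] by (intro mult_mono) (auto simp: dist_norm)
  finally show "norm ((norm z)\<^sup>2 - (norm z')\<^sup>2) \<le> 1 * (1 + norm z + norm z') * dist z z'" by simp
qed auto

lemma second_moment_bounded:
  assumes f: "continuous_prob2 S (f :: real \<Rightarrow> 'a::euclidean_space measure)"
  shows "\<exists>K. \<forall>s\<in>{0..t}. (\<integral>z. (norm z)\<^sup>2 \<partial>f s) \<le> K"
proof -
  have "continuous_on {0..t} (\<lambda>s. \<integral>z. (norm z)\<^sup>2 \<partial>f s)"
    using continuous_on_integral_quad_lipschitz[OF f quad_lipschitz_norm_sq]
    by (rule continuous_on_subset) auto
  then have "compact ((\<lambda>s. \<integral>z. (norm z)\<^sup>2 \<partial>f s) ` {0..t})"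
    by (intro compact_continuous_image) auto
  then have "bdd_above ((\<lambda>s. \<integral>z. (norm z)\<^sup>2 \<partial>f s) ` {0..t})"
    by (intro bounded_imp_bdd_above compact_imp_bounded)
  then show ?thesis by (auto simp: bdd_above_def)
qed

text \<open>The hypothesis concerns increments because the weak formulation yields integral
  identities and no pointwise derivative. No sign of \<open>u\<close> is assumed, so the lemma also
  applies to the negative of a mass and then gives a lower bound.\<close>

lemma gronwall_integral:
  fixes u :: "real \<Rightarrow> real"
  assumes u: "continuous_on {0..b} u" and \<nu>: "0 < \<nu>" and b: "0 \<le> b"
    and le: "\<And>s t. 0 \<le> s \<Longrightarrow> s \<le> t \<Longrightarrow> t \<le> b \<Longrightarrow> u t - u s \<le> - \<nu> * integral {s..t} u"
  shows "u b \<le> u 0 * exp (- \<nu> * b)"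
proof -
  define I where "I t = integral {0..t} u" for t
  define v where "v t = u t + \<nu> * I t" for t
  have int: "u integrable_on {s..t}" if "0 \<le> s" "t \<le> b" for s t
    using integrable_continuous_interval[OF continuous_on_subset[OF u]] that by simp
  have v_mono: "v t \<le> v s" if "0 \<le> s" "s \<le> t" "t \<le> b" for s t
  proof -
    have "I t = I s + integral {s..t} u"
      unfolding I_def using that int by (intro Henstock_Kurzweil_Integration.integral_combine[symmetric]) auto
    then show ?thesis using le[OF that] by (simp add: v_def algebra_simps)
  qed
  \<comment> \<open>An integrating factor for the primitive \<open>I\<close>. The shift by
    \<open>v b / \<nu>\<close> gives the derivative \<open>exp (\<nu> * s) * (v s - v b)\<close>,
    which is nonnegative as \<open>v\<close> decreases; comparing \<open>k\<close> at the two ends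
    yields \<open>u b * exp (\<nu> * b) \<le> v b\<close>.\<close>
  define k where "k s = exp (\<nu> * s) * (I s - v b / \<nu>)" for s
  have I': "(I has_real_derivative u s) (at s within {0..b})" if "s \<in> {0..b}" for s
    unfolding I_def[abs_def] using integral_has_real_derivative[OF u that] .
  have k': "(k has_real_derivative exp (\<nu> * s) * (v s - v b)) (at s within {0..b})" if "s \<in> {0..b}" for s
  proof -
    have "((\<lambda>s. exp (\<nu> * s)) has_real_derivative exp (\<nu> * s) * \<nu>) (at s within {0..b})"
      by (auto intro!: derivative_eq_intros)
    moreover have "((\<lambda>s. I s - v b / \<nu>) has_real_derivative u s) (at s within {0..b})"
      using DERIV_diff[OF I'[OF that] DERIV_const, of "v b / \<nu>"] by simp
    ultimately have "(k has_real_derivative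
        exp (\<nu> * s) * u s + exp (\<nu> * s) * \<nu> * (I s - v b / \<nu>)) (at s within {0..b})"
      unfolding k_def[abs_def] by (rule DERIV_mult')
    then show ?thesis
      by (rule DERIV_cong) (use \<nu> in \<open>simp add: v_def field_simps\<close>)
  qed
  have "k 0 \<le> k b"
  proof (rule DERIV_nonneg_imp_increasing_open[OF b])
    fix s assume s: "0 < s" "s < b"
    then have "(k has_real_derivative exp (\<nu> * s) * (v s - v b)) (at s)"
      using k'[of s] by (simp add: at_within_Icc_at)
    moreover have "0 \<le> exp (\<nu> * s) * (v s - v b)"
      using v_mono[of s b] s by simp
    ultimately show "\<exists>y. (k has_real_derivative y) (at s) \<and> 0 \<le> y" by blast
  next
    show "continuous_on {0..b} k" using k' by (rule DERIV_continuous_on)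
  qed
  then have "- v b \<le> exp (\<nu> * b) * (\<nu> * I b - v b)"
    using \<nu> by (simp add: k_def I_def field_simps)
  then have "u b * exp (\<nu> * b) \<le> v b" by (simp add: v_def algebra_simps)
  also have "v b \<le> u 0" using v_mono[of 0 b] b by (simp add: v_def I_def)
  finally show ?thesis by (simp add: exp_minus field_simps)
qed

section \<open>The weight simplex, the potential and the curve of minimizers\<close>

lemma Omega_2_iff: "w \<in> (Omega :: (real^2) set) \<longleftrightarrow> 0 \<le> w $ 1 \<and> 0 \<le> w $ 2 \<and> w $ 1 + w $ 2 = 1"
  by (auto simp: Omega_def sum_2 forall_2)

text \<open>The unit tangent of the segment, pointing from \<open>(0, 1)\<close> to
  \<open>(1, 0)\<close>; it is the constant velocity of \<open>Omega_arc\<close>.\<close>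

definition Omega_dir :: "real^2" where
  "Omega_dir = vector [1 / sqrt 2, - (1 / sqrt 2)]"

lemma norm_Omega_dir: "norm Omega_dir = 1"
  by (simp add: Omega_dir_def norm_vec_def L2_set_def sum_2 power_divide)

lemma Omega_arc_eq: "Omega_arc s = vector [0, 1] + s *\<^sub>R Omega_dir"
  by (simp add: Omega_arc_def Omega_dir_def vec_eq_iff forall_2)

lemma sqrt2_le_iff: "s / sqrt 2 \<le> 1 \<longleftrightarrow> s \<le> sqrt 2"
  by (simp add: divide_le_eq)

lemma Omega_arc_in_Omega: "s \<in> {0..sqrt 2} \<Longrightarrow> Omega_arc s \<in> Omega"
  by (auto simp: Omega_2_iff Omega_arc_def sqrt2_le_iff)

lemma Omega_arc_inverse:
  assumes "w \<in> (Omega :: (real^2) set)"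
  shows "sqrt 2 * w $ 1 \<in> {0..sqrt 2}" "Omega_arc (sqrt 2 * w $ 1) = w"
  using assms by (auto simp: Omega_2_iff Omega_arc_def vec_eq_iff forall_2)

lemma closed_Omega_2: "closed (Omega :: (real^2) set)"
proof -
  have "Omega = {w :: real^2. 0 \<le> w $ 1} \<inter> {w. 0 \<le> w $ 2} \<inter> {w. w $ 1 + w $ 2 = 1}"
    by (auto simp: Omega_2_iff)
  show ?thesis
    unfolding \<open>Omega = _\<close>
    by (intro closed_Int closed_Collect_le closed_Collect_eq continuous_intros)
qed

lemma norm_Omega_2: "w \<in> (Omega :: (real^2) set) \<Longrightarrow> norm w \<le> 1"
  using norm_le_l1_cart[of w] by (simp add: Omega_2_iff sum_2)

lemma compact_Omega_2: "compact (Omega :: (real^2) set)"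
  using closed_Omega_2 norm_Omega_2 by (auto simp: compact_eq_bounded_closed bounded_iff)

text \<open>At an end point the part of a tangential velocity that leaves the segment is removed.
  Since \<open>Omega_dir\<close> increases the first weight, only nonnegative multiples survive
  where \<open>w $ 1 = 0\<close> and only nonpositive ones where \<open>w $ 2 = 0\<close>.\<close>

definition cone_clip :: "real^2 \<Rightarrow> real \<Rightarrow> real" where
  "cone_clip w c = (if w $ 1 = 0 then max c 0 else if w $ 2 = 0 then min c 0 else c)"

lemma abs_cone_clip: "\<bar>cone_clip w c\<bar> \<le> \<bar>c\<bar>"
  by (auto simp: cone_clip_def)

text \<open>The cone spanned by \<open>Omega - w\<close> is already closed, so the closure adds
  nothing. A direction with positive first component is a multiple of the vector from
  \<open>w\<close> to the vertex \<open>(1, 0)\<close>, and one with negative first component points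
  to \<open>(0, 1)\<close>; the factor is found from \<open>1 - w $ 1 = w $ 2\<close>.\<close>

lemma tangent_cone_Omega:
  assumes "w \<in> (Omega :: (real^2) set)"
  shows "tangent_cone w Omega =
    {z. z $ 1 + z $ 2 = 0 \<and> (w $ 1 = 0 \<longrightarrow> 0 \<le> z $ 1) \<and> (w $ 2 = 0 \<longrightarrow> z $ 1 \<le> 0)}" (is "_ = ?T")
proof -
  have "{s *\<^sub>R (v - w) | s v. 0 \<le> s \<and> v \<in> Omega} = ?T"
  proof (intro equalityI subsetI)
    fix z assume "z \<in> {s *\<^sub>R (v - w) | s v. 0 \<le> s \<and> v \<in> Omega}"
    then obtain s v where z: "z = s *\<^sub>R (v - w)" "0 \<le> s" "v \<in> Omega" by blast
    have "z $ 1 + z $ 2 = s * ((v $ 1 + v $ 2) - (w $ 1 + w $ 2))"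
      by (simp add: z algebra_simps)
    moreover have "w $ 2 = 0 \<longrightarrow> v $ 1 - w $ 1 \<le> 0"
      using z assms unfolding Omega_2_iff by linarith
    ultimately show "z \<in> ?T"
      using z assms by (auto simp: Omega_2_iff mult_nonneg_nonpos)
  next
    fix z assume z: "z \<in> ?T"
    consider "z $ 1 = 0" | "z $ 1 > 0" | "z $ 1 < 0" by linarith
    then show "z \<in> {s *\<^sub>R (v - w) | s v. 0 \<le> s \<and> v \<in> Omega}"
    proof cases
      case 1
      then have "z = 0 *\<^sub>R (w - w)" using z by (simp add: vec_eq_iff forall_2)
      then show ?thesis using assms by blast
    next
      case 2
      then have w: "0 < w $ 2" using z assms by (auto simp: Omega_2_iff less_le)
      have "z = (z $ 1 / w $ 2) *\<^sub>R (vector [1, 0] - w)"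
      proof -
        have "1 - w $ 1 = w $ 2" "z $ 2 = - z $ 1"
          using z assms unfolding Omega_2_iff by auto
        then show ?thesis using w by (simp add: vec_eq_iff forall_2)
      qed
      moreover have "vector [1, 0] \<in> (Omega :: (real^2) set)" by (simp add: Omega_2_iff)
      moreover have "0 \<le> z $ 1 / w $ 2" using 2 w by simp
      ultimately show ?thesis by blast
    next
      case 3
      then have w: "0 < w $ 1" using z assms by (auto simp: Omega_2_iff less_le)
      have "z = (- z $ 1 / w $ 1) *\<^sub>R (vector [0, 1] - w)"
      proof -
        have "1 - w $ 2 = w $ 1" "z $ 2 = - z $ 1"
          using z assms unfolding Omega_2_iff by auto
        then show ?thesis using w by (simp add: vec_eq_iff forall_2)
      qed
      moreover have "vector [0, 1] \<in> (Omega :: (real^2) set)" by (simp add: Omega_2_iff)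
      moreover have "0 \<le> - z $ 1 / w $ 1" using 3 w by (intro divide_nonneg_pos) auto
      ultimately show ?thesis by blast
    qed
  qed
  moreover have "closed ?T"
    by (auto intro!: closed_Collect_conj closed_Collect_imp closed_Collect_le closed_Collect_eq
        continuous_intros)
  ultimately show ?thesis by (simp add: tangent_cone_def)
qed

text \<open>All elements of the cone are multiples of \<open>Omega_dir\<close>. By Pythagoras the
  squared distance from \<open>h\<close> to \<open>k *\<^sub>R Omega_dir\<close> depends on
  \<open>k\<close> only through \<open>(k - h \<bullet> Omega_dir)\<^sup>2\<close>, so projecting
  means clipping one real number.\<close>

lemma tangent_proj_Omega:
  assumes "w \<in> (Omega :: (real^2) set)"
  shows "tangent_proj w h = cone_clip w (h \<bullet> Omega_dir) *\<^sub>R Omega_dir"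
proof -
  let ?T = "tangent_cone w (Omega :: (real^2) set)" and ?c = "h \<bullet> Omega_dir"
  note T = tangent_cone_Omega[OF assms]
  have mem: "c *\<^sub>R Omega_dir \<in> ?T \<longleftrightarrow> (w $ 1 = 0 \<longrightarrow> 0 \<le> c) \<and> (w $ 2 = 0 \<longrightarrow> c \<le> 0)" for c
    unfolding T by (auto simp: Omega_dir_def zero_le_divide_iff divide_le_0_iff)
  have "cone_clip w ?c *\<^sub>R Omega_dir = closest_point ?T h"
  proof (rule closest_point_unique)
    show "convex ?T"
    proof -
      have "?T = {z. z $ 1 + z $ 2 = 0} \<inter> {z. w $ 1 = 0 \<longrightarrow> 0 \<le> z $ 1} \<inter> {z. w $ 2 = 0 \<longrightarrow> z $ 1 \<le> 0}"
        unfolding T by auto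
      moreover have "convex {z :: real^2. z $ 1 + z $ 2 = 0}"
        using convex_hyperplane[of "vector [1, 1] :: real^2" 0] by (simp add: inner_vec_def sum_2)
      moreover have "convex {z :: real^2. w $ 1 = 0 \<longrightarrow> 0 \<le> z $ 1}"
        using convex_halfspace_ge[of 0 "vector [1, 0] :: real^2"]
        by (cases "w $ 1 = 0") (auto simp: inner_vec_def sum_2)
      moreover have "convex {z :: real^2. w $ 2 = 0 \<longrightarrow> z $ 1 \<le> 0}"
        using convex_halfspace_le[of "vector [1, 0] :: real^2" 0]
        by (cases "w $ 2 = 0") (auto simp: inner_vec_def sum_2)
      ultimately show ?thesis by (simp add: convex_Int)
    qed
    show "closed ?T" by (simp add: tangent_cone_def)
    show "cone_clip w ?c *\<^sub>R Omega_dir \<in> ?T"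
      using assms by (auto simp: mem cone_clip_def Omega_2_iff)
    show "\<forall>z\<in>?T. dist h (cone_clip w ?c *\<^sub>R Omega_dir) \<le> dist h z"
    proof
      fix z assume z: "z \<in> ?T"
      define c where "c = sqrt 2 * z $ 1"
      have z2: "z $ 2 = - z $ 1" using z unfolding T by simp
      have zc: "z = c *\<^sub>R Omega_dir"
        using z2 by (simp add: c_def Omega_dir_def vec_eq_iff forall_2)
      have c: "w $ 1 = 0 \<longrightarrow> 0 \<le> c" "w $ 2 = 0 \<longrightarrow> c \<le> 0" using z unfolding zc mem by auto
      have d: "(dist h (k *\<^sub>R Omega_dir))\<^sup>2 = h \<bullet> h - ?c\<^sup>2 + (k - ?c)\<^sup>2" for k
      proof -
        have "(dist h (k *\<^sub>R Omega_dir))\<^sup>2 = h \<bullet> h - 2 * k * ?c + k\<^sup>2 * (norm Omega_dir)\<^sup>2"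
          unfolding dist_norm power2_norm_eq_inner
          by (simp add: inner_diff_left inner_diff_right inner_commute power2_eq_square algebra_simps)
        then show ?thesis by (simp add: norm_Omega_dir power2_diff)
      qed
      have "\<bar>cone_clip w ?c - ?c\<bar> \<le> \<bar>c - ?c\<bar>"
        using c by (auto simp: cone_clip_def)
      then have "(cone_clip w ?c - ?c)\<^sup>2 \<le> (c - ?c)\<^sup>2" by (simp add: abs_le_square_iff)
      then have "(dist h (cone_clip w ?c *\<^sub>R Omega_dir))\<^sup>2 \<le> (dist h z)\<^sup>2"
        unfolding zc d by simp
      then show "dist h (cone_clip w ?c *\<^sub>R Omega_dir) \<le> dist h z"
        by (rule power2_le_imp_le) simp
    qed
  qed
  then show ?thesis by (simp add: tangent_proj_def)
qed

section \<open>From essential bounds to pointwise bounds\<close>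

lemma bounded_on_open_of_AE:
  fixes h :: "'a::euclidean_space \<Rightarrow> 'b::real_normed_vector"
  assumes "open S" "continuous_on S h" "AE x in lborel. x \<in> S \<longrightarrow> norm (h x) \<le> M" "x \<in> S"
  shows "norm (h x) \<le> M"
proof (rule ccontr)
  assume x: "\<not> norm (h x) \<le> M"
  let ?B = "{y \<in> S. M < norm (h y)}"
  \<comment> \<open>The set where the bound fails is open by continuity and null by assumption, and
    a nonempty open set is not null.\<close>
  have B: "open ?B"
  proof -
    have "continuous_on S (\<lambda>y. norm (h y))" using assms(2) by (intro continuous_intros)
    then have "open (S \<inter> (\<lambda>y. norm (h y)) -` {M<..})"
      using assms(1) by (intro continuous_open_preimage open_greaterThan)
    moreover have "?B = S \<inter> (\<lambda>y. norm (h y)) -` {M<..}" by auto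
    ultimately show ?thesis by simp
  qed
  have "AE y in lborel. y \<notin> ?B" using assms(3) by eventually_elim auto
  then have "?B \<in> null_sets lborel"
    using B by (subst (asm) AE_iff_null_sets[symmetric]) auto
  then have "negligible ?B" by (simp add: negligible_iff_null_sets null_sets_completionI)
  moreover have "?B \<noteq> {}" using x assms(4) by auto
  ultimately show False using open_not_negligible[OF B] by simp
qed

lemma Linf_norm_AE:
  assumes "esssup M (\<lambda>x. ereal (norm (h x))) < \<infinity>"
  shows "AE x in M. norm (h x) \<le> Linf_norm M h"
proof -
  let ?E = "esssup M (\<lambda>x. ereal (norm (h x)))"
  have "AE x in M. ereal (norm (h x)) \<le> ?E" by (rule esssup_AE)
  then show ?thesis
  proof eventually_elim
    case (elim x)
    \<comment> \<open>The value \<open>-\<infinity>\<close> is excluded because the essential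
      supremum lies above a norm at some point; hence the conversion to a real number loses
      nothing.\<close>
    then have "\<bar>?E\<bar> \<noteq> \<infinity>" using assms by auto
    then have "ereal (Linf_norm M h) = ?E" by (simp add: Linf_norm_def ereal_real)
    then show ?case using elim by (metis ereal_less_eq(3))
  qed
qed

lemma potential_grad_eq:
  assumes "\<bar>U y\<bar> \<noteq> \<infinity>" "GDERIV (\<lambda>v. real_of_ereal (U v)) y :> D"
  shows "potential_grad U y = D"
proof -
  have "D' = D" if "GDERIV (\<lambda>v. real_of_ereal (U v)) y :> D'" for D'
  proof -
    have "(\<lambda>h. h \<bullet> D') = (\<lambda>h. h \<bullet> D)"
      using that assms(2) unfolding gderiv_def by (rule has_derivative_unique)
    then show ?thesis by (metis inner_commute vector_eq_rdot)
  qed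
  then have "(THE D'. GDERIV (\<lambda>v. real_of_ereal (U v)) y :> D') = D"
    by (rule the_equality[where P = "\<lambda>D'. GDERIV (\<lambda>v. real_of_ereal (U v)) y :> D'", OF assms(2)])
  moreover have "\<bar>U y\<bar> \<noteq> \<infinity> \<and> (\<exists>D'. GDERIV (\<lambda>v. real_of_ereal (U v)) y :> D')"
    using assms by blast
  ultimately show ?thesis unfolding potential_grad_def by (simp only: if_True simp_thms)
qed

text \<open>The bound is required at every point, the origin included, because the force integrates
  the gradient at \<open>g x - g y\<close> against a measure that may charge the set where this
  vanishes. Off the origin continuity suffices. At the origin the gradient is 0 by convention or a
  genuine derivative, possibly without continuity, and the mean value theorem transfers the
  bound.\<close>

lemma potential_grad_bound:
  fixes U :: "'a::euclidean_space \<Rightarrow> ereal"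
  assumes U: "is_potential U" and Linf: "in_Linf lborel (potential_grad U)"
  shows "norm (potential_grad U y) \<le> Linf_norm lborel (potential_grad U)"
proof -
  let ?M = "Linf_norm lborel (potential_grad U)" and ?u = "\<lambda>v. real_of_ereal (U v)"
  have nz: "norm (potential_grad U z) \<le> ?M" if "z \<noteq> 0" for z
  proof (rule bounded_on_open_of_AE[where S = "- {0}" and h = "potential_grad U" and x = z])
    show "continuous_on (- {0}) (potential_grad U)" using U by (simp add: is_potential_def)
    show "AE x in lborel. x \<in> - {0} \<longrightarrow> norm (potential_grad U x) \<le> ?M"
      using Linf_norm_AE[of lborel "potential_grad U"] Linf by (auto simp: in_Linf_def)
  qed (use that in auto)
  have G: "GDERIV ?u z :> potential_grad U z" if "z \<noteq> 0" for z
  proof -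
    have "\<bar>U z\<bar> \<noteq> \<infinity>" "\<exists>D. GDERIV ?u z :> D" using U that by (auto simp: is_potential_def)
    then show ?thesis using potential_grad_eq by metis
  qed
  have M: "0 \<le> ?M"
  proof -
    obtain b :: 'a where "b \<in> Basis" by (meson nonempty_Basis ex_in_conv)
    then have "b \<noteq> 0" by (metis nonzero_Basis)
    from nz[OF this] show ?thesis using norm_ge_zero order_trans by blast
  qed
  show ?thesis
  proof (cases "y = 0 \<and> potential_grad U y \<noteq> 0")
    case False
    then show ?thesis using nz[of y] M by (cases "y = 0") auto
  next
    case True
    define D where "D = potential_grad U 0"
    have D0: "D \<noteq> 0" using True by (auto simp: D_def)
    then have "\<bar>U 0\<bar> \<noteq> \<infinity> \<and> (\<exists>D. GDERIV ?u 0 :> D)"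
      unfolding D_def potential_grad_def by (meson)
    then have D: "GDERIV ?u 0 :> D" unfolding D_def using potential_grad_eq by metis
    \<comment> \<open>Along the ray in direction \<open>D\<close> the derivative at 0 is
      \<open>D \<bullet> D\<close>, while every difference quotient is at most
      \<open>?M * norm D\<close>; dividing by \<open>norm D\<close> gives the claim.\<close>
    define \<phi> where "\<phi> t = ?u (t *\<^sub>R D)" for t :: real
    have line: "((\<lambda>t. t *\<^sub>R D) has_derivative (\<lambda>t. t *\<^sub>R D)) (at t)" for t
      by (auto intro!: derivative_eq_intros)
    have \<phi>': "(\<phi> has_real_derivative G \<bullet> D) (at t)" if "GDERIV ?u (t *\<^sub>R D) :> G" for t G
    proof -
      have "(\<phi> has_derivative (\<lambda>s. (s *\<^sub>R D) \<bullet> G)) (at t)"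
        unfolding \<phi>_def using that[unfolded gderiv_def] by (rule has_derivative_compose[OF line])
      moreover have "(\<lambda>s. (s *\<^sub>R D) \<bullet> G) = (*) (G \<bullet> D)" by (auto simp: inner_commute)
      ultimately show ?thesis by (simp add: has_field_derivative_def)
    qed
    have \<phi>0: "(\<phi> has_real_derivative D \<bullet> D) (at 0)" using \<phi>'[of 0 D] D by simp
    have quot: "(\<phi> h - \<phi> 0) / h \<le> ?M * norm D" if h: "0 < h" for h
    proof -
      have "\<exists>l z. 0 < z \<and> z < h \<and> (\<phi> has_real_derivative l) (at z) \<and> \<phi> h - \<phi> 0 = (h - 0) * l"
      proof (rule MVT[OF h])
        show "continuous_on {0..h} \<phi>"
        proof (rule continuous_at_imp_continuous_on, rule ballI)
          fix t assume "t \<in> {0..h}"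
          show "isCont \<phi> t"
          proof (cases "t = 0")
            case True
            then show ?thesis using \<phi>0 DERIV_isCont by blast
          next
            case False
            then have "t *\<^sub>R D \<noteq> 0" using D0 by simp
            from DERIV_isCont[OF \<phi>'[OF G[OF this]]] show ?thesis .
          qed
        qed
        show "\<phi> differentiable (at t)" if "0 < t" "t < h" for t
        proof -
          have "t *\<^sub>R D \<noteq> 0" using D0 that by simp
          from \<phi>'[OF G[OF this]] show ?thesis by (auto simp: real_differentiable_def)
        qed
      qed
      then obtain l z where z: "0 < z" "(\<phi> has_real_derivative l) (at z)" "\<phi> h - \<phi> 0 = h * l" by auto
      have zD: "z *\<^sub>R D \<noteq> 0" using D0 z by simp
      have "l = potential_grad U (z *\<^sub>R D) \<bullet> D"
        using DERIV_unique[OF z(2) \<phi>'[OF G[OF zD]]] .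
      also have "\<dots> \<le> norm (potential_grad U (z *\<^sub>R D)) * norm D" by (rule norm_cauchy_schwarz)
      also have "\<dots> \<le> ?M * norm D" using nz[OF zD] by (intro mult_right_mono) auto
      finally show ?thesis using z h by simp
    qed
    have "((\<lambda>h. (\<phi> h - \<phi> 0) / h) \<longlongrightarrow> D \<bullet> D) (at_right 0)"
      using \<phi>0 unfolding DERIV_def by (auto intro: tendsto_within_subset)
    then have "D \<bullet> D \<le> ?M * norm D"
    proof (rule tendsto_upperbound)
      show "\<forall>\<^sub>F h in at_right 0. (\<phi> h - \<phi> 0) / h \<le> ?M * norm D"
        using eventually_at_right_less[of 0] by (rule eventually_mono) (rule quot)
    qed simp
    then have "norm D * norm D \<le> ?M * norm D"
      by (simp add: power2_norm_eq_inner[symmetric] power2_eq_square)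
    then have "norm D \<le> ?M" using D0 by simp
    then show ?thesis using True by (auto simp: D_def)
  qed
qed

section \<open>The curve of minimizers and its polynomial approximation\<close>

lemma has_vector_derivative_lipschitz:
  fixes \<gamma> :: "real \<Rightarrow> 'a::real_normed_vector"
  assumes "\<And>s. s \<in> {a..b} \<Longrightarrow> (\<gamma> has_vector_derivative \<gamma>' s) (at s within {a..b})"
    and "\<And>s. s \<in> {a..b} \<Longrightarrow> norm (\<gamma>' s) \<le> N" and "s \<in> {a..b}" "t \<in> {a..b}"
  shows "norm (\<gamma> s - \<gamma> t) \<le> N * \<bar>s - t\<bar>"
proof -
  have "norm (\<gamma> s - \<gamma> t) \<le> N * norm (s - t)"
  proof (rule differentiable_bound)
    show "(\<gamma> has_derivative (\<lambda>h. h *\<^sub>R \<gamma>' x)) (at x within {a..b})" if "x \<in> {a..b}" for x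
      using assms(1)[OF that] by (simp add: has_vector_derivative_def)
    show "onorm (\<lambda>h. h *\<^sub>R \<gamma>' x) \<le> N" if "x \<in> {a..b}" for x
    proof (rule onorm_bound)
      show "0 \<le> N" using order_trans[OF norm_ge_zero assms(2)[OF that]] .
      show "norm (h *\<^sub>R \<gamma>' x) \<le> N * norm h" for h
        using mult_left_mono[OF assms(2)[OF that], of "\<bar>h\<bar>"] by (simp add: mult.commute)
    qed
  qed (use assms in auto)
  then show ?thesis by simp
qed

text \<open>The chain rule evaluates the derivative only in the tangential direction
  \<open>Omega_dir\<close>, where it is determined by \<open>xbar\<close>. The essential bound then
  holds at every interior point by continuity of \<open>\<gamma>'\<close> and extends to both end
  points by closure.\<close>

lemma Omega_arc_curve:
  fixes xbar :: "real^2 \<Rightarrow> 'a::euclidean_space"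
  assumes "C1_on Omega xbar"
  shows "\<exists>\<gamma>'. continuous_on {0..sqrt 2} \<gamma>' \<and>
    (\<forall>s\<in>{0..sqrt 2}. ((\<lambda>s. xbar (Omega_arc s)) has_vector_derivative \<gamma>' s) (at s within {0..sqrt 2}) \<and>
      norm (\<gamma>' s) \<le> Omega_grad_Linf_norm xbar)"
proof -
  obtain D where D: "continuous_on Omega D"
    "\<And>w. w \<in> Omega \<Longrightarrow> (xbar has_derivative blinfun_apply (D w)) (at w within Omega)"
    using assms by (auto simp: C1_on_def)
  let ?I = "{0..sqrt 2}" and ?\<gamma> = "\<lambda>s. xbar (Omega_arc s)"
  define \<gamma>' where "\<gamma>' s = D (Omega_arc s) Omega_dir" for s
  have arc: "Omega_arc ` ?I \<subseteq> Omega" using Omega_arc_in_Omega by blast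
  have "continuous_on ?I Omega_arc" unfolding Omega_arc_eq[abs_def] by (intro continuous_intros)
  then have cont: "continuous_on ?I \<gamma>'"
    unfolding \<gamma>'_def by (intro continuous_intros continuous_on_compose2[OF D(1) _ arc])
  have deriv: "(?\<gamma> has_vector_derivative \<gamma>' s) (at s within ?I)" if s: "s \<in> ?I" for s
  proof -
    have "(Omega_arc has_derivative (\<lambda>h. h *\<^sub>R Omega_dir)) (at s within ?I)"
      unfolding Omega_arc_eq[abs_def] by (auto intro!: derivative_eq_intros)
    moreover have "(xbar has_derivative blinfun_apply (D (Omega_arc s))) (at (Omega_arc s) within Omega_arc ` ?I)"
      using D(2) arc s has_derivative_subset by blast
    ultimately have "(?\<gamma> has_derivative (\<lambda>h. D (Omega_arc s) (h *\<^sub>R Omega_dir))) (at s within ?I)"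
      by (rule has_derivative_in_compose)
    then show ?thesis by (simp add: has_vector_derivative_def \<gamma>'_def blinfun.scaleR_right)
  qed
  let ?M = "restrict_space lborel ?I" and ?v = "\<lambda>s. vector_derivative ?\<gamma> (at s within ?I)"
  have v: "?v s = \<gamma>' s" if "s \<in> ?I" for s
    using deriv[OF that] that by (intro vector_derivative_within_closed_interval) auto
  have "(\<lambda>s. ereal (norm (\<gamma>' s))) \<in> borel_measurable ?M"
    using borel_measurable_continuous_on_restrict[OF cont]
    by (auto simp: measurable_cong_sets[OF sets_restrict_space_cong[OF sets_lborel] refl])
  then have meas: "(\<lambda>s. ereal (norm (?v s))) \<in> borel_measurable ?M"
    by (subst measurable_cong[where g = "\<lambda>s. ereal (norm (\<gamma>' s))"]) (auto simp: space_restrict_space v)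
  have "compact (\<gamma>' ` ?I)" using cont by (intro compact_continuous_image) auto
  then have "bounded (\<gamma>' ` ?I)" by (rule compact_imp_bounded)
  then obtain B where B: "\<And>s. s \<in> ?I \<Longrightarrow> norm (\<gamma>' s) \<le> B"
    unfolding bounded_iff by (meson imageI)
  have "esssup ?M (\<lambda>s. ereal (norm (?v s))) \<le> ereal B"
    using B v by (intro esssup_I meas AE_I2) (auto simp: space_restrict_space)
  then have "esssup ?M (\<lambda>s. ereal (norm (?v s))) < \<infinity>" by auto
  from Linf_norm_AE[OF this] have "AE s in ?M. norm (?v s) \<le> Omega_grad_Linf_norm xbar"
    by (simp add: Omega_grad_Linf_norm_def)
  then have "AE s in lborel. s \<in> ?I \<longrightarrow> norm (?v s) \<le> Omega_grad_Linf_norm xbar"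
    by (subst (asm) AE_restrict_space_iff) auto
  then have AE: "AE s in lborel. s \<in> {0<..<sqrt 2} \<longrightarrow> norm (\<gamma>' s) \<le> Omega_grad_Linf_norm xbar"
    by eventually_elim (auto simp: v)
  have cl: "closure {0<..<sqrt 2} = ?I" by (simp add: closure_greaterThanLessThan)
  have "norm (\<gamma>' s) \<le> Omega_grad_Linf_norm xbar" if "s \<in> ?I" for s
  proof (rule continuous_on_closure_norm_le[where s = "{0<..<sqrt 2}"])
    show "\<forall>y\<in>{0<..<sqrt 2}. norm (\<gamma>' y) \<le> Omega_grad_Linf_norm xbar"
      using bounded_on_open_of_AE[OF _ continuous_on_subset[OF cont greaterThanLessThan_subseteq_atLeastAtMost_iff[THEN iffD2]] AE]
      by simp
  qed (use cont that cl in auto)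
  then show ?thesis using cont deriv by (intro exI[of _ \<gamma>']) auto
qed

text \<open>Weierstrass approximation is applied to the derivative and then integrated, since
  uniform closeness of the functions alone would say nothing about their derivatives. Polynomials
  keep compositions inside the smooth class.\<close>

lemma C1_polynomial_approximation_real:
  fixes \<gamma> :: "real \<Rightarrow> real"
  assumes cont: "continuous_on {0..b} \<gamma>'" and "0 \<le> b" and "0 < e"
    and deriv: "\<And>s. s \<in> {0..b} \<Longrightarrow> (\<gamma> has_real_derivative \<gamma>' s) (at s within {0..b})"
  shows "\<exists>P P'. (\<forall>s. (P has_real_derivative P' s) (at s)) \<and>
    (\<forall>u :: 'c::euclidean_space \<Rightarrow> real. smooth_fun u \<longrightarrow> smooth_fun (\<lambda>z. P (u z))) \<and>
    (\<forall>s\<in>{0..b}. \<bar>\<gamma> s - P s\<bar> \<le> e \<and> \<bar>\<gamma>' s - P' s\<bar> \<le> e)"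
proof -
  \<comment> \<open>Small enough both for the derivative (\<open>\<eta> \<le> e\<close>) and for its
    integral over the interval (\<open>\<eta> * b \<le> e\<close>).\<close>
  define \<eta> where "\<eta> = e / (b + 1)"
  have \<eta>: "0 < \<eta>" "\<eta> \<le> e" "\<eta> * b \<le> e"
    using assms(2,3) by (auto simp: \<eta>_def field_simps)
  obtain P' where P': "real_polynomial_function P'" "\<And>s. s \<in> {0..b} \<Longrightarrow> \<bar>\<gamma>' s - P' s\<bar> < \<eta>"
    using Stone_Weierstrass_real_polynomial_function[OF compact_Icc cont \<eta>(1)] by blast
  obtain a n where an: "P' = (\<lambda>x. \<Sum>i\<le>n. a i * x ^ i)"
    using P'(1) by (auto simp: real_polynomial_function_iff_sum)
  define P where "P s = \<gamma> 0 + (\<Sum>i\<le>n. a i / real (Suc i) * s ^ Suc i)" for s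
  have P: "(P has_real_derivative P' s) (at s)" for s
  proof -
    have "((\<lambda>s. a i / real (Suc i) * s ^ Suc i) has_real_derivative a i * s ^ i) (at s)" for i
      by (rule DERIV_cong[OF DERIV_cmult[OF DERIV_pow]]) (simp del: of_nat_Suc)
    then have "(P has_real_derivative 0 + (\<Sum>i\<le>n. a i * s ^ i)) (at s)"
      unfolding P_def by (intro DERIV_add DERIV_const DERIV_sum)
    then show ?thesis by (simp add: an)
  qed
  have "\<bar>\<gamma> s - P s\<bar> \<le> e" if s: "s \<in> {0..b}" for s
  proof -
    have "norm ((\<gamma> s - P s) - (\<gamma> 0 - P 0)) \<le> \<eta> * \<bar>s - 0\<bar>"
    proof (rule has_vector_derivative_lipschitz[where \<gamma>' = "\<lambda>s. \<gamma>' s - P' s"])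
      show "((\<lambda>s. \<gamma> s - P s) has_vector_derivative \<gamma>' s - P' s) (at s within {0..b})"
        if "s \<in> {0..b}" for s
        unfolding has_real_derivative_iff_has_vector_derivative[symmetric]
        using deriv[OF that] has_field_derivative_at_within[OF P] by (rule DERIV_diff)
      show "norm (\<gamma>' s - P' s) \<le> \<eta>" if "s \<in> {0..b}" for s
        using P'(2)[OF that] by simp
    qed (use s assms(2) in auto)
    also have "\<eta> * \<bar>s - 0\<bar> \<le> \<eta> * b" using s \<eta> by simp
    finally show ?thesis using \<eta>(3) by (simp add: P_def)
  qed
  moreover have "smooth_fun (\<lambda>z. P (u z))" if "smooth_fun u" for u :: "'c \<Rightarrow> real"
    unfolding P_def using that by (intro smooth_fun_intros)
  moreover have "\<bar>\<gamma>' s - P' s\<bar> \<le> e" if "s \<in> {0..b}" for s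
    using P'(2)[OF that] \<eta>(2) by simp
  ultimately show ?thesis using P by (intro exI[of _ P] exI[of _ P']) auto
qed

lemma C1_polynomial_approximation:
  fixes \<gamma> :: "real \<Rightarrow> real^'d"
  assumes cont: "continuous_on {0..b} \<gamma>'" and "0 \<le> b" and "0 < e"
    and deriv: "\<And>s. s \<in> {0..b} \<Longrightarrow> (\<gamma> has_vector_derivative \<gamma>' s) (at s within {0..b})"
  shows "\<exists>P P'. (\<forall>s. (P has_vector_derivative P' s) (at s)) \<and>
    (\<forall>l. \<forall>u :: 'c::euclidean_space \<Rightarrow> real. smooth_fun u \<longrightarrow> smooth_fun (\<lambda>z. P (u z) $ l)) \<and>
    (\<forall>s\<in>{0..b}. norm (\<gamma> s - P s) \<le> e \<and> norm (\<gamma>' s - P' s) \<le> e)"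
proof -
  \<comment> \<open>The Euclidean norm is bounded by the sum of the absolute coordinates, so the
    tolerance is shared among them.\<close>
  define \<eta> where "\<eta> = e / real CARD('d)"
  have \<eta>: "0 < \<eta>" using assms(3) by (simp add: \<eta>_def)
  have "\<exists>P P'. (\<forall>s. (P has_real_derivative P' s) (at s)) \<and>
    (\<forall>u :: 'c \<Rightarrow> real. smooth_fun u \<longrightarrow> smooth_fun (\<lambda>z. P (u z))) \<and>
    (\<forall>s\<in>{0..b}. \<bar>\<gamma> s $ l - P s\<bar> \<le> \<eta> \<and> \<bar>\<gamma>' s $ l - P' s\<bar> \<le> \<eta>)" for l
  proof (rule C1_polynomial_approximation_real[OF _ assms(2) \<eta>])
    show "continuous_on {0..b} (\<lambda>s. \<gamma>' s $ l)" using cont by (intro continuous_intros)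
    show "((\<lambda>s. \<gamma> s $ l) has_real_derivative \<gamma>' s $ l) (at s within {0..b})" if "s \<in> {0..b}" for s
      unfolding has_real_derivative_iff_has_vector_derivative
      using bounded_linear.has_vector_derivative[OF bounded_linear_vec_nth deriv[OF that]] .
  qed
  then obtain P P' where P: "\<And>l s. (P l has_real_derivative P' l s) (at s)"
    "\<And>l u :: 'c \<Rightarrow> real. smooth_fun u \<Longrightarrow> smooth_fun (\<lambda>z. P l (u z))"
    "\<And>l s. s \<in> {0..b} \<Longrightarrow> \<bar>\<gamma> s $ l - P l s\<bar> \<le> \<eta>" "\<And>l s. s \<in> {0..b} \<Longrightarrow> \<bar>\<gamma>' s $ l - P' l s\<bar> \<le> \<eta>"
    by metis
  have "((\<lambda>s. \<chi> l. P l s) has_vector_derivative (\<chi> l. P' l s)) (at s)" for s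
    unfolding has_vector_derivative_def
    by (subst has_derivative_componentwise_within)
      (use P(1) in \<open>auto simp: Basis_vec_def inner_axis has_field_derivative_def mult.commute[of _ "P' _ s"]\<close>)
  moreover have "norm (\<gamma> s - (\<chi> l. P l s)) \<le> e" if "s \<in> {0..b}" for s
  proof -
    have "norm (\<gamma> s - (\<chi> l. P l s)) \<le> (\<Sum>l\<in>UNIV. \<bar>(\<gamma> s - (\<chi> l. P l s)) $ l\<bar>)"
      by (rule norm_le_l1_cart)
    also have "\<dots> \<le> (\<Sum>l\<in>(UNIV :: 'd set). \<eta>)"
      by (rule sum_mono) (use P(3)[OF that] in simp)
    finally show ?thesis by (simp add: \<eta>_def)
  qed
  moreover have "norm (\<gamma>' s - (\<chi> l. P' l s)) \<le> e" if "s \<in> {0..b}" for s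
  proof -
    have "norm (\<gamma>' s - (\<chi> l. P' l s)) \<le> (\<Sum>l\<in>UNIV. \<bar>(\<gamma>' s - (\<chi> l. P' l s)) $ l\<bar>)"
      by (rule norm_le_l1_cart)
    also have "\<dots> \<le> (\<Sum>l\<in>(UNIV :: 'd set). \<eta>)"
      by (rule sum_mono) (use P(4)[OF that] in simp)
    finally show ?thesis by (simp add: \<eta>_def)
  qed
  ultimately show ?thesis using P(2)
    by (intro exI[of _ "\<lambda>s. \<chi> l. P l s"] exI[of _ "\<lambda>s. \<chi> l. P' l s"]) simp
qed

section \<open>The attracting point\<close>

lemma scalarized_2: "scalarized g x (w :: real^2) = max (w $ 1 * \<bar>g x $ 1\<bar>) (w $ 2 * \<bar>g x $ 2\<bar>)"
  by (simp add: scalarized_def UNIV_2)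

lemma scalarized_nonneg: "w \<in> (Omega :: (real^2) set) \<Longrightarrow> 0 \<le> scalarized g x w"
  by (simp add: scalarized_2 Omega_2_iff le_max_iff_disj)

lemma scalarized_diff:
  assumes w: "w \<in> (Omega :: (real^2) set)"
  shows "\<bar>scalarized g x w - scalarized g x' w\<bar> \<le> norm (g x - g x')"
proof -
  have *: "\<bar>w $ k * \<bar>g x $ k\<bar> - w $ k * \<bar>g x' $ k\<bar>\<bar> \<le> norm (g x - g x')" if "0 \<le> w $ k" "w $ k \<le> 1" for k
  proof -
    have "\<bar>w $ k * \<bar>g x $ k\<bar> - w $ k * \<bar>g x' $ k\<bar>\<bar> = w $ k * \<bar>\<bar>g x $ k\<bar> - \<bar>g x' $ k\<bar>\<bar>"
      using that by (simp add: right_diff_distrib[symmetric] abs_mult)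
    also have "\<dots> \<le> 1 * \<bar>(g x - g x') $ k\<bar>"
      using that by (intro mult_mono) (auto simp: abs_triangle_ineq3)
    also have "\<dots> \<le> norm (g x - g x')" using component_le_norm_cart[of "g x - g x'" k] by simp
    finally show ?thesis .
  qed
  have "\<bar>max a b - max a' b'\<bar> \<le> c" if "\<bar>a - a'\<bar> \<le> c" "\<bar>b - b'\<bar> \<le> c" for a b a' b' c :: real
    using that by linarith
  then show ?thesis
    unfolding scalarized_2 using w by (simp add: * Omega_2_iff)
qed

lemma scalarized_le_norm: "w \<in> (Omega :: (real^2) set) \<Longrightarrow> scalarized g x w \<le> norm (g x)"
proof -
  assume w: "w \<in> (Omega :: (real^2) set)"
  \<comment> \<open>The difference estimate is applied to an objective on a two-point domain with
    values \<open>g x\<close> and \<open>0\<close>.\<close>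
  have "\<bar>scalarized (\<lambda>b. if b then g x else 0) True w - scalarized (\<lambda>b. if b then g x else 0) False w\<bar> \<le> norm (g x)"
    using scalarized_diff[OF w, of "\<lambda>b. if b then g x else 0" True False] by simp
  moreover have "scalarized (\<lambda>b. if b then g x else 0) True w = scalarized g x w"
    "scalarized (\<lambda>b. if b then g x else 0) False w = 0" by (simp_all add: scalarized_2)
  ultimately show ?thesis by linarith
qed

lemma scalarized_measurable:
  assumes "continuous_on UNIV (g :: 'a::euclidean_space \<Rightarrow> real^2)"
    and [measurable]: "x \<in> borel_measurable M" "w \<in> borel_measurable M"
  shows "(\<lambda>s. scalarized g (x s) (w s)) \<in> borel_measurable M"
proof -
  have [measurable]: "g \<in> borel_measurable borel" using assms(1) by (rule borel_measurable_continuous_onI)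
  have [measurable]: "(\<lambda>v :: real^2. v $ k) \<in> borel_measurable borel" for k
    by (intro borel_measurable_continuous_onI continuous_intros)
  show ?thesis unfolding scalarized_2 by measurable
qed

text \<open>The unnormalised Gibbs weight: the attracting point is the mean of the law tilted by
  it.\<close>

definition gibbs :: "('a \<Rightarrow> real^'m) \<Rightarrow> real \<Rightarrow> real^'m \<Rightarrow> 'a \<Rightarrow> real" where
  "gibbs g \<alpha> w x = exp (- \<alpha> * scalarized g x w)"

lemma gibbs_pos [simp]: "0 < gibbs g \<alpha> w x" "0 \<le> gibbs g \<alpha> w x" "\<bar>gibbs g \<alpha> w x\<bar> = gibbs g \<alpha> w x"
  by (simp_all add: gibbs_def)

lemmas attracting_point_gibbs = attracting_point_def[folded gibbs_def]

locale lipschitz_objective =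
  fixes g :: "real^'d \<Rightarrow> real^2" and L \<alpha> :: real
  assumes lip: "L-lipschitz_on UNIV g" and \<alpha>: "0 < \<alpha>"
begin

lemma g_continuous: "continuous_on UNIV g"
  using lip by (rule lipschitz_on_continuous_on)

lemma g_diff: "norm (g x - g y) \<le> L * norm (x - y)"
  using lipschitz_onD[OF lip, of x y] by (simp add: dist_norm)

lemma L_nonneg: "0 \<le> L"
  using lip by (rule lipschitz_on_nonneg)

lemma scalarized_lipschitz:
  "w \<in> Omega \<Longrightarrow> \<bar>scalarized g x w - scalarized g y w\<bar> \<le> L * norm (x - y)"
  using scalarized_diff[of w g x y] g_diff[of x y] by simp

lemma scalarized_growth: "w \<in> Omega \<Longrightarrow> scalarized g x w \<le> norm (g 0) + L * norm x"
  using scalarized_lipschitz[of w x 0] scalarized_le_norm[of w g 0] by simp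

lemma gibbs_le_1: "w \<in> Omega \<Longrightarrow> gibbs g \<alpha> w x \<le> 1"
  using scalarized_nonneg[of w g x] \<alpha> by (simp add: gibbs_def)

text \<open>\<open>exp (- a)\<close> is 1-Lipschitz on the nonnegative reals. The constant grows
  with \<alpha> and is used only for continuity in time.\<close>

lemma gibbs_lipschitz:
  assumes "w \<in> Omega"
  shows "\<bar>gibbs g \<alpha> w x - gibbs g \<alpha> w y\<bar> \<le> \<alpha> * L * norm (x - y)"
proof -
  have *: "exp (- a) - exp (- b) \<le> \<bar>a - b\<bar>" if "0 \<le> a" "0 \<le> b" for a b :: real
  proof -
    have "1 - (b - a) \<le> exp (- (b - a))"
      using exp_ge_add_one_self[of "- (b - a)"] by linarith
    then have "exp (- a) * (1 - (b - a)) \<le> exp (- a) * exp (- (b - a))"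
      by (rule mult_left_mono) simp
    also have "\<dots> = exp (- b)" by (simp add: exp_add[symmetric])
    finally have "exp (- a) - exp (- b) \<le> exp (- a) * (b - a)" by (simp add: algebra_simps)
    also have "\<dots> \<le> exp (- a) * \<bar>a - b\<bar>" by (intro mult_left_mono) auto
    also have "\<dots> \<le> 1 * \<bar>a - b\<bar>" using that by (intro mult_right_mono) auto
    finally show ?thesis by simp
  qed
  let ?a = "\<alpha> * scalarized g x w" and ?b = "\<alpha> * scalarized g y w"
  have "0 \<le> ?a" "0 \<le> ?b" using scalarized_nonneg[OF assms, of g] \<alpha> by (auto intro: mult_nonneg_nonneg)
  then have "\<bar>exp (- ?a) - exp (- ?b)\<bar> \<le> \<bar>?a - ?b\<bar>"
    using *[of ?a ?b] *[of ?b ?a] by linarith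
  also have "\<dots> = \<alpha> * \<bar>scalarized g x w - scalarized g y w\<bar>"
    using \<alpha> by (simp add: right_diff_distrib[symmetric] abs_mult)
  also have "\<dots> \<le> \<alpha> * (L * norm (x - y))"
    using scalarized_lipschitz[OF assms] \<alpha> by (intro mult_left_mono) auto
  finally show ?thesis by (simp add: gibbs_def)
qed

lemma gibbs_measurable:
  assumes "x \<in> borel_measurable M" "w \<in> borel_measurable M"
  shows "(\<lambda>s. gibbs g \<alpha> (w s) (x s)) \<in> borel_measurable M"
  using scalarized_measurable[OF g_continuous assms] unfolding gibbs_def by measurable

lemma attracting_point_measurable:
  assumes \<rho>: "prob_space \<rho>" "sets \<rho> = sets borel" and w: "w \<in> borel_measurable M"
  shows "(\<lambda>s. attracting_point g \<alpha> \<rho> (w s)) \<in> borel_measurable M"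
proof -
  interpret prob_space \<rho> by fact
  have [measurable_cong]: "sets \<rho> = sets borel" by fact
  have [measurable]: "w \<in> borel_measurable M" by fact
  have [measurable]: "(\<lambda>(s, x). gibbs g \<alpha> (w s) x) \<in> borel_measurable (M \<Otimes>\<^sub>M \<rho>)"
    unfolding split_beta by (intro gibbs_measurable) measurable
  have [measurable]: "(\<lambda>s. \<integral>x. gibbs g \<alpha> (w s) x *\<^sub>R x \<partial>\<rho>) \<in> borel_measurable M"
    by (rule borel_measurable_lebesgue_integral) measurable
  have [measurable]: "(\<lambda>s. \<integral>x. gibbs g \<alpha> (w s) x \<partial>\<rho>) \<in> borel_measurable M"
    by (rule borel_measurable_lebesgue_integral) measurable
  show ?thesis unfolding attracting_point_gibbs by measurable
qed

section \<open>Gibbs averages under a law with finite second moment\<close>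

context
  fixes \<rho> :: "(real^'d) measure"
  assumes \<rho>: "prob2_on UNIV \<rho>"
begin

lemmas \<rho>_moments = prob2_on_moments[OF \<rho>]

lemma gibbs_meas: "gibbs g \<alpha> w \<in> borel_measurable \<rho>"
  by (rule gibbs_measurable) (auto simp: measurable_cong_sets[OF \<rho>_moments(2) refl])

lemma gibbs_integrable:
  assumes w: "w \<in> Omega"
  shows "integrable \<rho> (gibbs g \<alpha> w)" "integrable \<rho> (\<lambda>x. gibbs g \<alpha> w x *\<^sub>R (x - p))"
    "integrable \<rho> (\<lambda>x. gibbs g \<alpha> w x * norm (x - p))" "integrable \<rho> (\<lambda>x. norm (x - p))"
proof -
  interpret prob_space \<rho> by (rule \<rho>_moments)
  note [measurable] = gibbs_meas
  have [measurable_cong]: "sets \<rho> = sets borel" by (rule \<rho>_moments)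
  show "integrable \<rho> (gibbs g \<alpha> w)"
    by (rule integrable_const_bound[of _ 1]) (use gibbs_le_1[OF w] in auto)
  show n: "integrable \<rho> (\<lambda>x. norm (x - p))"
    using \<rho>_moments(6) by simp
  show 1: "integrable \<rho> (\<lambda>x. gibbs g \<alpha> w x * norm (x - p))"
    by (rule Bochner_Integration.integrable_bound[OF n])
      (use gibbs_le_1[OF w] in \<open>auto simp: abs_mult mult_left_le_one_le\<close>)
  show "integrable \<rho> (\<lambda>x. gibbs g \<alpha> w x *\<^sub>R (x - p))"
    by (rule Bochner_Integration.integrable_bound[OF 1]) auto
qed

lemma norm_moment_le: "(\<integral>x. norm (x - p) \<partial>\<rho>) \<le> 1 + norm p + (\<integral>x. (norm x)\<^sup>2 \<partial>\<rho>)"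
proof -
  interpret prob_space \<rho> by (rule \<rho>_moments)
  have "(\<integral>x. norm (x - p) \<partial>\<rho>) \<le> (\<integral>x. 1 + norm p + (norm x)\<^sup>2 \<partial>\<rho>)"
  proof (rule integral_mono)
    show "integrable \<rho> (\<lambda>x. norm (x - p))" using \<rho>_moments(6) by simp
    show "integrable \<rho> (\<lambda>x. 1 + norm p + (norm x)\<^sup>2)" using \<rho>_moments(4) by simp
    show "norm (x - p) \<le> 1 + norm p + (norm x)\<^sup>2" for x
      using norm_triangle_ineq4[of x p] sum_squares_ge_zero[of "norm x - 1" "norm x"]
      by (simp add: power2_eq_square algebra_simps)
  qed
  also have "\<dots> = 1 + norm p + (\<integral>x. (norm x)\<^sup>2 \<partial>\<rho>)"
    using \<rho>_moments(4) by (simp add: prob_space)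
  finally show ?thesis .
qed

text \<open>Jensen's inequality for the exponential, via the tangent line at the mean.\<close>

lemma partition_function_ge:
  assumes w: "w \<in> Omega" and B: "(\<integral>x. (norm x)\<^sup>2 \<partial>\<rho>) \<le> B"
  shows "exp (- \<alpha> * (norm (g 0) + L * (1 + B))) \<le> (\<integral>x. gibbs g \<alpha> w x \<partial>\<rho>)"
proof -
  interpret prob_space \<rho> by (rule \<rho>_moments)
  \<comment> \<open>The tangent line is taken at an upper bound for the mean exponent: the first
    moment is at most \<open>1 + B\<close>, so the linear correction is nonnegative after
    integration.\<close>
  define c where "c = norm (g 0) + L * (1 + B)"
  have n: "integrable \<rho> (\<lambda>x. norm x)" using gibbs_integrable(4)[OF w, of 0] by simp
  have "(\<integral>x. norm x \<partial>\<rho>) \<le> 1 + B" using norm_moment_le[of 0] B by simp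
  then have m: "L * (\<integral>x. norm x \<partial>\<rho>) \<le> L * (1 + B)" using L_nonneg by (rule mult_left_mono)
  have "exp (- \<alpha> * c) \<le> exp (- \<alpha> * c) * (1 + \<alpha> * (c - norm (g 0) - L * (\<integral>x. norm x \<partial>\<rho>)))"
    using m \<alpha> by (simp add: c_def)
  also have "\<dots> = (\<integral>x. exp (- \<alpha> * c) * (1 + \<alpha> * (c - norm (g 0) - L * norm x)) \<partial>\<rho>)"
    using n by (simp add: prob_space)
  also have "\<dots> \<le> (\<integral>x. gibbs g \<alpha> w x \<partial>\<rho>)"
  proof (rule integral_mono)
    show "integrable \<rho> (\<lambda>x. exp (- \<alpha> * c) * (1 + \<alpha> * (c - norm (g 0) - L * norm x)))"
      using n by simp
    show "integrable \<rho> (gibbs g \<alpha> w)" by (rule gibbs_integrable[OF w])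
    fix x :: "real^'d"
    have "1 + \<alpha> * (c - norm (g 0) - L * norm x) \<le> exp (\<alpha> * (c - norm (g 0) - L * norm x))"
      by (rule exp_ge_add_one_self)
    also have "\<dots> \<le> exp (\<alpha> * (c - scalarized g x w))"
      using scalarized_growth[OF w, of x] \<alpha> by simp
    finally have "exp (- \<alpha> * c) * (1 + \<alpha> * (c - norm (g 0) - L * norm x)) \<le>
        exp (- \<alpha> * c) * exp (\<alpha> * (c - scalarized g x w))" by (rule mult_left_mono) simp
    also have "\<dots> = gibbs g \<alpha> w x" by (simp add: gibbs_def exp_add[symmetric] algebra_simps)
    finally show "exp (- \<alpha> * c) * (1 + \<alpha> * (c - norm (g 0) - L * norm x)) \<le> gibbs g \<alpha> w x" .
  qed
  finally show ?thesis by (simp add: c_def)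
qed

lemma partition_function_pos:
  assumes "w \<in> Omega"
  shows "0 < (\<integral>x. gibbs g \<alpha> w x \<partial>\<rho>)"
  using partition_function_ge[OF assms order_refl] exp_gt_zero less_le_trans by blast

lemma attracting_point_diff:
  assumes w: "w \<in> Omega"
  shows "attracting_point g \<alpha> \<rho> w - p =
    (\<integral>x. gibbs g \<alpha> w x *\<^sub>R (x - p) \<partial>\<rho>) /\<^sub>R (\<integral>x. gibbs g \<alpha> w x \<partial>\<rho>)"
proof -
  let ?Z = "\<integral>x. gibbs g \<alpha> w x \<partial>\<rho>"
  have Z: "?Z \<noteq> 0" using partition_function_pos[OF w] by simp
  have 1: "integrable \<rho> (\<lambda>x. gibbs g \<alpha> w x *\<^sub>R x)" using gibbs_integrable(2)[OF w, of 0] by simp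
  have "(\<integral>x. gibbs g \<alpha> w x *\<^sub>R (x - p) \<partial>\<rho>) = (\<integral>x. gibbs g \<alpha> w x *\<^sub>R x - gibbs g \<alpha> w x *\<^sub>R p \<partial>\<rho>)"
    by (simp add: scaleR_diff_right)
  also have "\<dots> = (\<integral>x. gibbs g \<alpha> w x *\<^sub>R x \<partial>\<rho>) - ?Z *\<^sub>R p"
    using 1 gibbs_integrable(1)[OF w] by simp
  finally show ?thesis
    using Z by (simp add: attracting_point_gibbs scaleR_diff_right)
qed

text \<open>Clearing the denominator turns a bound on a quotient into an inequality between
  expectations, each of which is continuous in time.\<close>

lemma attracting_point_dist_iff:
  assumes w: "w \<in> Omega"
  shows "norm (attracting_point g \<alpha> \<rho> w - p) \<le> \<delta> \<longleftrightarrow>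
    norm (\<integral>x. gibbs g \<alpha> w x *\<^sub>R (x - p) \<partial>\<rho>) \<le> \<delta> * (\<integral>x. gibbs g \<alpha> w x \<partial>\<rho>)"
  unfolding attracting_point_diff[OF w]
  using partition_function_pos[OF w] pos_divide_le_eq[of "\<integral>x. gibbs g \<alpha> w x \<partial>\<rho>"]
  by (simp add: divide_inverse mult.commute[of "inverse _"])

text \<open>A crude bound, exponentially large in \<alpha>; it only secures integrability and
  dominated convergence.\<close>

lemma attracting_point_bound:
  assumes w: "w \<in> Omega" and B: "(\<integral>x. (norm x)\<^sup>2 \<partial>\<rho>) \<le> B"
  shows "norm (attracting_point g \<alpha> \<rho> w) \<le> (1 + B) * exp (\<alpha> * (norm (g 0) + L * (1 + B)))"
proof -
  let ?c = "exp (\<alpha> * (norm (g 0) + L * (1 + B)))"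
  have "norm (\<integral>x. gibbs g \<alpha> w x *\<^sub>R (x - 0) \<partial>\<rho>) \<le> (\<integral>x. norm (gibbs g \<alpha> w x *\<^sub>R (x - 0)) \<partial>\<rho>)"
    by (rule integral_norm_bound)
  also have "\<dots> \<le> (\<integral>x. norm (x - 0) \<partial>\<rho>)"
    using gibbs_integrable(3,4)[OF w, of 0] gibbs_le_1[OF w]
    by (intro integral_mono) (auto simp: mult_left_le_one_le)
  also have "\<dots> \<le> 1 + B" using norm_moment_le[of 0] B by simp
  also have "1 + B = (1 + B) * ?c * exp (- \<alpha> * (norm (g 0) + L * (1 + B)))"
    by (simp add: exp_minus)
  also have "\<dots> \<le> (1 + B) * ?c * (\<integral>x. gibbs g \<alpha> w x \<partial>\<rho>)"
  proof (rule mult_left_mono[OF partition_function_ge[OF w B]])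
    have "0 \<le> (\<integral>x. (norm x)\<^sup>2 \<partial>\<rho>)" by simp
    then have "0 \<le> 1 + B" using B by linarith
    then show "0 \<le> (1 + B) * ?c" by (intro mult_nonneg_nonneg) auto
  qed
  finally have "norm (attracting_point g \<alpha> \<rho> w - 0) \<le> (1 + B) * ?c"
    by (simp only: attracting_point_dist_iff[OF w])
  then show ?thesis by simp
qed

text \<open>The numerator is split at distance \<open>\<delta> / 2\<close>. The near part is at most
  \<open>\<delta> / 2\<close> times the partition function \<open>Z\<close>. The far part is at most
  \<open>A * exp (- \<alpha> * (m + h))\<close>, whereas the ball of radius \<open>r\<close> alone
  gives \<open>Z \<ge> c * exp (- \<alpha> * (m + h / 2))\<close>; the remaining factor
  \<open>exp (- \<alpha> * (h / 2))\<close> brings it below \<open>\<delta> / 4 * Z\<close>. This is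
  the origin of \<open>3 / 4\<close>.\<close>

lemma laplace_principle:
  assumes w: "w \<in> Omega" and far: "\<And>x. \<delta> / 2 \<le> norm (x - p) \<Longrightarrow> m + h \<le> scalarized g x w"
    and near: "\<And>x. norm (x - p) \<le> r \<Longrightarrow> scalarized g x w \<le> m + h / 2"
    and mass: "c \<le> measure \<rho> {x. norm (x - p) \<le> r}" and moment: "(\<integral>x. norm (x - p) \<partial>\<rho>) \<le> A"
    and \<alpha>_large: "A * exp (- \<alpha> * (h / 2)) \<le> c * (\<delta> / 4)" and "0 < \<delta>"
  shows "norm (attracting_point g \<alpha> \<rho> w - p) \<le> 3 / 4 * \<delta>"
proof -
  interpret prob_space \<rho> by (rule \<rho>_moments)
  let ?Z = "\<integral>x. gibbs g \<alpha> w x \<partial>\<rho>" and ?B = "{x. norm (x - p) \<le> r}"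
  have B: "?B \<in> sets \<rho>"
    unfolding \<rho>_moments(2) by (intro borel_closed closed_Collect_le continuous_intros)
  have Z: "exp (- \<alpha> * (m + h / 2)) * c \<le> ?Z"
  proof -
    have "exp (- \<alpha> * (m + h / 2)) * c \<le> exp (- \<alpha> * (m + h / 2)) * measure \<rho> ?B"
      using mass by simp
    also have "\<dots> = (\<integral>x. exp (- \<alpha> * (m + h / 2)) * indicat_real ?B x \<partial>\<rho>)"
      using B by simp
    also have "\<dots> \<le> ?Z"
    proof (rule integral_mono)
      show "integrable \<rho> (\<lambda>x. exp (- \<alpha> * (m + h / 2)) * indicat_real ?B x)"
        using B by (intro integrable_mult_right integrable_real_indicator) (auto simp: emeasure_eq_measure)
      show "exp (- \<alpha> * (m + h / 2)) * indicat_real ?B x \<le> gibbs g \<alpha> w x" for x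
        using near[of x] \<alpha> by (auto simp: indicator_def gibbs_def)
    qed (rule gibbs_integrable[OF w])
    finally show ?thesis .
  qed
  have "norm (\<integral>x. gibbs g \<alpha> w x *\<^sub>R (x - p) \<partial>\<rho>) \<le> (\<integral>x. norm (gibbs g \<alpha> w x *\<^sub>R (x - p)) \<partial>\<rho>)"
    by (rule integral_norm_bound)
  also have "\<dots> \<le> (\<integral>x. \<delta> / 2 * gibbs g \<alpha> w x + exp (- \<alpha> * (m + h)) * norm (x - p) \<partial>\<rho>)"
  proof (rule integral_mono)
    show "integrable \<rho> (\<lambda>x. norm (gibbs g \<alpha> w x *\<^sub>R (x - p)))" using gibbs_integrable(3)[OF w] by simp
    show "integrable \<rho> (\<lambda>x. \<delta> / 2 * gibbs g \<alpha> w x + exp (- \<alpha> * (m + h)) * norm (x - p))"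
      using gibbs_integrable(1,4)[OF w] by (intro Bochner_Integration.integrable_add integrable_mult_right)
    fix x :: "real^'d"
    show "norm (gibbs g \<alpha> w x *\<^sub>R (x - p)) \<le> \<delta> / 2 * gibbs g \<alpha> w x + exp (- \<alpha> * (m + h)) * norm (x - p)"
    proof (cases "\<delta> / 2 \<le> norm (x - p)")
      case True
      have "gibbs g \<alpha> w x \<le> exp (- \<alpha> * (m + h))" using far[OF True] \<alpha> by (simp add: gibbs_def)
      from mult_right_mono[OF this, of "norm (x - p)"]
      have "norm (gibbs g \<alpha> w x *\<^sub>R (x - p)) \<le> exp (- \<alpha> * (m + h)) * norm (x - p)" by simp
      moreover have "0 \<le> \<delta> / 2 * gibbs g \<alpha> w x" using assms(7) by simp
      ultimately show ?thesis by linarith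
    next
      case False
      then have "norm (gibbs g \<alpha> w x *\<^sub>R (x - p)) \<le> \<delta> / 2 * gibbs g \<alpha> w x"
        using mult_left_mono[of "norm (x - p)" "\<delta> / 2" "gibbs g \<alpha> w x"] by (simp add: mult.commute)
      moreover have "0 \<le> exp (- \<alpha> * (m + h)) * norm (x - p)" by simp
      ultimately show ?thesis by linarith
    qed
  qed
  also have "\<dots> = \<delta> / 2 * ?Z + exp (- \<alpha> * (m + h)) * (\<integral>x. norm (x - p) \<partial>\<rho>)"
    using gibbs_integrable(1,4)[OF w] by simp
  also have "exp (- \<alpha> * (m + h)) * (\<integral>x. norm (x - p) \<partial>\<rho>) \<le> exp (- \<alpha> * (m + h)) * A"
    using moment by simp
  also have "exp (- \<alpha> * (m + h)) * A = exp (- \<alpha> * (m + h / 2)) * (A * exp (- \<alpha> * (h / 2)))"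
    by (simp add: exp_add[symmetric] algebra_simps)
  also have "\<dots> \<le> exp (- \<alpha> * (m + h / 2)) * (c * (\<delta> / 4))"
    using \<alpha>_large by simp
  also have "\<dots> \<le> \<delta> / 4 * ?Z"
    using mult_left_mono[OF Z, of "\<delta> / 4"] assms(7) by (simp add: algebra_simps)
  finally have "norm (\<integral>x. gibbs g \<alpha> w x *\<^sub>R (x - p) \<partial>\<rho>) \<le> 3 / 4 * \<delta> * ?Z" by simp
  then show ?thesis by (simp only: attracting_point_dist_iff[OF w])
qed

end

text \<open>The constants depend on the weight only through the norm of the reference point
  \<open>p\<close>. With \<open>p\<close> a minimizer they are bounded over \<open>Omega\<close>,
  which makes the continuity of the attracting point in time uniform in \<open>w\<close>.\<close>

lemma quad_lipschitz_gibbs: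
  assumes w: "w \<in> Omega"
  shows "quad_lipschitz S (\<alpha> * L) (\<lambda>z :: (real^'d) \<times> (real^2). gibbs g \<alpha> w (fst z))"
    and "quad_lipschitz S ((1 + \<alpha> * L) * (1 + norm p))
      (\<lambda>z :: (real^'d) \<times> (real^2). gibbs g \<alpha> w (fst z) *\<^sub>R (fst z - p))"
proof -
  have fst_meas: "fst \<in> borel_measurable (borel :: ((real^'d) \<times> (real^2)) measure)"
    by (intro borel_measurable_continuous_onI continuous_intros)
  have gm [measurable]: "(\<lambda>z :: (real^'d) \<times> (real^2). gibbs g \<alpha> w (fst z)) \<in> borel_measurable borel"
    using fst_meas by (intro gibbs_measurable) auto
  have \<alpha>L: "0 \<le> \<alpha> * L" using \<alpha> L_nonneg by simp
  show "quad_lipschitz S (\<alpha> * L) (\<lambda>z :: (real^'d) \<times> (real^2). gibbs g \<alpha> w (fst z))"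
    unfolding quad_lipschitz_def
  proof (intro conjI ballI \<alpha>L gm)
    fix z z' :: "(real^'d) \<times> (real^2)"
    have "norm (gibbs g \<alpha> w (fst z) - gibbs g \<alpha> w (fst z')) \<le> \<alpha> * L * dist z z'"
      using gibbs_lipschitz[OF w, of "fst z" "fst z'"] mult_left_mono[OF dist_fst_le[of z z'] \<alpha>L]
      by (simp add: dist_norm)
    also have "\<dots> \<le> \<alpha> * L * (1 + norm z + norm z') * dist z z'"
      using mult_left_mono[of 1 "1 + norm z + norm z'", OF _ \<alpha>L] by (intro mult_right_mono) auto
    finally show "norm (gibbs g \<alpha> w (fst z) - gibbs g \<alpha> w (fst z')) \<le> \<alpha> * L * (1 + norm z + norm z') * dist z z'" .
  qed
  show "quad_lipschitz S ((1 + \<alpha> * L) * (1 + norm p))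
      (\<lambda>z :: (real^'d) \<times> (real^2). gibbs g \<alpha> w (fst z) *\<^sub>R (fst z - p))"
    unfolding quad_lipschitz_def
  proof (intro conjI ballI)
    show "0 \<le> (1 + \<alpha> * L) * (1 + norm p)" using \<alpha>L by simp
    show "(\<lambda>z :: (real^'d) \<times> (real^2). gibbs g \<alpha> w (fst z) *\<^sub>R (fst z - p)) \<in> borel_measurable borel"
      using gm fst_meas by (intro borel_measurable_scaleR borel_measurable_diff) auto
    fix z z' :: "(real^'d) \<times> (real^2)"
    let ?D = "dist z z'" and ?x = "fst z" and ?y = "fst z'"
    have D: "norm (?x - ?y) \<le> ?D" using dist_fst_le[of z z'] by (simp add: dist_norm)
    have y: "norm (?y - p) \<le> norm z' + norm p"
      using norm_triangle_ineq4[of ?y p] norm_fst_le[of ?y "snd z'"] by simp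
    have "gibbs g \<alpha> w ?x *\<^sub>R (?x - p) - gibbs g \<alpha> w ?y *\<^sub>R (?y - p) =
        gibbs g \<alpha> w ?x *\<^sub>R (?x - ?y) + (gibbs g \<alpha> w ?x - gibbs g \<alpha> w ?y) *\<^sub>R (?y - p)"
      by (simp add: algebra_simps)
    also have "norm \<dots> \<le> gibbs g \<alpha> w ?x * norm (?x - ?y) + \<bar>gibbs g \<alpha> w ?x - gibbs g \<alpha> w ?y\<bar> * norm (?y - p)"
      by (rule order_trans[OF norm_triangle_ineq]) simp
    also have "gibbs g \<alpha> w ?x * norm (?x - ?y) \<le> 1 * ?D"
      using gibbs_le_1[OF w] D by (intro mult_mono) auto
    also have "\<bar>gibbs g \<alpha> w ?x - gibbs g \<alpha> w ?y\<bar> * norm (?y - p) \<le> (\<alpha> * L * ?D) * (norm z' + norm p)"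
      using order_trans[OF gibbs_lipschitz[OF w] mult_left_mono[OF D \<alpha>L]] y \<alpha>L
      by (intro mult_mono) auto
    also have "1 * ?D + (\<alpha> * L * ?D) * (norm z' + norm p) = (1 + \<alpha> * L * (norm z' + norm p)) * ?D"
      by (simp add: algebra_simps)
    also have "\<dots> \<le> ((1 + \<alpha> * L) * (1 + norm p) * (1 + norm z + norm z')) * ?D"
    proof (rule mult_right_mono)
      have "norm z' + norm p \<le> (1 + norm p) * (1 + norm z + norm z')"
        by (simp add: algebra_simps)
      from mult_left_mono[OF this \<alpha>L]
      have "\<alpha> * L * (norm z' + norm p) \<le> \<alpha> * L * ((1 + norm p) * (1 + norm z + norm z'))" .
      moreover have "1 \<le> (1 + norm p) * (1 + norm z + norm z')"
        using mult_mono[of 1 "1 + norm p" 1 "1 + norm z + norm z'"] by simp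
      ultimately have "1 + \<alpha> * L * (norm z' + norm p) \<le>
          (1 + \<alpha> * L) * ((1 + norm p) * (1 + norm z + norm z'))"
        by (simp only: distrib_right mult_1_left)
      then show "1 + \<alpha> * L * (norm z' + norm p) \<le> (1 + \<alpha> * L) * (1 + norm p) * (1 + norm z + norm z')"
        by (simp only: mult.assoc)
    qed simp
    finally show "norm (gibbs g \<alpha> w ?x *\<^sub>R (?x - p) - gibbs g \<alpha> w ?y *\<^sub>R (?y - p)) \<le>
        (1 + \<alpha> * L) * (1 + norm p) * (1 + norm z + norm z') * ?D" by simp
  qed
qed

end

section \<open>Extension of the weak formulation\<close>

abbreviation phase :: "((real^'d) \<times> (real^2)) set" where
  "phase \<equiv> UNIV \<times> Omega"

lemma phase_measurable: "phase \<in> sets (borel :: ((real^'d) \<times> (real^2)) measure)"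
  by (intro borel_closed closed_Times closed_UNIV closed_Omega_2)

lemma sum_cart_axis_fst: "(\<Sum>l\<in>UNIV. (v $ l) *\<^sub>R (axis l 1, 0)) = (v :: real^'d, 0 :: real^2)"
  by (auto simp: prod_eq_iff fst_sum snd_sum vec_eq_iff axis_def if_distrib sum.delta cong: if_cong)

lemma diffusion_coeff_le: "diffusion_coeff dif l v \<le> (norm v)\<^sup>2"
  using component_le_norm_cart[of v l] by (cases dif) (auto simp: abs_le_square_iff[symmetric])

lemma diffusion_coeff_ge: "(v $ l)\<^sup>2 \<le> diffusion_coeff dif l v"
  using component_le_norm_cart[of v l] by (cases dif) (auto simp: abs_le_square_iff[symmetric])

lemma diffusion_coeff_nonneg: "0 \<le> diffusion_coeff dif l v"
  by (cases dif) auto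

text \<open>Source of \<kappa> in the rate condition: the trace of the diffusion matrix, relative to
  the squared distance.\<close>

lemma sum_diffusion_coeff:
  "(\<Sum>l\<in>UNIV. diffusion_coeff dif l (v :: real^'d)) = diffusion_const dif TYPE('d) * (norm v)\<^sup>2"
  by (cases dif) (auto simp: norm_vec_def L2_set_def sum_nonneg)

locale mean_field = lipschitz_objective g L \<alpha>
  for g :: "real^'d \<Rightarrow> real^2" and L \<alpha> +
  fixes dif :: diffusion and U :: "real^2 \<Rightarrow> ereal" and lam \<sigma> \<tau> M :: real
    and f0 :: "((real^'d) \<times> (real^2)) measure" and f :: "real \<Rightarrow> ((real^'d) \<times> (real^2)) measure"
  assumes params: "0 < lam" "0 < \<sigma>" "0 \<le> \<tau>"
    and sol: "mean_field_solution dif g U \<alpha> lam \<sigma> \<tau> f0 f"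
    and grad_meas: "potential_grad U \<in> borel_measurable borel"
    and grad_bound: "\<And>y. norm (potential_grad U y) \<le> M"
begin

section \<open>Marginals, drift and diffusion along a solution\<close>

abbreviation "\<rho> s \<equiv> x_marginal (f s)"

lemma M_nonneg: "0 \<le> M"
  using order_trans[OF norm_ge_zero grad_bound] .

lemma f_cont: "continuous_prob2 phase f"
  using sol by (simp add: mean_field_solution_def)

lemma f_prob2: "0 \<le> s \<Longrightarrow> prob2_on phase (f s)"
  using f_cont by (simp add: continuous_prob2_def)

lemmas f_moments = prob2_on_moments[OF f_prob2]

lemma fst_meas: "0 \<le> s \<Longrightarrow> fst \<in> measurable (f s) borel"
  and snd_meas: "0 \<le> s \<Longrightarrow> snd \<in> measurable (f s) borel"
  by (auto simp: measurable_cong_sets[OF f_moments(2) refl] intro!: borel_measurable_continuous_onI continuous_intros)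

lemma marginal_integral:
  fixes h :: "real^'d \<Rightarrow> 'b::euclidean_space"
  assumes "0 \<le> s" "h \<in> borel_measurable borel"
  shows "(\<integral>x. h x \<partial>\<rho> s) = (\<integral>z. h (fst z) \<partial>f s)"
  unfolding x_marginal_def using integral_distr[OF fst_meas[OF assms(1)] assms(2)] .

lemma marginal_prob2:
  assumes "0 \<le> s"
  shows "prob2_on UNIV (\<rho> s)"
proof -
  interpret prob_space "f s" by (rule f_moments[OF assms])
  have "prob_space (\<rho> s)"
    unfolding x_marginal_def using fst_meas[OF assms] by (rule prob_space_distr)
  moreover have "integrable (f s) (\<lambda>z. (norm (fst z))\<^sup>2)"
  proof (rule Bochner_Integration.integrable_bound[OF f_moments(4)[OF assms]])
    show "(\<lambda>z. (norm (fst z))\<^sup>2) \<in> borel_measurable (f s)" using fst_meas[OF assms] by measurable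
    show "AE z in f s. norm ((norm (fst z))\<^sup>2) \<le> norm ((norm z)\<^sup>2)"
      using norm_fst_le by (intro AE_I2) (auto intro!: power_mono)
  qed
  then have "integrable (\<rho> s) (\<lambda>x. (norm x)\<^sup>2)"
    unfolding x_marginal_def using fst_meas[OF assms] by (subst integrable_distr_eq) auto
  ultimately show ?thesis by (simp add: prob2_on_def prob_on_def x_marginal_def)
qed

lemmas \<rho>_prob = prob2_on_moments(1)[OF marginal_prob2]
lemmas \<rho>_sets = prob2_on_moments(2)[OF marginal_prob2]

lemma marginal_second_moment:
  assumes "0 \<le> s"
  shows "(\<integral>x. (norm x)\<^sup>2 \<partial>\<rho> s) \<le> (\<integral>z. (norm z)\<^sup>2 \<partial>f s)"
proof -
  have 1: "(\<integral>x. (norm x)\<^sup>2 \<partial>\<rho> s) = (\<integral>z. (norm (fst z))\<^sup>2 \<partial>f s)"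
    using assms by (rule marginal_integral) auto
  have 2: "integrable (f s) (\<lambda>z. (norm (fst z))\<^sup>2)"
    using prob2_on_moments(4)[OF marginal_prob2[OF assms]] fst_meas[OF assms]
    unfolding x_marginal_def by (subst (asm) integrable_distr_eq) auto
  show ?thesis unfolding 1
    using 2 f_moments(4)[OF assms] norm_fst_le by (intro integral_mono) (auto intro!: power_mono)
qed

definition consensus :: "real \<Rightarrow> (real^'d) \<times> (real^2) \<Rightarrow> real^'d" where
  "consensus s z = attracting_point g \<alpha> (\<rho> s) (snd z)"

definition force :: "real \<Rightarrow> (real^'d) \<times> (real^2) \<Rightarrow> real^2" where
  "force s z = (\<integral>y. potential_grad U (g (fst z) - g y) \<partial>\<rho> s)"

text \<open>The signed velocity in the arc-length coordinate, up to the factor \<tau>. The clipped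
  formula makes sense for every second component, inside the segment or not.\<close>

definition speed :: "real \<Rightarrow> (real^'d) \<times> (real^2) \<Rightarrow> real" where
  "speed s z = cone_clip (snd z) (force s z \<bullet> Omega_dir)"

lemma consensus_meas: "0 \<le> s \<Longrightarrow> consensus s \<in> borel_measurable (f s)"
  unfolding consensus_def
  by (rule attracting_point_measurable[OF \<rho>_prob \<rho>_sets snd_meas])

lemma speed_meas: 
  assumes s: "0 \<le> s"
  shows "speed s \<in> borel_measurable (f s)"
proof -
  interpret prob_space "\<rho> s" by (rule \<rho>_prob[OF s])
  have [measurable_cong]: "sets (\<rho> s) = sets borel" by (rule \<rho>_sets[OF s])
  note [measurable] = fst_meas[OF s] snd_meas[OF s] grad_meas borel_measurable_continuous_onI[OF g_continuous]
  have [measurable]: "(\<lambda>v :: real^2. v $ k) \<in> borel_measurable borel" for k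
    by (intro borel_measurable_continuous_onI continuous_intros)
  have [measurable]: "force s \<in> borel_measurable (f s)"
    unfolding force_def by (rule borel_measurable_lebesgue_integral) measurable
  show ?thesis unfolding speed_def cone_clip_def by measurable
qed

lemma force_bound: 
  assumes s: "0 \<le> s"
  shows "norm (force s z) \<le> M"
proof -
  interpret prob_space "\<rho> s" by (rule \<rho>_prob[OF s])
  have [measurable_cong]: "sets (\<rho> s) = sets borel" by (rule \<rho>_sets[OF s])
  note [measurable] = grad_meas borel_measurable_continuous_onI[OF g_continuous]
  have "integrable (\<rho> s) (\<lambda>y. potential_grad U (g (fst z) - g y))"
    by (rule integrable_const_bound[of _ M]) (use grad_bound in auto)
  then have "integrable (\<rho> s) (\<lambda>y. norm (potential_grad U (g (fst z) - g y)))" by simp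
  then have "(\<integral>y. norm (potential_grad U (g (fst z) - g y)) \<partial>\<rho> s) \<le> (\<integral>y. M \<partial>\<rho> s)"
    using grad_bound by (intro integral_mono) auto
  then have "(\<integral>y. norm (potential_grad U (g (fst z) - g y)) \<partial>\<rho> s) \<le> M"
    by (simp add: prob_space)
  then show ?thesis unfolding force_def by (rule order_trans[OF integral_norm_bound])
qed

lemma speed_bound: "0 \<le> s \<Longrightarrow> \<bar>speed s z\<bar> \<le> M"
  using abs_cone_clip[of "snd z" "force s z \<bullet> Omega_dir"] Cauchy_Schwarz_ineq2[of "force s z" Omega_dir]
    force_bound[of s z]
  by (simp add: speed_def norm_Omega_dir)

text \<open>The generator with the projected drift replaced by its explicit form on the segment, which is
  measurable on the whole space.\<close>

definition gen :: "real \<Rightarrow> ((real^'d) \<times> (real^2) \<Rightarrow> real) \<Rightarrow> (real^'d) \<times> (real^2) \<Rightarrow> real" where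
  "gen s \<phi> z =
     lam * frechet_derivative \<phi> (at z) (consensus s z - fst z, 0)
      + \<sigma>\<^sup>2 / 2 * (\<Sum>l\<in>UNIV. diffusion_coeff dif l (fst z - consensus s z) *
          frechet_derivative (\<lambda>z'. frechet_derivative \<phi> (at z') (axis l 1, 0)) (at z) (axis l 1, 0))
      + \<tau> * (speed s z * frechet_derivative \<phi> (at z) (0, Omega_dir))"

lemma generator_eq_gen:
  assumes "smooth_fun \<phi>" "z \<in> phase"
  shows "generator dif g U \<alpha> lam \<sigma> \<tau> (\<rho> s) \<phi> z = gen s \<phi> z"
proof -
  have w: "snd z \<in> Omega" using assms(2) by (cases z) auto
  have "w_drift g U (\<rho> s) (fst z) (snd z) = speed s z *\<^sub>R Omega_dir"
    unfolding w_drift_def tangent_proj_Omega[OF w] speed_def force_def ..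
  moreover have "(0, speed s z *\<^sub>R Omega_dir) = speed s z *\<^sub>R (0 :: real^'d, Omega_dir)" by simp
  ultimately have "frechet_derivative \<phi> (at z) (0, w_drift g U (\<rho> s) (fst z) (snd z)) =
      speed s z * frechet_derivative \<phi> (at z) (0, Omega_dir)"
    using linear_scale[OF smooth_fun_frechet_linear[OF assms(1)]] by (metis real_scaleR_def)
  then show ?thesis unfolding generator_def gen_def consensus_def Let_def by simp
qed

lemma gen_meas:
  assumes "smooth_fun \<phi>" and s: "0 \<le> s"
  shows "gen s \<phi> \<in> borel_measurable (f s)"
proof -
  note [measurable] = fst_meas[OF s] snd_meas[OF s] consensus_meas[OF s] speed_meas[OF s]
  have [measurable]: "(\<lambda>v :: real^'d. v $ k) \<in> borel_measurable borel" for k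
    by (intro borel_measurable_continuous_onI continuous_intros)
  have id [measurable]: "(\<lambda>z. z) \<in> borel_measurable (f s)"
    by (subst measurable_cong_sets[OF f_moments(2)[OF s] refl]) simp
  have pair: "(\<lambda>z. (consensus s z - fst z, 0 :: real^2)) \<in> borel_measurable (f s)"
    by (rule borel_measurable_Pair) measurable
  have [measurable]: "(\<lambda>z. diffusion_coeff dif l (fst z - consensus s z)) \<in> borel_measurable (f s)" for l
    by (cases dif) (auto intro: measurable_compose)
  note [measurable] = smooth_fun_frechet_measurable[OF assms(1) pair id]
    smooth_fun_frechet_measurable[OF assms(1) measurable_const id]
    smooth_fun_frechet_measurable[OF smooth_fun_frechet[OF assms(1)] measurable_const id]
  show ?thesis unfolding gen_def by measurable
qed

lemma generator_integral:
  assumes "smooth_fun \<phi>" and s: "0 \<le> s"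
  shows "(LINT z:phase|f s. generator dif g U \<alpha> lam \<sigma> \<tau> (\<rho> s) \<phi> z) = (\<integral>z. gen s \<phi> z \<partial>f s)"
proof -
  have "indicat_real phase z *\<^sub>R generator dif g U \<alpha> lam \<sigma> \<tau> (\<rho> s) \<phi> z = indicat_real phase z * gen s \<phi> z" for z
    using generator_eq_gen[OF assms(1), of z] by (auto simp: indicator_def)
  moreover have "(\<integral>z. indicat_real phase z * gen s \<phi> z \<partial>f s) = (\<integral>z. gen s \<phi> z \<partial>f s)"
  proof (rule integral_cong_AE)
    show "(\<lambda>z. indicat_real phase z * gen s \<phi> z) \<in> borel_measurable (f s)"
      using gen_meas[OF assms] phase_measurable f_moments(2)[OF s]
      by (intro borel_measurable_times borel_measurable_indicator) auto
    show "AE z in f s. indicat_real phase z * gen s \<phi> z = gen s \<phi> z"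
      using f_moments(3)[OF s] by eventually_elim auto
  qed (rule gen_meas[OF assms])
  ultimately show ?thesis unfolding set_lebesgue_integral_def by (simp only:)
qed

lemma consensus_bounded: "\<exists>B\<ge>0. \<forall>s\<in>{0..t}. \<forall>z\<in>phase. norm (consensus s z) \<le> B"
proof -
  obtain K where K: "\<And>s. s \<in> {0..t} \<Longrightarrow> (\<integral>z. (norm z)\<^sup>2 \<partial>f s) \<le> K"
    using second_moment_bounded[OF f_cont] by blast
  define B where "B = \<bar>(1 + K) * exp (\<alpha> * (norm (g 0) + L * (1 + K)))\<bar>"
  have "norm (consensus s z) \<le> B" if "s \<in> {0..t}" "z \<in> phase" for s z
  proof -
    have "(\<integral>x. (norm x)\<^sup>2 \<partial>\<rho> s) \<le> K" using marginal_second_moment[of s] K[OF that(1)] that by simp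
    then have "norm (consensus s z) \<le> (1 + K) * exp (\<alpha> * (norm (g 0) + L * (1 + K)))"
      unfolding consensus_def using that by (intro attracting_point_bound marginal_prob2) auto
    then show ?thesis by (simp add: B_def)
  qed
  then show ?thesis by (intro exI[of _ B]) (auto simp: B_def)
qed

text \<open>The commutator of the generator with multiplication by the cutoff: the terms in which at
  least one derivative falls on the cutoff.\<close>

definition cross :: "real \<Rightarrow> ((real^'d) \<times> (real^2) \<Rightarrow> real) \<Rightarrow> real \<Rightarrow> (real^'d) \<times> (real^2) \<Rightarrow> real" where
  "cross s \<phi> R z = lam * (\<phi> z * frechet_derivative (cutoff R) (at z) (consensus s z - fst z, 0))
      + \<sigma>\<^sup>2 / 2 * (\<Sum>l\<in>UNIV. diffusion_coeff dif l (fst z - consensus s z) *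
          (2 * (frechet_derivative \<phi> (at z) (axis l 1, 0) * frechet_derivative (cutoff R) (at z) (axis l 1, 0)) +
           \<phi> z * frechet_derivative (\<lambda>z'. frechet_derivative (cutoff R) (at z') (axis l 1, 0)) (at z) (axis l 1, 0)))
      + \<tau> * (speed s z * (\<phi> z * frechet_derivative (cutoff R) (at z) (0, Omega_dir)))"

lemma gen_mult_cutoff:
  assumes \<phi>: "smooth_fun \<phi>"
  shows "gen s (\<lambda>z. \<phi> z * cutoff R z) z = gen s \<phi> z * cutoff R z + cross s \<phi> R z"
proof -
  note c = smooth_fun_cutoff[of R]
  have 2: "frechet_derivative (\<lambda>z'. frechet_derivative (\<lambda>z. \<phi> z * cutoff R z) (at z') v) (at z) v =
      \<phi> z * frechet_derivative (\<lambda>z'. frechet_derivative (cutoff R) (at z') v) (at z) v +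
      2 * (frechet_derivative \<phi> (at z) v * frechet_derivative (cutoff R) (at z) v) +
      frechet_derivative (\<lambda>z'. frechet_derivative \<phi> (at z') v) (at z) v * cutoff R z" for v
    unfolding frechet_derivative_mult[OF \<phi> c]
    by (simp add: frechet_derivative_plus[OF smooth_fun.mult[OF \<phi> smooth_fun_frechet[OF c]]
          smooth_fun.mult[OF smooth_fun_frechet[OF \<phi>] c]]
        frechet_derivative_mult[OF \<phi> smooth_fun_frechet[OF c]]
        frechet_derivative_mult[OF smooth_fun_frechet[OF \<phi>] c])
  show ?thesis
    unfolding gen_def cross_def 2 unfolding frechet_derivative_mult[OF \<phi> c]
    by (simp add: algebra_simps sum.distrib sum_distrib_left)
qed

text \<open>The class covers both later uses, box bumps and squared distances to a curve. Growth is
  restricted on \<open>phase\<close> only, since the polynomial curves are unbounded for weights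
  outside the segment.\<close>

context
  fixes \<phi> :: "(real^'d) \<times> (real^2) \<Rightarrow> real" and K t B :: real
  assumes \<phi>: "smooth_fun \<phi>" and K: "0 \<le> K"
    and growth0: "\<And>z. z \<in> phase \<Longrightarrow> \<bar>\<phi> z\<bar> \<le> K * (1 + (norm (fst z))\<^sup>2)"
    and growth1: "\<And>z v. z \<in> phase \<Longrightarrow> \<bar>frechet_derivative \<phi> (at z) v\<bar> \<le> K * (1 + norm (fst z)) * norm v"
    and growth2: "\<And>z l. z \<in> phase \<Longrightarrow>
      \<bar>frechet_derivative (\<lambda>z'. frechet_derivative \<phi> (at z') (axis l 1, 0)) (at z) (axis l 1, 0)\<bar> \<le> K"
    and B: "0 \<le> B" "\<And>s z. s \<in> {0..t} \<Longrightarrow> z \<in> phase \<Longrightarrow> norm (consensus s z) \<le> B"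
begin

definition "weight z = 1 + (norm (fst z :: real^'d))\<^sup>2" for z :: "(real^'d) \<times> (real^2)"

definition "reach z = B + norm (fst z :: real^'d)" for z :: "(real^'d) \<times> (real^2)"

definition "gen_const = 2 * lam * K * (B + 1) + \<sigma>\<^sup>2 * real CARD('d) * (B + 1)\<^sup>2 * K + 2 * \<tau> * M * K"

text \<open>Two bounds on \<open>cross\<close> with complementary roles. \<open>cross_rate\<close>
  grows faster than quadratically but comes with a factor \<open>1 / R\<close>, so it gives
  pointwise convergence to 0; \<open>cross_const * weight\<close> does not decay but is uniform in
  \<open>R\<close> and integrable, so it dominates.\<close>

definition "cross_const = 12 * lam * K * (B + 1) + \<sigma>\<^sup>2 / 2 * real CARD('d) * (596 * K * (B + 1)\<^sup>2) + 12 * \<tau> * M * K"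

definition "cross_rate z = 12 * lam * K * weight z * reach z +
  \<sigma>\<^sup>2 / 2 * real CARD('d) * ((reach z)\<^sup>2 * (24 * K * (1 + norm (fst z)) + 500 * K * weight z)) + 12 * \<tau> * M * K * weight z"
  for z :: "(real^'d) \<times> (real^2)"

lemma sq_le_weight: "(1 + norm (fst z))\<^sup>2 \<le> 2 * weight z"
  using sum_squares_ge_zero[of "norm (fst z) - 1" 0] by (simp add: weight_def power2_eq_square algebra_simps)

lemma le_weight: "1 + norm (fst z) \<le> 2 * weight z" "1 \<le> weight z"
proof -
  show "1 \<le> weight z" by (simp add: weight_def)
  have "1 + norm (fst z) \<le> (1 + norm (fst z))\<^sup>2"
    using mult_left_mono[of 1 "1 + norm (fst z)" "1 + norm (fst z)"] by (simp add: power2_eq_square)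
  then show "1 + norm (fst z) \<le> 2 * weight z" using sq_le_weight[of z] by linarith
qed

lemma reach_le: "reach z \<le> (B + 1) * (1 + norm (fst z))" "0 \<le> reach z"
  using B(1) by (auto simp: reach_def algebra_simps)

lemma dist_consensus: "s \<in> {0..t} \<Longrightarrow> z \<in> phase \<Longrightarrow> norm (fst z - consensus s z) \<le> reach z"
  using B(2)[of s z] norm_triangle_ineq4[of "fst z" "consensus s z"] by (simp add: reach_def)

lemma diffusion_le_reach:
  "s \<in> {0..t} \<Longrightarrow> z \<in> phase \<Longrightarrow> \<bar>diffusion_coeff dif l (fst z - consensus s z)\<bar> \<le> (reach z)\<^sup>2"
  using power_mono[OF dist_consensus[of s z] norm_ge_zero, of 2]
    diffusion_coeff_le[of dif l "fst z - consensus s z"] diffusion_coeff_nonneg[of dif l "fst z - consensus s z"]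
  by simp

lemma reach_sq_le: "(reach z)\<^sup>2 \<le> (B + 1)\<^sup>2 * (2 * weight z)"
proof -
  have "(reach z)\<^sup>2 \<le> ((B + 1) * (1 + norm (fst z)))\<^sup>2" using reach_le by (rule power_mono)
  also have "\<dots> \<le> (B + 1)\<^sup>2 * (2 * weight z)"
    unfolding power_mult_distrib using sq_le_weight by (intro mult_left_mono) auto
  finally show ?thesis .
qed

text \<open>The common shape of \<open>gen\<close> and \<open>cross\<close>: a drift term, a
  diffusion sum and a transport term in \<open>w\<close>.\<close>

lemma second_order_bound:
  assumes s: "s \<in> {0..t}" and z: "z \<in> phase"
    and u: "\<bar>u\<bar> \<le> p * reach z" and u': "\<bar>u'\<bar> \<le> p" and h: "\<And>l. \<bar>h l\<bar> \<le> c"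
  shows "\<bar>lam * u + \<sigma>\<^sup>2 / 2 * (\<Sum>l\<in>UNIV. diffusion_coeff dif l (fst z - consensus s z) * h l) +
    \<tau> * (speed s z * u')\<bar> \<le> lam * (p * reach z) + \<sigma>\<^sup>2 / 2 * (real CARD('d) * ((reach z)\<^sup>2 * c)) + \<tau> * (M * p)"
proof -
  let ?D = "\<lambda>l. diffusion_coeff dif l (fst z - consensus s z)"
  have "\<bar>\<Sum>l\<in>UNIV. ?D l * h l\<bar> \<le> (\<Sum>l\<in>(UNIV :: 'd set). (reach z)\<^sup>2 * c)"
    using diffusion_le_reach[OF s z] h
    by (intro order_trans[OF sum_abs sum_mono]) (auto simp: abs_mult intro!: mult_mono)
  then have "\<sigma>\<^sup>2 / 2 * \<bar>\<Sum>l\<in>UNIV. ?D l * h l\<bar> \<le> \<sigma>\<^sup>2 / 2 * (real CARD('d) * ((reach z)\<^sup>2 * c))"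
    by (intro mult_left_mono) auto
  then have "\<bar>\<sigma>\<^sup>2 / 2 * (\<Sum>l\<in>UNIV. ?D l * h l)\<bar> \<le> \<sigma>\<^sup>2 / 2 * (real CARD('d) * ((reach z)\<^sup>2 * c))"
    by (simp add: abs_mult)
  moreover have "\<bar>lam * u\<bar> \<le> lam * (p * reach z)"
    using u params(1) by (simp add: abs_mult)
  moreover have "\<bar>\<tau> * (speed s z * u')\<bar> \<le> \<tau> * (M * p)"
    unfolding abs_mult using speed_bound[of s z] s u' params(3) M_nonneg by (intro mult_mono) auto
  ultimately show ?thesis by linarith
qed

lemma gen_le:
  assumes s: "s \<in> {0..t}" and z: "z \<in> phase"
  shows "\<bar>gen s \<phi> z\<bar> \<le> gen_const * weight z"
proof -
  let ?p = "K * (1 + norm (fst z))"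
  have "\<bar>frechet_derivative \<phi> (at z) (consensus s z - fst z, 0)\<bar> \<le> ?p * norm (consensus s z - fst z)"
    using growth1[OF z, of "(consensus s z - fst z, 0)"] by simp
  also have "\<dots> \<le> ?p * reach z"
    using dist_consensus[OF s z] K by (intro mult_left_mono) (auto simp: norm_minus_commute)
  finally have u: "\<bar>frechet_derivative \<phi> (at z) (consensus s z - fst z, 0)\<bar> \<le> ?p * reach z" .
  have u': "\<bar>frechet_derivative \<phi> (at z) (0, Omega_dir)\<bar> \<le> ?p"
    using growth1[OF z, of "(0, Omega_dir)"] by (simp add: norm_Omega_dir)
  have "\<bar>gen s \<phi> z\<bar> \<le> lam * (?p * reach z) + \<sigma>\<^sup>2 / 2 * (real CARD('d) * ((reach z)\<^sup>2 * K)) + \<tau> * (M * ?p)"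
    unfolding gen_def by (rule second_order_bound[OF s z u u' growth2[OF z]])
  also have "\<dots> \<le> lam * (K * (B + 1) * (2 * weight z)) + \<sigma>\<^sup>2 / 2 * (real CARD('d) * ((B + 1)\<^sup>2 * (2 * weight z) * K)) +
      \<tau> * (M * (K * (2 * weight z)))"
  proof (intro add_mono mult_left_mono mult_right_mono)
    have "?p * reach z \<le> ?p * ((B + 1) * (1 + norm (fst z)))"
      using reach_le(1) K by (intro mult_left_mono) auto
    also have "\<dots> = K * (B + 1) * (1 + norm (fst z))\<^sup>2" by (simp add: power2_eq_square algebra_simps)
    also have "\<dots> \<le> K * (B + 1) * (2 * weight z)" using sq_le_weight K B(1) by (intro mult_left_mono) auto
    finally show "?p * reach z \<le> K * (B + 1) * (2 * weight z)" .
  qed (use reach_sq_le le_weight(1) K params M_nonneg in auto)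
  also have "\<dots> = gen_const * weight z" by (simp add: gen_const_def algebra_simps)
  finally show ?thesis .
qed

lemma cross_abs:
  assumes s: "s \<in> {0..t}" and z: "z \<in> phase" and R: "0 < R"
  shows "\<bar>cross s \<phi> R z\<bar> \<le> 12 * lam * K * weight z * reach z / R +
    \<sigma>\<^sup>2 / 2 * real CARD('d) * ((reach z)\<^sup>2 * (24 * K * (1 + norm (fst z)) / R + 500 * K * weight z / R\<^sup>2))
    + 12 * \<tau> * M * K * weight z / R"
proof -
  let ?x = "norm (fst z)" and ?c = "cutoff R :: (real^'d) \<times> (real^2) \<Rightarrow> real"
  have \<phi>z: "\<bar>\<phi> z\<bar> \<le> K * weight z" using growth0[OF z] by (simp add: weight_def)
  have Kq: "0 \<le> K * weight z" using K le_weight(2)[of z] by simp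
  have first: "\<bar>\<phi> z * frechet_derivative ?c (at z) v\<bar> \<le> K * weight z * (12 / R) * a" if "norm v \<le> a" for v a
  proof -
    have "\<bar>frechet_derivative ?c (at z) v\<bar> \<le> 12 / R * a"
      using cutoff_frechet_bound(1)[OF R, of z v] mult_left_mono[OF that, of "12 / R"] R by simp
    from mult_mono[OF \<phi>z this Kq] show ?thesis by (simp add: abs_mult mult.assoc)
  qed
  have u: "\<bar>\<phi> z * frechet_derivative ?c (at z) (consensus s z - fst z, 0)\<bar> \<le> K * weight z * (12 / R) * reach z"
    using dist_consensus[OF s z] by (intro first) (simp add: norm_minus_commute)
  have u': "\<bar>\<phi> z * frechet_derivative ?c (at z) (0, Omega_dir)\<bar> \<le> K * weight z * (12 / R)"
    using first[of "(0, Omega_dir)" 1] by (simp add: norm_Omega_dir)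
  have h: "\<bar>2 * (frechet_derivative \<phi> (at z) v * frechet_derivative ?c (at z) v) +
      \<phi> z * frechet_derivative (\<lambda>z'. frechet_derivative ?c (at z') v) (at z) v\<bar>
    \<le> 24 * K * (1 + ?x) / R + 500 * K * weight z / R\<^sup>2" (is "\<bar>2 * (?a * ?b) + _ * ?d\<bar> \<le> _")
    if v: "v = (axis l 1, 0)" for l and v :: "(real^'d) \<times> (real^2)"
  proof -
    have nv: "norm v = 1" by (simp add: v)
    have "\<bar>?a\<bar> * \<bar>?b\<bar> \<le> K * (1 + ?x) * (12 / R)"
      using growth1[OF z, of v] cutoff_frechet_bound(1)[OF R, of z v] K nv by (intro mult_mono) auto
    moreover have "\<bar>\<phi> z\<bar> * \<bar>?d\<bar> \<le> K * weight z * (500 / R\<^sup>2)"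
      using \<phi>z cutoff_frechet2_bound(1)[OF R, of v z] Kq nv by (intro mult_mono) auto
    ultimately have "2 * (\<bar>?a\<bar> * \<bar>?b\<bar>) + \<bar>\<phi> z\<bar> * \<bar>?d\<bar> \<le> 2 * (K * (1 + ?x) * (12 / R)) + K * weight z * (500 / R\<^sup>2)"
      by linarith
    also have "\<dots> = 24 * K * (1 + ?x) / R + 500 * K * weight z / R\<^sup>2" by (simp add: ac_simps)
    finally show ?thesis
      by (rule order_trans[rotated]) (rule order_trans[OF abs_triangle_ineq], simp add: abs_mult)
  qed
  have "\<bar>cross s \<phi> R z\<bar> \<le> lam * (K * weight z * (12 / R) * reach z) +
      \<sigma>\<^sup>2 / 2 * (real CARD('d) * ((reach z)\<^sup>2 * (24 * K * (1 + ?x) / R + 500 * K * weight z / R\<^sup>2))) + \<tau> * (M * (K * weight z * (12 / R)))"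
    unfolding cross_def by (rule second_order_bound[OF s z u u' h[OF refl]])
  also have "\<dots> = 12 * lam * K * weight z * reach z / R +
      \<sigma>\<^sup>2 / 2 * real CARD('d) * ((reach z)\<^sup>2 * (24 * K * (1 + ?x) / R + 500 * K * weight z / R\<^sup>2)) + 12 * \<tau> * M * K * weight z / R"
    by simp
  finally show ?thesis .
qed

lemma cross_le_rate:
  assumes s: "s \<in> {0..t}" and z: "z \<in> phase" and R: "1 \<le> R"
  shows "\<bar>cross s \<phi> R z\<bar> \<le> cross_rate z / R"
proof -
  have "500 * K * weight z / R\<^sup>2 \<le> 500 * K * weight z / R"
    using R K le_weight(2)[of z] by (intro divide_left_mono) (auto simp: power2_eq_square)
  then have "\<sigma>\<^sup>2 / 2 * real CARD('d) * ((reach z)\<^sup>2 * (24 * K * (1 + norm (fst z)) / R + 500 * K * weight z / R\<^sup>2)) \<le>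
      \<sigma>\<^sup>2 / 2 * real CARD('d) * ((reach z)\<^sup>2 * (24 * K * (1 + norm (fst z)) / R + 500 * K * weight z / R))"
    by (intro mult_left_mono) auto
  then have "\<bar>cross s \<phi> R z\<bar> \<le> 12 * lam * K * weight z * reach z / R +
      \<sigma>\<^sup>2 / 2 * real CARD('d) * ((reach z)\<^sup>2 * (24 * K * (1 + norm (fst z)) / R + 500 * K * weight z / R))
      + 12 * \<tau> * M * K * weight z / R"
    using cross_abs[OF s z, of R] R by linarith
  also have "\<dots> = cross_rate z / R" by (simp add: cross_rate_def add_divide_distrib algebra_simps)
  finally show ?thesis .
qed

text \<open>Beyond radius \<open>R\<close> the derivatives of the cutoff vanish. Inside,
  \<open>reach z \<le> (B + 1) * R\<close>, so each factor \<open>1 / R\<close> absorbs one factor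
  \<open>reach\<close>, and quadratic growth remains. The number 596 is
  \<open>2 * 48 + 500\<close>.\<close>

lemma cross_le_const:
  assumes s: "s \<in> {0..t}" and z: "z \<in> phase" and R: "1 \<le> R"
  shows "\<bar>cross s \<phi> R z\<bar> \<le> cross_const * weight z"
proof (cases "R \<le> norm z")
  case True
  have "cross s \<phi> R z = 0"
    using cutoff_frechet_bound(2)[OF _ True] cutoff_frechet2_bound(2)[OF _ True] R by (simp add: cross_def)
  moreover have "0 \<le> cross_const * weight z"
    using params K B(1) M_nonneg le_weight(2)[of z] by (simp add: cross_const_def)
  ultimately show ?thesis by simp
next
  case False
  let ?x = "norm (fst z)"
  have x: "?x \<le> R" using False norm_fst_le[of "fst z" "snd z"] by simp
  have nR: "reach z \<le> (B + 1) * R"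
    using x R B(1) mult_left_mono[of 1 R B] by (simp add: reach_def algebra_simps)
  have 1: "12 * lam * K * weight z * reach z / R \<le> 12 * lam * K * (B + 1) * weight z"
  proof -
    have "12 * lam * K * weight z * reach z \<le> 12 * lam * K * weight z * ((B + 1) * R)"
      using nR params K le_weight(2)[of z] by (intro mult_left_mono) auto
    then show ?thesis using R by (simp add: pos_divide_le_eq algebra_simps)
  qed
  have 3: "12 * \<tau> * M * K * weight z / R \<le> 12 * \<tau> * M * K * weight z"
    using divide_left_mono[of 1 R "12 * \<tau> * M * K * weight z"] R params K M_nonneg le_weight(2)[of z] by simp
  have 2: "(reach z)\<^sup>2 * (24 * K * (1 + ?x) / R + 500 * K * weight z / R\<^sup>2) \<le> 596 * K * (B + 1)\<^sup>2 * weight z"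
  proof -
    have "24 * K * ((1 + ?x) / R) \<le> 24 * K * 2"
      using x R K by (intro mult_left_mono) (auto simp: pos_divide_le_eq)
    then have "(reach z)\<^sup>2 * (24 * K * (1 + ?x) / R) \<le> (B + 1)\<^sup>2 * (2 * weight z) * (48 * K)"
      using reach_sq_le[of z] K R le_weight(2)[of z] by (intro mult_mono) auto
    moreover have "(reach z)\<^sup>2 * (500 * K * weight z / R\<^sup>2) \<le> (B + 1)\<^sup>2 * (500 * K * weight z)"
    proof -
      have "(reach z)\<^sup>2 \<le> ((B + 1) * R)\<^sup>2" using nR reach_le(2) by (rule power_mono)
      then have "(reach z)\<^sup>2 / R\<^sup>2 \<le> (B + 1)\<^sup>2" using R by (simp add: pos_divide_le_eq power_mult_distrib)
      from mult_right_mono[OF this, of "500 * K * weight z"] show ?thesis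
        using K le_weight(2)[of z] by simp
    qed
    ultimately show ?thesis by (simp add: algebra_simps)
  qed
  have "\<sigma>\<^sup>2 / 2 * real CARD('d) * ((reach z)\<^sup>2 * (24 * K * (1 + ?x) / R + 500 * K * weight z / R\<^sup>2)) \<le>
      \<sigma>\<^sup>2 / 2 * real CARD('d) * (596 * K * (B + 1)\<^sup>2 * weight z)"
    using 2 by (rule mult_left_mono) simp
  then have "\<bar>cross s \<phi> R z\<bar> \<le> 12 * lam * K * (B + 1) * weight z +
      \<sigma>\<^sup>2 / 2 * real CARD('d) * (596 * K * (B + 1)\<^sup>2 * weight z) + 12 * \<tau> * M * K * weight z"
    using cross_abs[OF s z, of R] R 1 3 by linarith
  then show ?thesis by (simp add: cross_const_def algebra_simps)
qed

lemma weight_integrable: "0 \<le> s \<Longrightarrow> integrable (f s) weight"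
proof -
  assume s: "0 \<le> s"
  show ?thesis
  proof (rule integrable_quadratic_growth[OF f_prob2[OF s]])
    show "weight \<in> borel_measurable (f s)" unfolding weight_def using fst_meas[OF s] by measurable
    show "norm (weight z) \<le> 1 * (1 + (norm z)\<^sup>2)" if "z \<in> phase" for z
      using power_mono[OF norm_fst_le[of "fst z" "snd z"], of 2] by (simp add: weight_def)
  qed
qed

lemma gen_integrable: "s \<in> {0..t} \<Longrightarrow> integrable (f s) (gen s \<phi>)"
proof (rule Bochner_Integration.integrable_bound)
  assume s: "s \<in> {0..t}"
  then have s0: "0 \<le> s" by simp
  show "integrable (f s) (\<lambda>z. gen_const * weight z)" using weight_integrable[OF s0] by simp
  show "gen s \<phi> \<in> borel_measurable (f s)" using gen_meas[OF \<phi> s0] .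
  show "AE z in f s. norm (gen s \<phi> z) \<le> norm (gen_const * weight z)"
    using f_moments(3)[OF s0] by eventually_elim (use gen_le[OF s] in fastforce)
qed

lemma phi_integrable: "0 \<le> s \<Longrightarrow> integrable (f s) \<phi>"
proof (rule Bochner_Integration.integrable_bound)
  assume s: "0 \<le> s"
  show "integrable (f s) (\<lambda>z. K * weight z)" using weight_integrable[OF s] by simp
  show "\<phi> \<in> borel_measurable (f s)"
    using borel_measurable_continuous_onI[OF smooth_fun_continuous[OF \<phi>]]
    by (simp add: measurable_cong_sets[OF f_moments(2)[OF s] refl])
  show "AE z in f s. norm (\<phi> z) \<le> norm (K * weight z)"
    using f_moments(3)[OF s] by eventually_elim (use growth0 in \<open>fastforce simp: weight_def\<close>)
qed

text \<open>Products with cutoffs are admissible test functions. At each time the integrals converge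
  by dominated convergence with a multiple of \<open>weight\<close>; a second dominated convergence,
  in time, rests on the boundedness of second moments on \<open>{0..t}\<close>.\<close>

lemma weak_identity:
  assumes t: "0 \<le> t"
  shows "((\<lambda>s. \<integral>z. gen s \<phi> z \<partial>f s) has_integral ((\<integral>z. \<phi> z \<partial>f t) - (\<integral>z. \<phi> z \<partial>f 0))) {0..t}"
proof -
  \<comment> \<open>The successor keeps the radius at least 1, as both bounds on
    \<open>cross\<close> require.\<close>
  let ?R = "\<lambda>k. real (Suc k)"
  define \<phi>' where "\<phi>' k z = \<phi> z * cutoff (?R k) z" for k z
  have sm: "smooth_fun (\<phi>' k)" for k
    unfolding \<phi>'_def[abs_def] by (intro smooth_fun.mult \<phi> smooth_fun_cutoff)
  have test: "test_function (\<phi>' k)" for k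
    unfolding \<phi>'_def[abs_def] by (intro test_function_mult_cutoff \<phi>) simp
  have hi: "((\<lambda>s. \<integral>z. gen s (\<phi>' k) z \<partial>f s) has_integral ((\<integral>z. \<phi>' k z \<partial>f t) - (\<integral>z. \<phi>' k z \<partial>f 0))) {0..t}" for k
  proof -
    have "((\<lambda>s. LINT z:phase|f s. generator dif g U \<alpha> lam \<sigma> \<tau> (\<rho> s) (\<phi>' k) z)
        has_integral ((\<integral>z. \<phi>' k z \<partial>f t) - (\<integral>z. \<phi>' k z \<partial>f 0))) {0..t}"
      using sol test t by (auto simp: mean_field_solution_def)
    then show ?thesis
      by (rule has_integral_eq[rotated]) (auto simp: generator_integral[OF sm])
  qed
  define C where "C = gen_const + cross_const"
  have gen_eq: "gen s (\<phi>' k) z = gen s \<phi> z * cutoff (?R k) z + cross s \<phi> (?R k) z" for s k z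
    unfolding \<phi>'_def[abs_def] by (rule gen_mult_cutoff[OF \<phi>])
  have gen_bound: "\<bar>gen s (\<phi>' k) z\<bar> \<le> C * weight z" if "s \<in> {0..t}" "z \<in> phase" for s k z
  proof -
    have "\<bar>gen s \<phi> z * cutoff (?R k) z\<bar> \<le> gen_const * weight z * 1"
      unfolding abs_mult using gen_le[OF that] cutoff_bounds[of "?R k" z]
      by (intro mult_mono) auto
    then show ?thesis
      using cross_le_const[OF that, of "?R k"] unfolding gen_eq C_def distrib_right by simp
  qed
  have inv: "(\<lambda>k. c / ?R k) \<longlonglongrightarrow> 0" for c
    using tendsto_mult[OF tendsto_const[of c] LIMSEQ_inverse_real_of_nat] by (simp add: divide_inverse)
  have gen_lim: "(\<lambda>k. gen s (\<phi>' k) z) \<longlonglongrightarrow> gen s \<phi> z" if "s \<in> {0..t}" "z \<in> phase" for s z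
  proof -
    have "(\<lambda>k. cross s \<phi> (?R k) z) \<longlonglongrightarrow> 0"
      using cross_le_rate[OF that]
      by (intro Lim_null_comparison[OF _ inv[of "cross_rate z"]] always_eventually) auto
    from tendsto_add[OF tendsto_mult[OF tendsto_const[of "gen s \<phi> z"] cutoff_tendsto[of z]] this]
    show ?thesis unfolding gen_eq by simp
  qed
  have lim_s: "(\<lambda>k. \<integral>z. gen s (\<phi>' k) z \<partial>f s) \<longlonglongrightarrow> (\<integral>z. gen s \<phi> z \<partial>f s)" if s: "s \<in> {0..t}" for s
  proof (rule integral_dominated_convergence[where w = "\<lambda>z. C * weight z"])
    have s0: "0 \<le> s" using s by simp
    note full = f_moments(3)[OF s0]
    show "gen s \<phi> \<in> borel_measurable (f s)" by (rule gen_meas[OF \<phi> s0])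
    show "gen s (\<phi>' k) \<in> borel_measurable (f s)" for k by (rule gen_meas[OF sm s0])
    show "integrable (f s) (\<lambda>z. C * weight z)" using weight_integrable[OF s0] by simp
    show "AE z in f s. (\<lambda>k. gen s (\<phi>' k) z) \<longlonglongrightarrow> gen s \<phi> z"
      using full by eventually_elim (rule gen_lim[OF s])
    show "AE z in f s. norm (gen s (\<phi>' k) z) \<le> C * weight z" for k
      using full by eventually_elim (use gen_bound[OF s] in simp)
  qed
  obtain K2 where K2: "\<And>s. s \<in> {0..t} \<Longrightarrow> (\<integral>z. (norm z)\<^sup>2 \<partial>f s) \<le> K2"
    using second_moment_bounded[OF f_cont] by blast
  have C: "0 \<le> C"
    using params K B(1) M_nonneg by (simp add: C_def gen_const_def cross_const_def)
  have bound: "norm (\<integral>z. gen s (\<phi>' k) z \<partial>f s) \<le> C * (1 + K2)" if s: "s \<in> {0..t}" for s k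
  proof -
    have s0: "0 \<le> s" using s by simp
    interpret prob_space "f s" by (rule f_moments[OF s0])
    have ae: "AE z in f s. norm (gen s (\<phi>' k) z) \<le> C * weight z"
      using f_moments(3)[OF s0] by eventually_elim (use gen_bound[OF s] in simp)
    have Cq: "integrable (f s) (\<lambda>z. C * weight z)" using weight_integrable[OF s0] by simp
    have int: "integrable (f s) (gen s (\<phi>' k))"
      by (rule Bochner_Integration.integrable_bound[OF Cq gen_meas[OF sm s0]])
        (use ae in \<open>eventually_elim, simp\<close>)
    have "norm (\<integral>z. gen s (\<phi>' k) z \<partial>f s) \<le> (\<integral>z. norm (gen s (\<phi>' k) z) \<partial>f s)"
      by (rule integral_norm_bound)
    also have "\<dots> \<le> (\<integral>z. C * weight z \<partial>f s)"
      by (rule integral_mono_AE[OF integrable_norm[OF int] Cq ae])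
    also have "\<dots> = C * (\<integral>z. weight z \<partial>f s)" by simp
    also have "(\<integral>z. weight z \<partial>f s) \<le> (\<integral>z. 1 + (norm z)\<^sup>2 \<partial>f s)"
    proof (rule integral_mono[OF weight_integrable[OF s0]])
      show "integrable (f s) (\<lambda>z. 1 + (norm z)\<^sup>2)" using f_moments(4)[OF s0] by simp
      show "weight z \<le> 1 + (norm z)\<^sup>2" for z
        using power_mono[OF norm_fst_le[of "fst z" "snd z"], of 2] by (simp add: weight_def)
    qed
    also have "\<dots> = 1 + (\<integral>z. (norm z)\<^sup>2 \<partial>f s)" using f_moments(4)[OF s0] by (simp add: prob_space)
    also have "\<dots> \<le> 1 + K2" using K2[OF s] by simp
    finally show ?thesis using C by (simp add: mult_left_mono)
  qed
  have lim_phi: "(\<lambda>k. \<integral>z. \<phi>' k z \<partial>f s) \<longlonglongrightarrow> (\<integral>z. \<phi> z \<partial>f s)" if s: "0 \<le> s" for s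
  proof (rule integral_dominated_convergence[where w = "\<lambda>z. norm (\<phi> z)"])
    show "integrable (f s) (\<lambda>z. norm (\<phi> z))" using phi_integrable[OF s] by simp
    show "\<phi> \<in> borel_measurable (f s)" using phi_integrable[OF s] by simp
    show "\<phi>' k \<in> borel_measurable (f s)" for k
      using borel_measurable_continuous_onI[OF smooth_fun_continuous[OF sm[of k]]]
      by (simp add: measurable_cong_sets[OF f_moments(2)[OF s] refl])
    show "AE z in f s. (\<lambda>k. \<phi>' k z) \<longlonglongrightarrow> \<phi> z"
      using tendsto_mult[OF tendsto_const cutoff_tendsto] by (intro AE_I2) (fastforce simp: \<phi>'_def)
    show "AE z in f s. norm (\<phi>' k z) \<le> norm (\<phi> z)" for k
      by (intro AE_I2) (simp add: \<phi>'_def abs_mult mult_left_le abs_of_nonneg[OF cutoff_bounds(1)] cutoff_bounds(2))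
  qed
  have int: "(\<lambda>s. \<integral>z. gen s (\<phi>' k) z \<partial>f s) integrable_on {0..t}" for k
    using hi by blast
  have dc: "(\<lambda>s. \<integral>z. gen s \<phi> z \<partial>f s) integrable_on {0..t}"
    "(\<lambda>k. integral {0..t} (\<lambda>s. \<integral>z. gen s (\<phi>' k) z \<partial>f s)) \<longlonglongrightarrow> integral {0..t} (\<lambda>s. \<integral>z. gen s \<phi> z \<partial>f s)"
    using dominated_convergence[where f = "\<lambda>k s. \<integral>z. gen s (\<phi>' k) z \<partial>f s"
        and g = "\<lambda>s. \<integral>z. gen s \<phi> z \<partial>f s", OF int integrable_const_ivl[of "C * (1 + K2)"]]
      bound lim_s by auto
  have "integral {0..t} (\<lambda>s. \<integral>z. gen s (\<phi>' k) z \<partial>f s) = (\<integral>z. \<phi>' k z \<partial>f t) - (\<integral>z. \<phi>' k z \<partial>f 0)" for k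
    using hi by (rule integral_unique)
  then have "(\<lambda>k. integral {0..t} (\<lambda>s. \<integral>z. gen s (\<phi>' k) z \<partial>f s)) \<longlonglongrightarrow> (\<integral>z. \<phi> z \<partial>f t) - (\<integral>z. \<phi> z \<partial>f 0)"
    using tendsto_diff[OF lim_phi[OF t] lim_phi[of 0]] by simp
  from LIMSEQ_unique[OF dc(2) this] dc(1) show ?thesis
    by (simp add: has_integral_integrable_integral)
qed

end

end

section \<open>Lower bound on the mass near a minimizer\<close>

lemma frechet_derivative_fst_expand:
  assumes "smooth_fun (\<phi> :: (real^'d) \<times> (real^2) \<Rightarrow> real)"
  shows "frechet_derivative \<phi> (at z) (v, 0) = (\<Sum>l\<in>UNIV. v $ l * frechet_derivative \<phi> (at z) (axis l 1, 0))"
proof -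
  have "frechet_derivative \<phi> (at z) (v, 0) = frechet_derivative \<phi> (at z) (\<Sum>l\<in>UNIV. (v $ l) *\<^sub>R (axis l 1, 0))"
    by (simp only: sum_cart_axis_fst)
  also have "\<dots> = (\<Sum>l\<in>UNIV. v $ l * frechet_derivative \<phi> (at z) (axis l 1, 0))"
    using smooth_fun_frechet_linear[OF assms, of z] by (simp only: linear_sum linear_scale real_scaleR_def)
  finally show ?thesis .
qed

lemma frechet_derivative_pair:
  assumes "smooth_fun (\<phi> :: (real^'d) \<times> (real^2) \<Rightarrow> real)"
  shows "frechet_derivative \<phi> (at z) (v, w) = frechet_derivative \<phi> (at z) (v, 0) + frechet_derivative \<phi> (at z) (0, w)"
proof -
  have "(v, w) = (v, 0) + (0, w)" by simp
  then show ?thesis using linear_add[OF smooth_fun_frechet_linear[OF assms, of z]] by metis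
qed

lemma box_bump_frechet_snd: "frechet_derivative (box_bump c r) (at (z :: (real^'d) \<times> (real^2))) (0, w) = 0"
  by (rule frechet_derivative_eq_DERIV[OF smooth_fun_box_bump]) (simp add: box_bump_def)

lemma abs_bump': "\<bar>bump' x\<bar> \<le> 4"
proof (cases "\<bar>x\<bar> \<le> 1")
  case True
  then have "\<bar>bump' x\<bar> \<le> 2 * 1 * 2"
    unfolding bump'_def abs_mult using flat_exp_bounded[of 2 "1 - x\<^sup>2"] by (intro mult_mono) auto
  then show ?thesis by simp
qed (simp add: bump_eq_0)

lemma abs_bump'': "\<bar>bump'' x\<bar> \<le> 148"
proof (cases "\<bar>x\<bar> \<le> 1")
  case True
  let ?s = "1 - x\<^sup>2"
  have f: "\<bar>flat_exp 4 ?s - 2 * flat_exp 3 ?s\<bar> \<le> 36" "\<bar>flat_exp 2 ?s\<bar> \<le> 2"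
    using flat_exp_bounded[of 4 ?s] flat_exp_bounded[of 3 ?s] flat_exp_bounded[of 2 ?s]
    by (auto simp: fact_numeral)
  have "x\<^sup>2 \<le> 1" using True by (simp add: abs_square_le_1)
  then have "\<bar>4 * x\<^sup>2 * (flat_exp 4 ?s - 2 * flat_exp 3 ?s)\<bar> \<le> 4 * 1 * 36"
    unfolding abs_mult using f by (intro mult_mono) auto
  then show ?thesis unfolding bump''_def using f(2) by linarith
qed (simp add: bump_eq_0)

lemma prod_bump_bounds: "0 \<le> (\<Prod>j\<in>I. bump (u j))" "(\<Prod>j\<in>I. bump (u j)) \<le> 1"
  "\<bar>\<Prod>j\<in>I. bump (u j)\<bar> \<le> 1"
  unfolding abs_prod by (auto intro!: prod_nonneg prod_le_1 simp: bump_nonneg bump_le_1)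

lemma le_of_le_add_eps:
  fixes a b C :: real
  assumes "\<And>\<eta>. 0 < \<eta> \<Longrightarrow> \<eta> \<le> 1 \<Longrightarrow> a \<le> b + \<eta> * C"
  shows "a \<le> b"
proof (rule field_le_epsilon)
  fix e :: real assume e: "0 < e"
  define \<eta> where "\<eta> = min 1 (e / (\<bar>C\<bar> + 1))"
  have \<eta>: "0 < \<eta>" "\<eta> \<le> 1" using e by (auto simp: \<eta>_def)
  have "\<eta> * C \<le> \<eta> * (\<bar>C\<bar> + 1)" using \<eta> by (intro mult_left_mono) auto
  also have "\<dots> \<le> e / (\<bar>C\<bar> + 1) * (\<bar>C\<bar> + 1)" by (intro mult_right_mono) (auto simp: \<eta>_def)
  finally have "\<eta> * C \<le> e" by simp
  then show "a \<le> b + e" using assms[OF \<eta>] by linarith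
qed

context mean_field
begin

text \<open>One bound on the attracting point over \<open>{0..t}\<close> serves both end times, and
  the identity on \<open>{s..t}\<close> is the difference of two identities started at 0. The bound
  depending on \<alpha> does not appear in the conclusions.\<close>

lemma weak_identity_interval:
  assumes \<phi>: "smooth_fun \<phi>" and K: "0 \<le> K"
    and growth0: "\<And>z. z \<in> phase \<Longrightarrow> \<bar>\<phi> z\<bar> \<le> K * (1 + (norm (fst z))\<^sup>2)"
    and growth1: "\<And>z v. z \<in> phase \<Longrightarrow> \<bar>frechet_derivative \<phi> (at z) v\<bar> \<le> K * (1 + norm (fst z)) * norm v"
    and growth2: "\<And>z l. z \<in> phase \<Longrightarrow>
      \<bar>frechet_derivative (\<lambda>z'. frechet_derivative \<phi> (at z') (axis l 1, 0)) (at z) (axis l 1, 0)\<bar> \<le> K"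
    and st: "0 \<le> s" "s \<le> t"
  shows "(\<lambda>s. \<integral>z. gen s \<phi> z \<partial>f s) integrable_on {s..t}"
    "(\<integral>z. \<phi> z \<partial>f t) - (\<integral>z. \<phi> z \<partial>f s) = integral {s..t} (\<lambda>s. \<integral>z. gen s \<phi> z \<partial>f s)"
    "integrable (f t) \<phi>" "integrable (f t) (gen t \<phi>)"
proof -
  have t: "0 \<le> t" using st by simp
  obtain B where B: "0 \<le> B" "\<And>s z. s \<in> {0..t} \<Longrightarrow> z \<in> phase \<Longrightarrow> norm (consensus s z) \<le> B"
    using consensus_bounded[of t] by blast
  have B': "\<And>s' z. s' \<in> {0..s} \<Longrightarrow> z \<in> phase \<Longrightarrow> norm (consensus s' z) \<le> B" using B(2) st by auto
  have 1: "((\<lambda>s. \<integral>z. gen s \<phi> z \<partial>f s) has_integral ((\<integral>z. \<phi> z \<partial>f t) - (\<integral>z. \<phi> z \<partial>f 0))) {0..t}"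
    by (rule weak_identity[OF \<phi> K, where B = B]) (fact growth0 growth1 growth2 B t)+
  have 2: "((\<lambda>s. \<integral>z. gen s \<phi> z \<partial>f s) has_integral ((\<integral>z. \<phi> z \<partial>f s) - (\<integral>z. \<phi> z \<partial>f 0))) {0..s}"
    by (rule weak_identity[OF \<phi> K, where B = B]) (fact growth0 growth1 growth2 B(1) B' st)+
  show "integrable (f t) \<phi>"
    by (rule phi_integrable[OF \<phi> K, where B = B and t = t]) (fact growth0 growth1 growth2 B t)+
  have tt: "t \<in> {0..t}" using t by simp
  show "integrable (f t) (gen t \<phi>)"
    by (rule gen_integrable[OF \<phi> K, where B = B and t = t]) (fact growth0 growth1 growth2 B tt)+
  show 3: "(\<lambda>s. \<integral>z. gen s \<phi> z \<partial>f s) integrable_on {s..t}"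
    by (rule integrable_on_subinterval[OF has_integral_integrable[OF 1]]) (use st in simp)
  have "integral {0..s} (\<lambda>s. \<integral>z. gen s \<phi> z \<partial>f s) + integral {s..t} (\<lambda>s. \<integral>z. gen s \<phi> z \<partial>f s) =
      integral {0..t} (\<lambda>s. \<integral>z. gen s \<phi> z \<partial>f s)"
    using st by (intro Henstock_Kurzweil_Integration.integral_combine has_integral_integrable[OF 1])
  then show "(\<integral>z. \<phi> z \<partial>f t) - (\<integral>z. \<phi> z \<partial>f s) = integral {s..t} (\<lambda>s. \<integral>z. gen s \<phi> z \<partial>f s)"
    using integral_unique[OF 1] integral_unique[OF 2] by simp
qed

text \<open>The constant of \<open>bump_drift_diffusion\<close> with \<open>B\<close> the square of
  the largest distance to the attracting point inside the box, once for every coordinate. \<alpha>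
  enters only through \<open>E\<close>.\<close>

definition mass_decay :: "real \<Rightarrow> real \<Rightarrow> real" where
  "mass_decay r E = real CARD('d) * (lam\<^sup>2 / \<sigma>\<^sup>2 + 2500 * \<sigma>\<^sup>2 * (real CARD('d) * r + E)\<^sup>2 / r\<^sup>2)"

text \<open>The generator on a product is a sum over coordinates, each being a scalar
  drift-diffusion expression times the other factors. Inside the box the scalar inequality applies
  to every summand; outside both sides vanish, since the bump vanishes there together with its two
  derivatives.\<close>

lemma gen_box_bump_ge:
  assumes r: "0 < r" and E: "norm (consensus s z - c) \<le> E"
  shows "- mass_decay r E * box_bump c r z \<le> gen s (box_bump c r) z"
proof -
  let ?\<xi> = "\<lambda>l. (fst z $ l - c $ l) / r"
  let ?P = "\<lambda>l. \<Prod>j\<in>UNIV - {l}. bump (?\<xi> j)"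
  let ?v = "fst z - consensus s z"
  let ?k = "lam\<^sup>2 / \<sigma>\<^sup>2 + 2500 * \<sigma>\<^sup>2 * (real CARD('d) * r + E)\<^sup>2 / r\<^sup>2"
  define T where "T l = - lam * (?v $ l) * (bump' (?\<xi> l) / r) + \<sigma>\<^sup>2 / 2 * diffusion_coeff dif l ?v * (bump'' (?\<xi> l) / r\<^sup>2)" for l
  have aux: "(- lam * v * a + k * D * b) * P = lam * (v' * (a * P)) + k * (D * (b * P))"
    if "v' = - v" for v v' a k D b P :: real
    by (simp add: that algebra_simps)
  have "T l * ?P l = lam * ((consensus s z - fst z) $ l * (bump' (?\<xi> l) / r * ?P l)) +
      \<sigma>\<^sup>2 / 2 * (diffusion_coeff dif l ?v * (bump'' (?\<xi> l) / r\<^sup>2 * ?P l))" for l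
    unfolding T_def by (rule aux) simp
  then have gen: "gen s (box_bump c r) z = (\<Sum>l\<in>UNIV. T l * ?P l)"
    unfolding gen_def frechet_derivative_fst_expand[OF smooth_fun_box_bump, of _ _ _ "consensus s z - fst z"]
      box_bump_frechet_snd box_bump_frechet2[OF less_imp_neq[OF r, symmetric]]
    unfolding box_bump_frechet[OF less_imp_neq[OF r, symmetric]]
    by (simp only: sum.distrib sum_distrib_left mult_zero_right add_0_right)
  have "- ?k * box_bump c r z \<le> T l * ?P l" for l
  proof (cases "\<forall>j. \<bar>?\<xi> j\<bar> < 1")
    case True
    \<comment> \<open>Inside the box the distance to the centre is at most the dimension times
      \<open>r\<close>; together with \<open>E\<close> this bounds the distance to the attracting
      point.\<close>
    have "norm (fst z - c) \<le> (\<Sum>j\<in>UNIV. \<bar>(fst z - c) $ j\<bar>)" by (rule norm_le_l1_cart)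
    also have "\<dots> \<le> (\<Sum>j\<in>(UNIV :: 'd set). r)"
      by (rule sum_mono) (use True r in \<open>simp add: divide_less_eq abs_divide less_imp_le\<close>)
    finally have "norm ?v \<le> real CARD('d) * r + E"
      using E norm_triangle_ineq4[of "fst z - c" "consensus s z - c"] by simp
    then have "diffusion_coeff dif l ?v \<le> (real CARD('d) * r + E)\<^sup>2"
      using diffusion_coeff_le[of dif l ?v] power_mono[OF _ norm_ge_zero, of ?v _ 2] by (rule_tac order_trans)
    then have "- ?k * bump (?\<xi> l) \<le> T l"
      unfolding T_def using True by (intro bump_drift_diffusion params(2) diffusion_coeff_ge r) auto
    from mult_right_mono[OF this prod_bump_bounds(1), of ?\<xi> "UNIV - {l}"] show ?thesis
      unfolding box_bump_split[of c r z l] by (simp only: mult.assoc)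
  next
    case False
    then obtain j where j: "1 \<le> \<bar>?\<xi> j\<bar>" by (auto simp: not_less)
    have "bump (?\<xi> j) = 0" using j by (rule bump_eq_0)
    then have 0: "box_bump c r z = 0" unfolding box_bump_split[of c r z j] by simp
    have "T l * ?P l = 0"
    proof (cases "j = l")
      case True
      then show ?thesis using bump_eq_0(2,3)[OF j] by (simp add: T_def)
    next
      case False
      then have "?P l = 0" using \<open>bump (?\<xi> j) = 0\<close> by (intro prod_zero) auto
      then show ?thesis by simp
    qed
    then show ?thesis unfolding 0 by (simp only: mult_zero_right order_refl)
  qed
  then have "(\<Sum>l\<in>(UNIV :: 'd set). - ?k * box_bump c r z) \<le> (\<Sum>l\<in>UNIV. T l * ?P l)"
    by (rule sum_mono)
  then show ?thesis unfolding gen mass_decay_def by (simp add: algebra_simps)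
qed

lemma box_bump_growth:
  fixes z :: "(real^'d) \<times> (real^2)"
  assumes r: "0 < r" and K: "K = 1 + real CARD('d) * 4 / r + 148 / r\<^sup>2"
  shows "\<bar>box_bump c r z\<bar> \<le> K * (1 + (norm (fst z))\<^sup>2)"
    "\<bar>frechet_derivative (box_bump c r) (at z) v\<bar> \<le> K * (1 + norm (fst z)) * norm v"
    "\<bar>frechet_derivative (\<lambda>z'. frechet_derivative (box_bump c r) (at z') (axis l 1, 0)) (at z) (axis l 1, 0)\<bar> \<le> K"
    "0 \<le> K"
proof -
  have r0: "r \<noteq> 0" using r by simp
  have K1: "1 \<le> K" "real CARD('d) * 4 / r \<le> K" "148 / r\<^sup>2 \<le> K" using r by (auto simp: K)
  then show "0 \<le> K" by simp
  have "\<bar>box_bump c r z\<bar> \<le> 1 * 1" using box_bump_nonneg[of c r z] box_bump_le_1[of c r z] by simp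
  also have "\<dots> \<le> K * (1 + (norm (fst z))\<^sup>2)" using K1 by (intro mult_mono) auto
  finally show "\<bar>box_bump c r z\<bar> \<le> K * (1 + (norm (fst z))\<^sup>2)" .
  show "\<bar>frechet_derivative (\<lambda>z'. frechet_derivative (box_bump c r) (at z') (axis l 1, 0)) (at z) (axis l 1, 0)\<bar> \<le> K"
  proof -
    have "\<bar>bump'' ((fst z $ l - c $ l) / r) / r\<^sup>2 * (\<Prod>j\<in>UNIV - {l}. bump ((fst z $ j - c $ j) / r))\<bar> \<le> 148 / r\<^sup>2 * 1"
      unfolding abs_mult using abs_bump'' prod_bump_bounds r
      by (intro mult_mono) (auto simp: divide_right_mono abs_of_nonneg)
    then show ?thesis unfolding box_bump_frechet2[OF r0] using K1(3) by linarith
  qed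
  have "\<bar>v' $ l * frechet_derivative (box_bump c r) (at z) (axis l 1, 0)\<bar> \<le> norm v' * (4 / r)" for v' l
  proof -
    have "\<bar>bump' ((fst z $ l - c $ l) / r) / r * (\<Prod>j\<in>UNIV - {l}. bump ((fst z $ j - c $ j) / r))\<bar> \<le> 4 / r * 1"
      unfolding abs_mult using abs_bump' prod_bump_bounds r
      by (intro mult_mono) (auto simp: divide_right_mono abs_of_nonneg)
    then show ?thesis
      unfolding box_bump_frechet[OF r0] abs_mult[of "v' $ l"]
      using component_le_norm_cart[of v' l] by (intro mult_mono) auto
  qed
  then have "\<bar>\<Sum>l\<in>UNIV. fst v $ l * frechet_derivative (box_bump c r) (at z) (axis l 1, 0)\<bar> \<le>
      (\<Sum>l\<in>(UNIV :: 'd set). norm (fst v) * (4 / r))"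
    by (intro order_trans[OF sum_abs sum_mono])
  then have "\<bar>frechet_derivative (box_bump c r) (at z) v\<bar> \<le> (real CARD('d) * 4 / r) * norm (fst v)"
    using frechet_derivative_pair[OF smooth_fun_box_bump, of c r z "fst v" "snd v"]
    by (simp add: frechet_derivative_fst_expand[OF smooth_fun_box_bump, of _ _ _ "fst v"]
        box_bump_frechet_snd mult.commute[of "norm (fst v)"] mult.left_commute[of "norm (fst v)"])
  also have "\<dots> \<le> K * norm v"
    using K1 norm_fst_le[of "fst v" "snd v"] by (intro mult_mono) auto
  also have "\<dots> \<le> K * (1 + norm (fst z)) * norm v"
    using K1(1) mult_left_mono[of 1 "1 + norm (fst z)" K] by (intro mult_right_mono) auto
  finally show "\<bar>frechet_derivative (box_bump c r) (at z) v\<bar> \<le> K * (1 + norm (fst z)) * norm v" .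
qed

text \<open>The pointwise bound on the generator says that the mass decreases at most at rate
  \<open>mass_decay r E\<close>; Gronwall is applied to its negative. Continuity in time comes from
  the integral identity itself.\<close>

lemma mass_lower_bound:
  assumes r: "0 < r" and E: "\<And>s z. s \<in> {0..b} \<Longrightarrow> z \<in> phase \<Longrightarrow> norm (consensus s z - c) \<le> E" and b: "0 \<le> b"
  shows "(\<integral>z. box_bump c r z \<partial>f 0) * exp (- mass_decay r E * b) \<le> (\<integral>z. box_bump c r z \<partial>f b)"
proof -
  let ?F = "\<lambda>s. \<integral>z. gen s (box_bump c r) z \<partial>f s" and ?m = "\<lambda>s. \<integral>z. box_bump c r z \<partial>f s"
  note g = box_bump_growth[OF r refl]
  have w: "?F integrable_on {s..t}" "?m t - ?m s = integral {s..t} ?F" "integrable (f t) (box_bump c r)"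
    "integrable (f t) (gen t (box_bump c r))" if "0 \<le> s" "s \<le> t" for s t
    using weak_identity_interval[OF smooth_fun_box_bump g(4) g(1) g(2) g(3) that] by auto
  have F: "- mass_decay r E * ?m s \<le> ?F s" if s: "s \<in> {0..b}" for s
  proof -
    have s0: "0 \<le> s" using s by simp
    have "- mass_decay r E * ?m s = (\<integral>z. - mass_decay r E * box_bump c r z \<partial>f s)" by simp
    also have "\<dots> \<le> ?F s"
    proof (rule integral_mono_AE)
      show "AE z in f s. - mass_decay r E * box_bump c r z \<le> gen s (box_bump c r) z"
        using f_moments(3)[OF s0] by eventually_elim (rule gen_box_bump_ge[OF r E[OF s]])
    qed (use w[OF s0 order_refl] in auto)
    finally show ?thesis .
  qed
  have m_eq: "?m t = ?m 0 + integral {0..t} ?F" if "t \<in> {0..b}" for t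
    using w(2)[of 0 t] that by simp
  have "continuous_on {0..b} (\<lambda>t. ?m 0 + integral {0..t} ?F)"
    using indefinite_integral_continuous_1[OF w(1)[OF order_refl b]] by (intro continuous_intros)
  then have cont: "continuous_on {0..b} ?m" by (simp only: continuous_on_cong[OF refl m_eq])
  have \<nu>: "0 < mass_decay r E"
    using params by (auto simp: mass_decay_def intro!: mult_pos_pos add_pos_nonneg divide_nonneg_nonneg)
  have "- ?m b \<le> - ?m 0 * exp (- mass_decay r E * b)"
  proof (rule gronwall_integral[OF _ \<nu> b])
    show c: "continuous_on {0..b} (\<lambda>t. - ?m t)" using cont by (rule continuous_on_minus)
    fix s t :: real assume st: "0 \<le> s" "s \<le> t" "t \<le> b"
    have mi: "?m integrable_on {s..t}"
      using st by (intro integrable_continuous_interval continuous_on_subset[OF cont]) auto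
    have "integral {s..t} (\<lambda>s. - mass_decay r E * ?m s) \<le> integral {s..t} ?F"
      using integral_le[OF integrable_on_cmult_left[OF mi, of "- mass_decay r E"] w(1)[OF st(1,2)]] F st
      by simp
    then show "- ?m t - - ?m s \<le> - mass_decay r E * integral {s..t} (\<lambda>t. - ?m t)"
      using w(2)[OF st(1,2)] by simp
  qed
  then show ?thesis by simp
qed

end

section \<open>Evolution of the energy\<close>

lemma abs_inner_le: "x \<bullet> y \<le> a * b" if "norm x \<le> a" "norm y \<le> b" for x y :: "'a::real_inner"
  using norm_cauchy_schwarz[of x y] mult_mono[OF that order_trans[OF norm_ge_zero that(1)] norm_ge_zero]
  by linarith

text \<open>\<open>X\<close> extends the minimizers from \<open>Omega\<close> to the whole plane as
  a Lipschitz map, which makes the error measurable and of controlled growth everywhere. \<gamma> is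
  the same curve in the arc-length coordinate, and \<open>N\<close> bounds its speed.\<close>

locale minimizer_curve =
  fixes \<gamma> \<gamma>' :: "real \<Rightarrow> real^'d" and N N' :: real and X :: "real^2 \<Rightarrow> real^'d"
  assumes \<gamma>: "\<And>s. s \<in> {0..sqrt 2} \<Longrightarrow> (\<gamma> has_vector_derivative \<gamma>' s) (at s within {0..sqrt 2})"
    and \<gamma>'_cont: "continuous_on {0..sqrt 2} \<gamma>'"
    and \<gamma>'_bound: "\<And>s. s \<in> {0..sqrt 2} \<Longrightarrow> norm (\<gamma>' s) \<le> N"
    and X_lipschitz: "N'-lipschitz_on UNIV X"
    and X_eq: "\<And>w. w \<in> Omega \<Longrightarrow> X w = \<gamma> (sqrt 2 * w $ 1)"
begin

definition err :: "(real^'d) \<times> (real^2) \<Rightarrow> real" where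
  "err z = norm (fst z - X (snd z))"

lemma err_nonneg: "0 \<le> err z"
  by (simp add: err_def)

lemma N_nonneg: "0 \<le> N"
  using order_trans[OF norm_ge_zero \<gamma>'_bound[of 0]] by simp

lemma X_continuous: "continuous_on UNIV X"
  using X_lipschitz by (rule lipschitz_on_continuous_on)

lemma err_measurable: "err \<in> borel_measurable borel"
proof -
  have "continuous_on UNIV err"
    unfolding err_def by (intro continuous_intros continuous_on_compose2[OF X_continuous]) auto
  then show ?thesis by (rule borel_measurable_continuous_onI)
qed

lemma quad_lipschitz_err: "quad_lipschitz S ((1 + N') * (1 + N' + 2 * norm (X 0))) (\<lambda>z. (err z)\<^sup>2)"
proof -
  have N': "0 \<le> N'" using X_lipschitz by (rule lipschitz_on_nonneg)
  have X: "norm (X v - X w) \<le> N' * norm (v - w)" for v w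
    using lipschitz_onD[OF X_lipschitz, of v w] by (simp add: dist_norm)
  show ?thesis
    unfolding quad_lipschitz_def
  proof (intro conjI ballI)
    show "0 \<le> (1 + N') * (1 + N' + 2 * norm (X 0))" using N' by simp
    show "(\<lambda>z. (err z)\<^sup>2) \<in> borel_measurable borel" using err_measurable by measurable
    fix z z' :: "(real^'d) \<times> (real^2)"
    let ?D = "dist z z'"
    have le: "err v \<le> (1 + N') * norm v + norm (X 0)" for v
    proof -
      have "err v \<le> norm (fst v) + norm (X (snd v) - X 0) + norm (X 0)"
        unfolding err_def by norm
      also have "\<dots> \<le> norm v + N' * norm v + norm (X 0)"
        using X[of "snd v" 0] mult_left_mono[OF norm_snd_le[of "snd v" "fst v"] N'] norm_fst_le[of "fst v" "snd v"]
        by simp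
      finally show ?thesis by (simp add: algebra_simps)
    qed
    have d: "\<bar>err z - err z'\<bar> \<le> (1 + N') * ?D"
    proof -
      have "\<bar>err z - err z'\<bar> \<le> norm (fst z - fst z') + norm (X (snd z) - X (snd z'))"
        unfolding err_def by norm
      also have "\<dots> \<le> ?D + N' * ?D"
        using X[of "snd z" "snd z'"] mult_left_mono[OF dist_snd_le[of z z'] N'] dist_fst_le[of z z']
        by (simp add: dist_norm)
      finally show ?thesis by (simp add: algebra_simps)
    qed
    have "norm ((err z)\<^sup>2 - (err z')\<^sup>2) = (err z + err z') * \<bar>err z - err z'\<bar>"
      using err_nonneg[of z] err_nonneg[of z']
      by (simp add: power2_eq_square square_diff_square_factored abs_mult)
    also have "\<dots> \<le> ((1 + N' + 2 * norm (X 0)) * (1 + norm z + norm z')) * ((1 + N') * ?D)"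
    proof (rule mult_mono[OF _ d])
      have "err z + err z' \<le> (1 + N') * (norm z + norm z') + 2 * norm (X 0) * 1"
        using le[of z] le[of z'] by (simp add: algebra_simps)
      also have "\<dots> \<le> (1 + N') * (1 + norm z + norm z') + 2 * norm (X 0) * (1 + norm z + norm z')"
        using N' by (intro add_mono mult_left_mono) auto
      finally show "err z + err z' \<le> (1 + N' + 2 * norm (X 0)) * (1 + norm z + norm z')"
        by (simp add: algebra_simps)
      show "0 \<le> (1 + N' + 2 * norm (X 0)) * (1 + norm z + norm z')" using N' by simp
    qed simp
    finally show "norm ((err z)\<^sup>2 - (err z')\<^sup>2) \<le>
        (1 + N') * (1 + N' + 2 * norm (X 0)) * (1 + norm z + norm z') * dist z z'"
      by (simp add: algebra_simps)
  qed
qed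

end

locale mean_field_energy = mean_field g L \<alpha> dif U lam \<sigma> \<tau> M f0 f + minimizer_curve \<gamma> \<gamma>' N N' X
  for g :: "real^'d \<Rightarrow> real^2" and L \<alpha> dif U lam \<sigma> \<tau> M f0 f
    and \<gamma> \<gamma>' :: "real \<Rightarrow> real^'d" and N N' :: real and X :: "real^2 \<Rightarrow> real^'d" +
  fixes \<kappa> :: real
  assumes \<kappa>: "\<kappa> = diffusion_const dif TYPE('d)"
begin

section \<open>The expected squared error and its approximations\<close>

definition V :: "real \<Rightarrow> real" where
  "V t = (\<integral>z. (err z)\<^sup>2 \<partial>f t)"

lemma \<kappa>_pos: "0 < \<kappa>"
  unfolding \<kappa> by (cases dif) auto

lemma V_continuous: "continuous_on {0..} V"
  unfolding V_def by (rule continuous_on_integral_quad_lipschitz[OF f_cont quad_lipschitz_err])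

lemma V_nonneg: "0 \<le> V t"
  by (simp add: V_def)

lemma err_integrable:
  assumes t: "0 \<le> t"
  shows "integrable (f t) (\<lambda>z. (err z)\<^sup>2)" "integrable (f t) err"
proof -
  interpret prob_space "f t" by (rule f_moments[OF t])
  show 1: "integrable (f t) (\<lambda>z. (err z)\<^sup>2)"
    by (rule quad_lipschitz_integrable[OF f_prob2[OF t] quad_lipschitz_err])
  have "err z \<le> 1 + (err z)\<^sup>2" for z
    using sum_squares_ge_zero[of "err z - 1" "err z"] by (simp add: power2_eq_square algebra_simps)
  then show "integrable (f t) err"
    using err_measurable err_nonneg
    by (intro Bochner_Integration.integrable_bound[OF Bochner_Integration.integrable_add[OF integrable_const[of 1] 1]])
      (auto simp: measurable_cong_sets[OF f_moments(2)[OF t] refl])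
qed

text \<open>Cauchy-Schwarz obtained from \<open>2 * a * c \<le> a\<^sup>2 + c\<^sup>2\<close> with
  \<open>c = sqrt (V t)\<close>; if \<open>V t = 0\<close> this choice is empty and \<open>c\<close>
  tends to 0 instead.\<close>

lemma mean_err_le:
  assumes t: "0 \<le> t"
  shows "(\<integral>z. err z \<partial>f t) \<le> sqrt (V t)" "(\<integral>z. err z \<partial>f t) \<le> 1 + V t"
proof -
  interpret prob_space "f t" by (rule f_moments[OF t])
  note i = err_integrable[OF t]
  have y: "(\<integral>z. err z \<partial>f t) * c \<le> (V t + c\<^sup>2) / 2" for c
  proof -
    have "(\<integral>z. err z \<partial>f t) * c = (\<integral>z. err z * c \<partial>f t)" using i by simp
    also have "\<dots> \<le> (\<integral>z. ((err z)\<^sup>2 + c\<^sup>2) / 2 \<partial>f t)"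
    proof (rule integral_mono)
      show "err z * c \<le> ((err z)\<^sup>2 + c\<^sup>2) / 2" for z
        using sum_squares_bound[of "err z" c] by simp
    qed (use i in auto)
    also have "\<dots> = (V t + c\<^sup>2) / 2" using i by (simp add: V_def prob_space)
    finally show ?thesis .
  qed
  show "(\<integral>z. err z \<partial>f t) \<le> 1 + V t" using y[of 1] V_nonneg[of t] by simp
  show "(\<integral>z. err z \<partial>f t) \<le> sqrt (V t)"
  proof (cases "V t = 0")
    case True
    have "(\<integral>z. err z \<partial>f t) \<le> 0"
    proof (rule le_of_le_add_eps[of _ 0 "1 / 2"])
      fix \<eta> :: real assume \<eta>: "0 < \<eta>"
      have "(\<integral>z. err z \<partial>f t) * \<eta> \<le> (\<eta> / 2) * \<eta>" using y[of \<eta>] True by (simp add: power2_eq_square)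
      then show "(\<integral>z. err z \<partial>f t) \<le> 0 + \<eta> * (1 / 2)" using \<eta> mult_right_le_imp_le by fastforce
    qed
    then show ?thesis using True by simp
  next
    case False
    then have p: "0 < sqrt (V t)" using V_nonneg[of t] by simp
    have "(\<integral>z. err z \<partial>f t) * sqrt (V t) \<le> sqrt (V t) * sqrt (V t)"
      using y[of "sqrt (V t)"] V_nonneg[of t] by simp
    then show ?thesis using p by (rule mult_right_le_imp_le)
  qed
qed

text \<open>The energy is not an admissible test function, as the minimizer is only continuously
  differentiable; the minimizer is therefore approximated by polynomials in \<open>C\<^sup>1\<close>.\<close>

definition approx_energy :: "(real \<Rightarrow> real^'d) \<Rightarrow> (real^'d) \<times> (real^2) \<Rightarrow> real" where
  "approx_energy P z = (\<Sum>l\<in>UNIV. (fst z $ l - P (sqrt 2 * snd z $ 1) $ l)\<^sup>2)"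

context
  fixes P P' :: "real \<Rightarrow> real^'d" and \<eta> :: real
  assumes P: "\<And>s. (P has_vector_derivative P' s) (at s)"
    and P_smooth: "\<And>l (u :: (real^'d) \<times> (real^2) \<Rightarrow> real). smooth_fun u \<Longrightarrow> smooth_fun (\<lambda>z. P (u z) $ l)"
    and P_close: "\<And>s. s \<in> {0..sqrt 2} \<Longrightarrow> norm (\<gamma> s - P s) \<le> \<eta>"
      "\<And>s. s \<in> {0..sqrt 2} \<Longrightarrow> norm (\<gamma>' s - P' s) \<le> \<eta>"
    and \<eta>: "0 < \<eta>" "\<eta> \<le> 1"
begin

abbreviation "arc_coord z \<equiv> sqrt 2 * snd (z :: (real^'d) \<times> (real^2)) $ 1"

abbreviation "deviation z \<equiv> fst z - P (arc_coord z)"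

lemma approx_energy_norm: "approx_energy P z = (norm (deviation z))\<^sup>2"
  by (simp add: approx_energy_def norm_vec_def L2_set_def sum_nonneg)

lemma smooth_arc_coord: "smooth_fun arc_coord"
proof -
  have "(\<lambda>z :: (real^'d) \<times> (real^2). sqrt 2 * snd z $ 1) = (\<lambda>z. sqrt 2 * (z \<bullet> (0, axis 1 1)))"
    by (auto simp: inner_axis inner_prod_def)
  then show ?thesis by (auto intro!: smooth_fun.mult smooth_fun.const smooth_fun.inner)
qed

lemma smooth_approx_energy: "smooth_fun (approx_energy P)"
  unfolding approx_energy_def[abs_def]
  by (intro smooth_fun_sum smooth_fun_power smooth_fun_diff smooth_fun_nth_fst P_smooth smooth_arc_coord)

lemma dev_has_derivative:
  "(deviation has_derivative (\<lambda>v. fst v - (sqrt 2 * snd v $ 1) *\<^sub>R P' (arc_coord z))) (at z)"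
proof -
  have "(arc_coord has_derivative (\<lambda>v. sqrt 2 * snd v $ 1)) (at z)"
    by (intro has_derivative_mult_right bounded_linear_imp_has_derivative
        bounded_linear_compose[OF bounded_linear_vec_nth bounded_linear_snd])
  from has_derivative_compose[OF this P[unfolded has_vector_derivative_def]]
  have "((\<lambda>z. P (arc_coord z)) has_derivative (\<lambda>v. (sqrt 2 * snd v $ 1) *\<^sub>R P' (arc_coord z))) (at z)" .
  then show ?thesis by (intro has_derivative_diff bounded_linear_imp_has_derivative bounded_linear_fst)
qed

lemma approx_energy_frechet:
  "frechet_derivative (approx_energy P) (at z) v = 2 * (deviation z \<bullet> (fst v - (sqrt 2 * snd v $ 1) *\<^sub>R P' (arc_coord z)))"
proof -
  have "approx_energy P = (\<lambda>z. deviation z \<bullet> deviation z)"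
    by (rule ext) (simp add: approx_energy_norm power2_norm_eq_inner)
  moreover have "((\<lambda>z. deviation z \<bullet> deviation z) has_derivative
      (\<lambda>v. deviation z \<bullet> (fst v - (sqrt 2 * snd v $ 1) *\<^sub>R P' (arc_coord z)) +
           (fst v - (sqrt 2 * snd v $ 1) *\<^sub>R P' (arc_coord z)) \<bullet> deviation z)) (at z)"
    by (rule has_derivative_inner[OF dev_has_derivative dev_has_derivative])
  ultimately have "(approx_energy P has_derivative
      (\<lambda>v. deviation z \<bullet> (fst v - (sqrt 2 * snd v $ 1) *\<^sub>R P' (arc_coord z)) +
           (fst v - (sqrt 2 * snd v $ 1) *\<^sub>R P' (arc_coord z)) \<bullet> deviation z)) (at z)"
    by (simp only:)
  from fun_cong[OF frechet_derivative_at[OF this, symmetric], of v] show ?thesis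
    by (simp only: inner_commute[of _ "deviation z"] mult_2)
qed

lemma approx_energy_frechet2:
  "frechet_derivative (\<lambda>z'. frechet_derivative (approx_energy P) (at z') (axis l 1, 0)) (at z) (axis l 1, 0) = 2"
proof -
  have "(\<lambda>z'. frechet_derivative (approx_energy P) (at z') (axis l 1, 0)) = (\<lambda>z'. 2 * (deviation z' \<bullet> axis l 1))"
    by (simp add: approx_energy_frechet)
  moreover have "((\<lambda>z'. 2 * (deviation z' \<bullet> axis l 1)) has_derivative
      (\<lambda>v. 2 * ((fst v - (sqrt 2 * snd v $ 1) *\<^sub>R P' (arc_coord z)) \<bullet> axis l 1))) (at z)"
    by (intro has_derivative_mult_right has_derivative_inner_left dev_has_derivative)
  ultimately have "((\<lambda>z'. frechet_derivative (approx_energy P) (at z') (axis l 1, 0)) has_derivative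
      (\<lambda>v. 2 * ((fst v - (sqrt 2 * snd v $ 1) *\<^sub>R P' (arc_coord z)) \<bullet> axis l 1))) (at z)"
    by (simp only:)
  from fun_cong[OF frechet_derivative_at[OF this, symmetric], of "(axis l 1, 0)"] show ?thesis
    by (simp add: inner_axis_axis)
qed

lemma gen_approx_energy:
  "gen s (approx_energy P) z = 2 * lam * (deviation z \<bullet> (consensus s z - fst z))
    + \<sigma>\<^sup>2 * \<kappa> * (norm (fst z - consensus s z))\<^sup>2 - 2 * \<tau> * (speed s z * (deviation z \<bullet> P' (arc_coord z)))"
proof -
  \<comment> \<open>The arc-length coordinate \<open>sqrt 2 * w $ 1\<close> has derivative 1 along
    \<open>Omega_dir\<close>, so the curve parameter moves with velocity \<tau> times
    \<open>speed\<close>.\<close>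
  have "sqrt 2 * Omega_dir $ 1 = 1" by (simp add: Omega_dir_def)
  then have 1: "frechet_derivative (approx_energy P) (at z) (0, Omega_dir) = - 2 * (deviation z \<bullet> P' (arc_coord z))"
    by (simp add: approx_energy_frechet)
  have 2: "(\<Sum>l\<in>UNIV. diffusion_coeff dif l (fst z - consensus s z) * 2) = 2 * (\<kappa> * (norm (fst z - consensus s z))\<^sup>2)"
    unfolding sum_distrib_right[symmetric] sum_diffusion_coeff \<kappa> by simp
  show ?thesis
    unfolding gen_def approx_energy_frechet2 1 2 approx_energy_frechet[of z "(consensus s z - fst z, 0)"]
    by (simp add: mult.assoc mult.left_commute)
qed

lemma arc_coord_phase: "z \<in> phase \<Longrightarrow> arc_coord z \<in> {0..sqrt 2}"
  using Omega_arc_inverse(1)[of "snd z"] by auto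

lemma dev_close: "z \<in> phase \<Longrightarrow> norm (deviation z - (fst z - X (snd z))) \<le> \<eta>"
  using P_close(1)[OF arc_coord_phase, of z] X_eq[of "snd z"] by auto

lemma dev_le:
  assumes "z \<in> phase"
  shows "norm (deviation z) \<le> err z + \<eta>" "err z \<le> norm (deviation z) + \<eta>"
  using dev_close[OF assms] norm_triangle_ineq3[of "deviation z" "fst z - X (snd z)"]
  unfolding err_def by linarith+

lemma P'_le: "z \<in> phase \<Longrightarrow> norm (P' (arc_coord z)) \<le> N + \<eta>"
  using P_close(2)[OF arc_coord_phase, of z] \<gamma>'_bound[OF arc_coord_phase, of z] norm_triangle_ineq3[of "\<gamma>' (arc_coord z)" "P' (arc_coord z)"]
  by auto

text \<open>Positions are measured from the minimizer of the particle's own weight. The drift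
  contributes \<open>- 2 * lam * (err z)\<^sup>2\<close>, the noise gives back
  \<open>\<kappa> * \<sigma>\<^sup>2 * (err z)\<^sup>2\<close>, and the motion of the minimizer
  along the curve costs at most \<open>2 * \<tau> * M * N * err z\<close>. All other terms carry a
  factor \<delta> or \<eta>.\<close>

lemma gen_approx_energy_le:
  assumes z: "z \<in> phase" and \<delta>: "norm (consensus s z - X (snd z)) \<le> \<delta>" and s: "0 \<le> s"
  shows "gen s (approx_energy P) z \<le> - (2 * lam - \<kappa> * \<sigma>\<^sup>2) * (err z)\<^sup>2
    + (2 * lam * \<delta> + 2 * \<kappa> * \<sigma>\<^sup>2 * \<delta> + 2 * \<tau> * M * N) * err z + \<kappa> * \<sigma>\<^sup>2 * \<delta>\<^sup>2
    + \<eta> * (2 * lam * (\<delta> + err z) + 2 * \<tau> * M * (err z + N + 1))"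
proof -
  define x where "x = fst z - X (snd z)"
  define y where "y = consensus s z - X (snd z)"
  have x: "norm x = err z" by (simp add: x_def err_def)
  have y: "norm y \<le> \<delta>" using \<delta> by (simp add: y_def)
  have \<delta>0: "0 \<le> \<delta>" using order_trans[OF norm_ge_zero y] .
  note e = err_nonneg[of z]
  have 1: "deviation z \<bullet> (consensus s z - fst z) \<le> (err z + \<eta>) * \<delta> - (err z)\<^sup>2 + \<eta> * err z"
  proof -
    have "consensus s z - fst z = y - x" by (simp add: x_def y_def)
    then have "deviation z \<bullet> (consensus s z - fst z) = deviation z \<bullet> y - x \<bullet> x + (x - deviation z) \<bullet> x"
      by (simp add: inner_diff_left inner_diff_right)
    moreover have "deviation z \<bullet> y \<le> (err z + \<eta>) * \<delta>" using dev_le(1)[OF z] y by (rule abs_inner_le)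
    moreover have "x \<bullet> x = (err z)\<^sup>2" by (simp add: x[symmetric] power2_norm_eq_inner)
    moreover have "(x - deviation z) \<bullet> x \<le> \<eta> * err z"
    proof (rule abs_inner_le)
      show "norm (x - deviation z) \<le> \<eta>"
        using dev_close[OF z] by (simp only: x_def norm_minus_commute)
    qed (simp add: x)
    ultimately show ?thesis by linarith
  qed
  have 2: "(norm (fst z - consensus s z))\<^sup>2 \<le> (err z + \<delta>)\<^sup>2"
  proof -
    have "fst z - consensus s z = x - y" by (simp add: x_def y_def)
    then have "norm (fst z - consensus s z) \<le> err z + \<delta>"
      using norm_triangle_ineq4[of x y] x y by simp
    then show ?thesis by (rule power_mono) simp
  qed
  have 3: "- (speed s z * (deviation z \<bullet> P' (arc_coord z))) \<le> M * ((err z + \<eta>) * (N + \<eta>))"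
  proof -
    have "\<bar>deviation z \<bullet> P' (arc_coord z)\<bar> \<le> norm (deviation z) * norm (P' (arc_coord z))" by (rule Cauchy_Schwarz_ineq2)
    also have "\<dots> \<le> (err z + \<eta>) * (N + \<eta>)"
      using dev_le(1)[OF z] P'_le[OF z] e \<eta> by (intro mult_mono) auto
    finally have "\<bar>speed s z\<bar> * \<bar>deviation z \<bullet> P' (arc_coord z)\<bar> \<le> M * ((err z + \<eta>) * (N + \<eta>))"
      using speed_bound[OF s, of z] M_nonneg by (intro mult_mono) auto
    then show ?thesis by (simp add: abs_mult[symmetric])
  qed
  have 4: "(err z + \<eta>) * (N + \<eta>) \<le> err z * N + \<eta> * (err z + N + 1)"
    using mult_left_mono[of \<eta> 1 \<eta>] \<eta> by (simp add: algebra_simps)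
  have "2 * lam * (deviation z \<bullet> (consensus s z - fst z)) \<le> 2 * lam * ((err z + \<eta>) * \<delta> - (err z)\<^sup>2 + \<eta> * err z)"
    using 1 params by (intro mult_left_mono) auto
  moreover have "\<sigma>\<^sup>2 * \<kappa> * (norm (fst z - consensus s z))\<^sup>2 \<le> \<sigma>\<^sup>2 * \<kappa> * (err z + \<delta>)\<^sup>2"
    using 2 \<kappa>_pos by (intro mult_left_mono) auto
  moreover have "2 * \<tau> * - (speed s z * (deviation z \<bullet> P' (arc_coord z))) \<le> 2 * \<tau> * (M * (err z * N + \<eta> * (err z + N + 1)))"
    using order_trans[OF 3 mult_left_mono[OF 4 M_nonneg]] params by (intro mult_left_mono) auto
  ultimately have "gen s (approx_energy P) z \<le> 2 * lam * ((err z + \<eta>) * \<delta> - (err z)\<^sup>2 + \<eta> * err z)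
      + \<sigma>\<^sup>2 * \<kappa> * (err z + \<delta>)\<^sup>2 + 2 * \<tau> * (M * (err z * N + \<eta> * (err z + N + 1)))"
    unfolding gen_approx_energy by linarith
  also have "\<dots> = - (2 * lam - \<kappa> * \<sigma>\<^sup>2) * (err z)\<^sup>2
    + (2 * lam * \<delta> + 2 * \<kappa> * \<sigma>\<^sup>2 * \<delta> + 2 * \<tau> * M * N) * err z + \<kappa> * \<sigma>\<^sup>2 * \<delta>\<^sup>2
    + \<eta> * (2 * lam * (\<delta> + err z) + 2 * \<tau> * M * (err z + N + 1))"
    by (simp add: algebra_simps power2_eq_square)
  finally show ?thesis .
qed

lemma approx_energy_growth:
  shows "\<exists>K\<ge>0. (\<forall>z\<in>phase. \<bar>approx_energy P z\<bar> \<le> K * (1 + (norm (fst z))\<^sup>2) \<and>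
    (\<forall>v. \<bar>frechet_derivative (approx_energy P) (at z) v\<bar> \<le> K * (1 + norm (fst z)) * norm v)) \<and> 2 \<le> K"
proof -
  have "continuous_on {0..sqrt 2} \<gamma>"
    using \<gamma> has_vector_derivative_continuous continuous_on_eq_continuous_within by blast
  then have "bounded (\<gamma> ` {0..sqrt 2})"
    by (intro compact_imp_bounded compact_continuous_image) auto
  then obtain G where G: "\<And>s. s \<in> {0..sqrt 2} \<Longrightarrow> norm (\<gamma> s) \<le> G"
    unfolding bounded_iff by (meson imageI)
  define p where "p = \<bar>G\<bar> + 1"
  have p: "1 \<le> p" by (simp add: p_def)
  have deviation: "norm (deviation z) \<le> norm (fst z) + p" if "z \<in> phase" for z
  proof -
    have "norm (P (arc_coord z)) \<le> norm (\<gamma> (arc_coord z)) + norm (\<gamma> (arc_coord z) - P (arc_coord z))" by norm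
    also have "\<dots> \<le> p"
      using G[OF arc_coord_phase[OF that]] P_close(1)[OF arc_coord_phase[OF that]] \<eta> by (simp add: p_def)
    finally show ?thesis using norm_triangle_ineq4[of "fst z" "P (arc_coord z)"] by simp
  qed
  define K where "K = 2 * p\<^sup>2 + 2 * p * (1 + sqrt 2 * (N + 1))"
  have p2: "1 \<le> p\<^sup>2" using p by simp
  have K: "0 \<le> K" "2 \<le> K" "2 * p\<^sup>2 \<le> K" "2 * p * (1 + sqrt 2 * (N + 1)) \<le> K"
  proof -
    have "0 \<le> 2 * p * (1 + sqrt 2 * (N + 1))" using p N_nonneg by (intro mult_nonneg_nonneg add_nonneg_nonneg) auto
    then show "0 \<le> K" "2 \<le> K" "2 * p\<^sup>2 \<le> K" "2 * p * (1 + sqrt 2 * (N + 1)) \<le> K"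
      using p2 unfolding K_def by linarith+
  qed
  have "\<bar>approx_energy P z\<bar> \<le> K * (1 + (norm (fst z))\<^sup>2)" if z: "z \<in> phase" for z
  proof -
    have "approx_energy P z \<le> (norm (fst z) + p)\<^sup>2"
      unfolding approx_energy_norm using deviation[OF z] by (rule power_mono) simp
    also have "\<dots> \<le> 2 * (norm (fst z))\<^sup>2 + 2 * p\<^sup>2"
      using sum_squares_ge_zero[of "norm (fst z) - p" 0] by (simp add: power2_eq_square algebra_simps)
    also have "\<dots> \<le> K * (norm (fst z))\<^sup>2 + K" using K by (intro add_mono mult_right_mono) auto
    finally show ?thesis by (simp add: approx_energy_norm algebra_simps)
  qed
  moreover have "\<bar>frechet_derivative (approx_energy P) (at z) v\<bar> \<le> K * (1 + norm (fst z)) * norm v"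
    if z: "z \<in> phase" for z v
  proof -
    have "norm ((sqrt 2 * snd v $ 1) *\<^sub>R P' (arc_coord z)) = sqrt 2 * \<bar>snd v $ 1\<bar> * norm (P' (arc_coord z))"
      by (simp add: abs_mult)
    also have "\<dots> \<le> sqrt 2 * norm v * (N + 1)"
      using order_trans[OF component_le_norm_cart norm_snd_le[of "snd v" "fst v"]] P'_le[OF z] \<eta>
      by (intro mult_mono) auto
    finally have "norm (fst v - (sqrt 2 * snd v $ 1) *\<^sub>R P' (arc_coord z)) \<le> norm v + sqrt 2 * norm v * (N + 1)"
      using norm_fst_le[of "fst v" "snd v"] norm_triangle_ineq4[of "fst v" "(sqrt 2 * snd v $ 1) *\<^sub>R P' (arc_coord z)"]
      by simp
    also have "\<dots> = (1 + sqrt 2 * (N + 1)) * norm v" by (simp add: algebra_simps)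
    finally have 1: "norm (fst v - (sqrt 2 * snd v $ 1) *\<^sub>R P' (arc_coord z)) \<le> (1 + sqrt 2 * (N + 1)) * norm v" .
    have "norm (fst z) + p \<le> p * (1 + norm (fst z))"
      using p mult_right_mono[of 1 p "norm (fst z)"] by (simp add: algebra_simps)
    then have 2: "norm (deviation z) \<le> p * (1 + norm (fst z))" using deviation[OF z] by linarith
    have "\<bar>deviation z \<bullet> (fst v - (sqrt 2 * snd v $ 1) *\<^sub>R P' (arc_coord z))\<bar> \<le>
        norm (deviation z) * norm (fst v - (sqrt 2 * snd v $ 1) *\<^sub>R P' (arc_coord z))" by (rule Cauchy_Schwarz_ineq2)
    also have "\<dots> \<le> (p * (1 + norm (fst z))) * ((1 + sqrt 2 * (N + 1)) * norm v)"
      using 1 2 p by (intro mult_mono) auto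
    finally have "\<bar>frechet_derivative (approx_energy P) (at z) v\<bar> \<le>
        2 * ((p * (1 + norm (fst z))) * ((1 + sqrt 2 * (N + 1)) * norm v))"
      unfolding approx_energy_frechet abs_mult[of 2] by simp
    also have "\<dots> = (2 * p * (1 + sqrt 2 * (N + 1))) * ((1 + norm (fst z)) * norm v)" by (simp add: algebra_simps)
    also have "\<dots> \<le> K * ((1 + norm (fst z)) * norm v)" using K(4) by (rule mult_right_mono) simp
    finally show ?thesis by (simp add: mult.assoc)
  qed
  ultimately show ?thesis using K by (intro exI[of _ K]) auto
qed

end

text \<open>After averaging, the term linear in the error is at most a multiple of the square root
  of the energy. The slack condition, available only above \<epsilon>, pays for it out of the
  difference between the rate \<open>2 * lam - \<kappa> * \<sigma>\<^sup>2\<close> and \<nu>. The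
  polynomial approximation costs a multiple of \<eta>, which tends to 0.\<close>

lemma energy_step:
  assumes st: "0 \<le> s" "s \<le> t"
    and \<delta>: "\<And>r z. r \<in> {s..t} \<Longrightarrow> z \<in> phase \<Longrightarrow> norm (consensus r z - X (snd z)) \<le> \<delta>"
    and low: "\<And>r. r \<in> {s..t} \<Longrightarrow> \<epsilon> \<le> V r"
    and slack: "\<And>v. \<epsilon> \<le> v \<Longrightarrow> (2 * lam * \<delta> + 2 * \<kappa> * \<sigma>\<^sup>2 * \<delta> + 2 * \<tau> * M * N) * sqrt v + \<kappa> * \<sigma>\<^sup>2 * \<delta>\<^sup>2
      \<le> (2 * lam - \<kappa> * \<sigma>\<^sup>2 - \<nu>) * v"
    and \<delta>0: "0 \<le> \<delta>"
  shows "V t - V s \<le> - \<nu> * integral {s..t} V"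
proof -
  define c where "c = 2 * lam * \<delta> + 2 * \<kappa> * \<sigma>\<^sup>2 * \<delta> + 2 * \<tau> * M * N"
  have c: "0 \<le> c" using params \<delta>0 \<kappa>_pos M_nonneg N_nonneg by (simp add: c_def)
  define c0 where "c0 = 2 * lam * \<delta> + 2 * \<tau> * M * (N + 1)"
  define c1 where "c1 = 2 * lam + 2 * \<tau> * M"
  have c1: "0 \<le> c1" using params M_nonneg by (simp add: c1_def)
  have V_int: "V integrable_on {s..t}"
    using st by (intro integrable_continuous_interval continuous_on_subset[OF V_continuous]) auto
  \<comment> \<open>Fixed before \<eta> and expressed through \<open>V\<close> alone, hence
    independent of the approximating polynomial.\<close>
  define C where "C = integral {s..t} (\<lambda>r. c0 + c1 * (1 + V r)) + 2 * (1 + V t) + 2 * (1 + V s) + 2"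
  have "V t - V s \<le> - \<nu> * integral {s..t} V + \<eta> * C" if \<eta>: "0 < \<eta>" "\<eta> \<le> 1" for \<eta>
  proof -
    obtain P P' where "(\<forall>s. (P has_vector_derivative P' s) (at s)) \<and>
      (\<forall>l. \<forall>u :: (real^'d) \<times> (real^2) \<Rightarrow> real. smooth_fun u \<longrightarrow> smooth_fun (\<lambda>z. P (u z) $ l)) \<and>
      (\<forall>s\<in>{0..sqrt 2}. norm (\<gamma> s - P s) \<le> \<eta> \<and> norm (\<gamma>' s - P' s) \<le> \<eta>)"
      using C1_polynomial_approximation[OF \<gamma>'_cont _ \<eta>(1) \<gamma>, where 'c = "(real^'d) \<times> (real^2)"] by auto
    then have P: "\<And>s. (P has_vector_derivative P' s) (at s)"
      "\<And>l (u :: (real^'d) \<times> (real^2) \<Rightarrow> real). smooth_fun u \<Longrightarrow> smooth_fun (\<lambda>z. P (u z) $ l)"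
      "\<And>s. s \<in> {0..sqrt 2} \<Longrightarrow> norm (\<gamma> s - P s) \<le> \<eta>" "\<And>s. s \<in> {0..sqrt 2} \<Longrightarrow> norm (\<gamma>' s - P' s) \<le> \<eta>"
      by auto
    note Pc = P \<eta>
    let ?\<phi> = "approx_energy P" and ?F = "\<lambda>r. \<integral>z. gen r (approx_energy P) z \<partial>f r"
    have sm: "smooth_fun ?\<phi>" by (rule smooth_approx_energy) (fact Pc)+
    have "\<exists>K\<ge>0. (\<forall>z\<in>phase. \<bar>?\<phi> z\<bar> \<le> K * (1 + (norm (fst z))\<^sup>2) \<and>
      (\<forall>v. \<bar>frechet_derivative ?\<phi> (at z) v\<bar> \<le> K * (1 + norm (fst z)) * norm v)) \<and> 2 \<le> K"
      by (rule approx_energy_growth) (fact Pc)+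
    then obtain K where K: "0 \<le> K" "2 \<le> K"
      "\<And>z. z \<in> phase \<Longrightarrow> \<bar>?\<phi> z\<bar> \<le> K * (1 + (norm (fst z))\<^sup>2)"
      "\<And>z v. z \<in> phase \<Longrightarrow> \<bar>frechet_derivative ?\<phi> (at z) v\<bar> \<le> K * (1 + norm (fst z)) * norm v" by blast
    have K2: "\<bar>frechet_derivative (\<lambda>z'. frechet_derivative ?\<phi> (at z') (axis l 1, 0)) (at z) (axis l 1, 0)\<bar> \<le> K" for z l
    proof -
      have "frechet_derivative (\<lambda>z'. frechet_derivative ?\<phi> (at z') (axis l 1, 0)) (at z) (axis l 1, 0) = 2"
        by (rule approx_energy_frechet2) (fact Pc)+
      then show ?thesis using K(2) by simp
    qed
    have w: "?F integrable_on {r..r'}" "(\<integral>z. ?\<phi> z \<partial>f r') - (\<integral>z. ?\<phi> z \<partial>f r) = integral {r..r'} ?F"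
      "integrable (f r') ?\<phi>" "integrable (f r') (gen r' ?\<phi>)" if "0 \<le> r" "r \<le> r'" for r r'
      using weak_identity_interval[OF sm K(1) K(3) K(4) K2 that] by auto
    have phi_err: "norm (?\<phi> z - (err z)\<^sup>2) \<le> 2 * \<eta> * err z + \<eta>" if z: "z \<in> phase" for z
    proof -
      have n: "?\<phi> z = (norm (fst z - P (sqrt 2 * snd z $ 1)))\<^sup>2" by (rule approx_energy_norm) (fact Pc)+
      have d: "norm (fst z - P (sqrt 2 * snd z $ 1)) \<le> err z + \<eta>" "err z \<le> norm (fst z - P (sqrt 2 * snd z $ 1)) + \<eta>"
        by (rule dev_le[OF _ _ _ _ _ _ z]; fact Pc)+
      define a where "a = norm (fst z - P (sqrt 2 * snd z $ 1))"
      have a: "0 \<le> a" "\<bar>a - err z\<bar> \<le> \<eta>" using d by (auto simp: a_def)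
      have "\<bar>a\<^sup>2 - (err z)\<^sup>2\<bar> = (a + err z) * \<bar>a - err z\<bar>"
        using a err_nonneg[of z] by (simp add: power2_eq_square square_diff_square_factored abs_mult)
      also have "\<dots> \<le> (2 * err z + \<eta>) * \<eta>"
        using a err_nonneg[of z] \<eta> by (intro mult_mono) auto
      also have "\<dots> \<le> 2 * \<eta> * err z + \<eta>" using mult_left_mono[of \<eta> 1 \<eta>] \<eta> by (simp add: algebra_simps)
      finally show ?thesis by (simp add: n a_def)
    qed
    have V_close: "\<bar>(\<integral>z. ?\<phi> z \<partial>f r) - V r\<bar> \<le> \<eta> * (2 * (1 + V r)) + \<eta>" if r: "0 \<le> r" for r
    proof -
      interpret prob_space "f r" by (rule f_moments[OF r])
      note i = err_integrable[OF r]
      have "\<bar>(\<integral>z. ?\<phi> z \<partial>f r) - V r\<bar> = norm (\<integral>z. ?\<phi> z - (err z)\<^sup>2 \<partial>f r)"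
        using i w(3)[OF r order_refl] by (simp add: V_def)
      also have "\<dots> \<le> (\<integral>z. norm (?\<phi> z - (err z)\<^sup>2) \<partial>f r)" by (rule integral_norm_bound)
      also have "\<dots> \<le> (\<integral>z. 2 * \<eta> * err z + \<eta> \<partial>f r)"
      proof (rule integral_mono_AE)
        show "AE z in f r. norm (?\<phi> z - (err z)\<^sup>2) \<le> 2 * \<eta> * err z + \<eta>"
          using f_moments(3)[OF r] by eventually_elim (rule phi_err)
      qed (use i w(3)[OF r order_refl] in auto)
      also have "\<dots> = 2 * \<eta> * (\<integral>z. err z \<partial>f r) + \<eta>" using i by (simp add: prob_space)
      also have "\<dots> \<le> 2 * \<eta> * (1 + V r) + \<eta>" using mean_err_le(2)[OF r] \<eta> by simp
      finally show ?thesis by (simp add: algebra_simps)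
    qed
    have F: "?F r \<le> - \<nu> * V r + \<eta> * (c0 + c1 * (1 + V r))" if r: "r \<in> {s..t}" for r
    proof -
      have r0: "0 \<le> r" using r st by simp
      interpret prob_space "f r" by (rule f_moments[OF r0])
      note i = err_integrable[OF r0]
      have "?F r \<le> (\<integral>z. - (2 * lam - \<kappa> * \<sigma>\<^sup>2) * (err z)\<^sup>2 + c * err z + \<kappa> * \<sigma>\<^sup>2 * \<delta>\<^sup>2 + \<eta> * (c0 + c1 * err z) \<partial>f r)"
      proof (rule integral_mono_AE)
        show "integrable (f r) (gen r ?\<phi>)" using w(4)[OF r0 order_refl] .
        show "integrable (f r) (\<lambda>z. - (2 * lam - \<kappa> * \<sigma>\<^sup>2) * (err z)\<^sup>2 + c * err z + \<kappa> * \<sigma>\<^sup>2 * \<delta>\<^sup>2 + \<eta> * (c0 + c1 * err z))"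
          using i by (intro Bochner_Integration.integrable_add integrable_mult_right integrable_const)
        show "AE z in f r. gen r ?\<phi> z \<le>
            - (2 * lam - \<kappa> * \<sigma>\<^sup>2) * (err z)\<^sup>2 + c * err z + \<kappa> * \<sigma>\<^sup>2 * \<delta>\<^sup>2 + \<eta> * (c0 + c1 * err z)"
          using f_moments(3)[OF r0]
        proof eventually_elim
          case (elim z)
          have "gen r ?\<phi> z \<le> - (2 * lam - \<kappa> * \<sigma>\<^sup>2) * (err z)\<^sup>2
              + (2 * lam * \<delta> + 2 * \<kappa> * \<sigma>\<^sup>2 * \<delta> + 2 * \<tau> * M * N) * err z + \<kappa> * \<sigma>\<^sup>2 * \<delta>\<^sup>2
              + \<eta> * (2 * lam * (\<delta> + err z) + 2 * \<tau> * M * (err z + N + 1))"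
            by (rule gen_approx_energy_le) (fact Pc elim \<delta>[OF r elim] r0)+
          also have "2 * lam * (\<delta> + err z) + 2 * \<tau> * M * (err z + N + 1) = c0 + c1 * err z"
            by (simp add: c0_def c1_def algebra_simps)
          finally show ?case by (simp only: c_def)
        qed
      qed
      also have "\<dots> = - (2 * lam - \<kappa> * \<sigma>\<^sup>2) * V r + c * (\<integral>z. err z \<partial>f r) + \<kappa> * \<sigma>\<^sup>2 * \<delta>\<^sup>2 + \<eta> * (c0 + c1 * (\<integral>z. err z \<partial>f r))"
        using i by (simp add: prob_space V_def)
      also have "c * (\<integral>z. err z \<partial>f r) \<le> c * sqrt (V r)" using mean_err_le(1)[OF r0] c by (rule mult_left_mono)
      also have "\<eta> * (c0 + c1 * (\<integral>z. err z \<partial>f r)) \<le> \<eta> * (c0 + c1 * (1 + V r))"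
        using mean_err_le(2)[OF r0] c1 \<eta> by (intro mult_left_mono add_left_mono) auto
      finally have "?F r \<le> - (2 * lam - \<kappa> * \<sigma>\<^sup>2) * V r + c * sqrt (V r) + \<kappa> * \<sigma>\<^sup>2 * \<delta>\<^sup>2 + \<eta> * (c0 + c1 * (1 + V r))"
        by simp
      moreover have "c * sqrt (V r) + \<kappa> * \<sigma>\<^sup>2 * \<delta>\<^sup>2 \<le> (2 * lam - \<kappa> * \<sigma>\<^sup>2 - \<nu>) * V r"
        using slack[OF low[OF r]] by (simp only: c_def)
      moreover have "(2 * lam - \<kappa> * \<sigma>\<^sup>2 - \<nu>) * V r = - (- (2 * lam - \<kappa> * \<sigma>\<^sup>2) * V r) - \<nu> * V r"
        by (simp add: algebra_simps)
      ultimately show ?thesis by linarith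
    qed
    have i1: "(\<lambda>r. - \<nu> * V r) integrable_on {s..t}"
      using integrable_on_cmult_left[OF V_int, of "- \<nu>"] by simp
    have i3: "(\<lambda>r. c0 + c1 * (1 + V r)) integrable_on {s..t}"
    proof -
      have "(\<lambda>r. 1 + V r) integrable_on {s..t}" by (intro integrable_add integrable_const_ivl V_int)
      from integrable_on_cmult_left[OF this, of c1] have "(\<lambda>r. c1 * (1 + V r)) integrable_on {s..t}" by simp
      then show ?thesis by (intro integrable_add integrable_const_ivl)
    qed
    from integrable_on_cmult_left[OF this, of \<eta>]
    have i2: "(\<lambda>r. \<eta> * (c0 + c1 * (1 + V r))) integrable_on {s..t}" by simp
    have "integral {s..t} ?F \<le> integral {s..t} (\<lambda>r. - \<nu> * V r + \<eta> * (c0 + c1 * (1 + V r)))"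
      using w(1)[OF st] F by (intro integral_le integrable_add i1 i2) auto
    also have "\<dots> = integral {s..t} (\<lambda>r. - \<nu> * V r) + integral {s..t} (\<lambda>r. \<eta> * (c0 + c1 * (1 + V r)))"
      using i1 i2 by (rule Henstock_Kurzweil_Integration.integral_add)
    also have "\<dots> = - \<nu> * integral {s..t} V + \<eta> * integral {s..t} (\<lambda>r. c0 + c1 * (1 + V r))"
      by (simp only: integral_mult_right)
    finally have "(\<integral>z. ?\<phi> z \<partial>f t) - (\<integral>z. ?\<phi> z \<partial>f s) \<le>
        - \<nu> * integral {s..t} V + \<eta> * integral {s..t} (\<lambda>r. c0 + c1 * (1 + V r))"
      using w(2)[OF st] by simp
    moreover have "0 \<le> t" using st by simp
    ultimately have "V t - V s \<le> - \<nu> * integral {s..t} V + \<eta> * integral {s..t} (\<lambda>r. c0 + c1 * (1 + V r))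
        + (\<eta> * (2 * (1 + V t)) + \<eta>) + (\<eta> * (2 * (1 + V s)) + \<eta>)"
      using V_close[of t] V_close[of s] st(1) by linarith
    also have "\<dots> = - \<nu> * integral {s..t} V + \<eta> * C" by (simp add: C_def algebra_simps)
    finally show ?thesis by simp
  qed
  then show ?thesis by (rule le_of_le_add_eps)
qed

end

section \<open>Continuation argument\<close>

lemma continuous_le_left_limit:
  fixes F :: "real \<Rightarrow> real"
  assumes "continuous_on {0..} F" "0 < T" "\<And>r. 0 \<le> r \<Longrightarrow> r < T \<Longrightarrow> F r \<le> a"
  shows "F T \<le> a"
proof -
  have cl: "closure {0..<T} = {0..T}" using assms(2) by (simp add: closure_atLeastLessThan)
  have "continuous_on (closure {0..<T}) F"
    unfolding cl using assms(1) by (rule continuous_on_subset) auto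
  then show ?thesis
    by (rule continuous_le_on_closure) (use assms(2,3) in \<open>auto simp: cl\<close>)
qed

context mean_field_energy
begin

section \<open>Persistence in time of a bound on the attracting points\<close>

abbreviation gap :: "real \<Rightarrow> real^2 \<Rightarrow> real" where
  "gap t w \<equiv> norm (attracting_point g \<alpha> (\<rho> t) w - X w)"

definition num :: "real \<Rightarrow> real^2 \<Rightarrow> real^'d" where
  "num t w = (\<integral>z. gibbs g \<alpha> w (fst z) *\<^sub>R (fst z - X w) \<partial>f t)"

definition den :: "real \<Rightarrow> real^2 \<Rightarrow> real" where
  "den t w = (\<integral>z. gibbs g \<alpha> w (fst z) \<partial>f t)"

lemma gap_le_iff:
  assumes "0 \<le> t" "w \<in> Omega"
  shows "gap t w \<le> \<delta> \<longleftrightarrow> norm (num t w) \<le> \<delta> * den t w"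
proof -
  have m: "(\<lambda>x. gibbs g \<alpha> w x) \<in> borel_measurable borel"
    by (rule gibbs_measurable) auto
  then have m': "(\<lambda>x. gibbs g \<alpha> w x *\<^sub>R (x - X w)) \<in> borel_measurable borel" by measurable
  show ?thesis
    unfolding attracting_point_dist_iff[OF marginal_prob2[OF assms(1)] assms(2)] num_def den_def
      marginal_integral[OF assms(1) m] marginal_integral[OF assms(1) m'] ..
qed

lemma den_lower_bound:
  assumes "0 \<le> t"
  shows "\<exists>b>0. \<forall>w\<in>Omega. b \<le> den t w"
proof -
  have "exp (- \<alpha> * (norm (g 0) + L * (1 + (\<integral>x. (norm x)\<^sup>2 \<partial>\<rho> t)))) \<le> den t w" if "w \<in> Omega" for w
  proof -
    have m: "(\<lambda>x. gibbs g \<alpha> w x) \<in> borel_measurable borel"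
      by (rule gibbs_measurable) auto
    show ?thesis
      using partition_function_ge[OF marginal_prob2[OF assms] that order_refl]
      by (simp add: den_def marginal_integral[OF assms m])
  qed
  then show ?thesis by (intro exI[of _ "exp (- \<alpha> * (norm (g 0) + L * (1 + (\<integral>x. (norm x)\<^sup>2 \<partial>\<rho> t))))"]) auto
qed

text \<open>With the denominator cleared, the bound for a fixed weight compares two continuous
  functions of time and so passes to the limit.\<close>

lemma gap_closed:
  assumes T: "0 < T" and w: "w \<in> Omega" and le: "\<And>r. 0 \<le> r \<Longrightarrow> r < T \<Longrightarrow> gap r w \<le> \<delta>"
  shows "gap T w \<le> \<delta>"
proof -
  have "continuous_on {0..} (\<lambda>t. num t w)" "continuous_on {0..} (\<lambda>t. den t w)"
    unfolding num_def den_def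
    by (rule continuous_on_integral_quad_lipschitz[OF f_cont quad_lipschitz_gibbs(2)[OF w]],
        rule continuous_on_integral_quad_lipschitz[OF f_cont quad_lipschitz_gibbs(1)[OF w]])
  then have "continuous_on {0..} (\<lambda>t. norm (num t w) - \<delta> * den t w)" by (intro continuous_intros)
  then have "norm (num T w) - \<delta> * den T w \<le> 0"
    by (rule continuous_le_left_limit[OF _ T]) (use le gap_le_iff[OF _ w] in auto)
  then show ?thesis using gap_le_iff[of T w] T w by simp
qed

lemma X_bounded: "\<exists>D. \<forall>w\<in>Omega. norm (X w) \<le> D"
proof -
  have "bounded (X ` Omega)"
    using continuous_on_subset[OF X_continuous] compact_Omega_2
    by (intro compact_imp_bounded compact_continuous_image) auto
  then show ?thesis unfolding bounded_iff by (meson imageI)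
qed

text \<open>The improved factor \<open>3 / 4\<close> leaves a reserve of \<open>\<delta> / 4\<close>
  times the denominator, which is bounded below uniformly in the weight. Numerator and denominator
  change by amounts that are uniform in the weight too.\<close>

lemma gap_open:
  assumes T: "0 \<le> T" and \<delta>: "0 < \<delta>" and le: "\<And>w. w \<in> Omega \<Longrightarrow> gap T w \<le> 3 / 4 * \<delta>"
  shows "\<exists>d>0. \<forall>s\<ge>0. \<bar>s - T\<bar> < d \<longrightarrow> (\<forall>w\<in>Omega. gap s w \<le> \<delta>)"
proof -
  obtain D where D: "\<And>w. w \<in> Omega \<Longrightarrow> norm (X w) \<le> D" using X_bounded by blast
  obtain b where b: "0 < b" "\<And>w. w \<in> Omega \<Longrightarrow> b \<le> den T w" using den_lower_bound[OF T] by blast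
  define A where "A = (1 + \<alpha> * L) * (1 + \<bar>D\<bar>)"
  have \<alpha>L: "0 \<le> \<alpha> * L" using \<alpha> L_nonneg by simp
  then have A: "0 < A" by (auto simp: A_def intro!: mult_pos_pos add_pos_nonneg)
  \<comment> \<open>The variation \<open>A * e\<close> of the numerator and
    \<open>\<delta> * (\<alpha> * L) * e\<close> of the scaled denominator together equal the
    reserve \<open>\<delta> / 4 * b\<close>.\<close>
  define e where "e = \<delta> / 4 * b / (\<delta> * (\<alpha> * L) + A)"
  have p: "0 < \<delta> * (\<alpha> * L) + A" using \<delta> \<alpha>L A by (intro add_nonneg_pos) auto
  then have e: "0 < e"
    unfolding e_def using \<delta> b(1) by (intro divide_pos_pos mult_pos_pos) auto
  have e_eq: "(\<delta> * (\<alpha> * L) + A) * e = \<delta> / 4 * b"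
    unfolding e_def times_divide_eq_right
    by (rule nonzero_mult_div_cancel_left) (rule less_imp_neq[OF p, symmetric])
  obtain d1 where d1: "0 < d1" "\<forall>s\<ge>0. \<bar>s - T\<bar> < d1 \<longrightarrow> (\<forall>A (h :: (real^'d) \<times> (real^2) \<Rightarrow> real^'d).
      quad_lipschitz phase A h \<longrightarrow> norm ((\<integral>z. h z \<partial>f s) - (\<integral>z. h z \<partial>f T)) \<le> A * e)"
    using continuous_prob2_uniform[OF f_cont T e, where 'b = "real^'d"] by blast
  obtain d2 where d2: "0 < d2" "\<forall>s\<ge>0. \<bar>s - T\<bar> < d2 \<longrightarrow> (\<forall>A (h :: (real^'d) \<times> (real^2) \<Rightarrow> real).
      quad_lipschitz phase A h \<longrightarrow> norm ((\<integral>z. h z \<partial>f s) - (\<integral>z. h z \<partial>f T)) \<le> A * e)"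
    using continuous_prob2_uniform[OF f_cont T e, where 'b = real] by blast
  have "gap s w \<le> \<delta>" if s: "0 \<le> s" "\<bar>s - T\<bar> < min d1 d2" and w: "w \<in> Omega" for s w
  proof -
    have "norm (num s w - num T w) \<le> (1 + \<alpha> * L) * (1 + norm (X w)) * e"
      unfolding num_def using d1(2) s quad_lipschitz_gibbs(2)[OF w] by simp
    also have "\<dots> \<le> A * e"
      unfolding A_def using D[OF w] \<alpha>L e by (intro mult_right_mono mult_left_mono) auto
    finally have n: "norm (num s w) \<le> norm (num T w) + A * e"
      using norm_triangle_ineq2[of "num s w" "num T w"] by simp
    have dn: "\<bar>den s w - den T w\<bar> \<le> \<alpha> * L * e"
      unfolding den_def using d2(2) s quad_lipschitz_gibbs(1)[OF w] by simp
    have "norm (num T w) \<le> 3 / 4 * \<delta> * den T w" using le[OF w] by (simp only: gap_le_iff[OF T w])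
    moreover have "\<delta> * (den T w - \<alpha> * L * e) \<le> \<delta> * den s w" using dn \<delta> by (intro mult_left_mono) auto
    moreover have "\<delta> / 4 * b \<le> \<delta> / 4 * den T w" using b(2)[OF w] \<delta> by (intro mult_left_mono) auto
    moreover have "\<delta> * (den T w - \<alpha> * L * e) = 3 / 4 * \<delta> * den T w + \<delta> / 4 * den T w - \<delta> * (\<alpha> * L) * e"
      by (simp add: algebra_simps)
    moreover have "\<delta> * (\<alpha> * L) * e + A * e = \<delta> / 4 * b" using e_eq by (simp add: distrib_right)
    ultimately have "norm (num s w) \<le> \<delta> * den s w" using n by linarith
    then show ?thesis using gap_le_iff[OF s(1) w] by simp
  qed
  then show ?thesis using d1(1) d2(1) by (intro exI[of _ "min d1 d2"]) auto
qed

lemma l2_error_eq_V: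
  assumes t: "0 \<le> t" and X: "\<And>w. w \<in> Omega \<Longrightarrow> X w = xbar w"
  shows "l2_error xbar (f t) = V t"
proof -
  have "indicat_real phase z *\<^sub>R (norm (fst z - xbar (snd z)))\<^sup>2 = indicat_real phase z * (err z)\<^sup>2" for z
    using X[of "snd z"] by (cases z) (auto simp: indicator_def err_def)
  moreover have "(\<integral>z. indicat_real phase z * (err z)\<^sup>2 \<partial>f t) = (\<integral>z. (err z)\<^sup>2 \<partial>f t)"
  proof (rule integral_cong_AE)
    show "(\<lambda>z. indicat_real phase z * (err z)\<^sup>2) \<in> borel_measurable (f t)"
      using err_integrable(1)[OF t] phase_measurable f_moments(2)[OF t]
      by (intro borel_measurable_times borel_measurable_indicator) auto
    show "AE z in f t. indicat_real phase z * (err z)\<^sup>2 = (err z)\<^sup>2"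
      using f_moments(3)[OF t] by eventually_elim auto
  qed (use err_integrable(1)[OF t] in simp)
  ultimately show ?thesis unfolding l2_error_def set_lebesgue_integral_def V_def by (simp only:)
qed

text \<open>The image under \<open>g\<close> of the minimizer for the particle's own weight lies on
  the front and serves as competitor in the distance, at most \<open>L * err z\<close> away.\<close>

lemma generational_distance_le:
  assumes t: "0 \<le> t" and X: "\<And>w. w \<in> Omega \<Longrightarrow> X w \<in> EP_points g"
  shows "generational_distance g (\<rho> t) \<le> L * sqrt (V t)"
proof -
  let ?F = "Pareto_front g"
  have m: "(\<lambda>x. (infdist (g x) ?F)\<^sup>2) \<in> borel_measurable borel"
    by (intro borel_measurable_continuous_onI continuous_intros g_continuous)
  have "(\<integral>x. (infdist (g x) ?F)\<^sup>2 \<partial>\<rho> t) = (\<integral>z. (infdist (g (fst z)) ?F)\<^sup>2 \<partial>f t)"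
    by (rule marginal_integral[OF t m])
  also have "\<dots> \<le> (\<integral>z. L\<^sup>2 * (err z)\<^sup>2 \<partial>f t)"
  proof (rule integral_mono_AE')
    show "integrable (f t) (\<lambda>z. L\<^sup>2 * (err z)\<^sup>2)" using err_integrable(1)[OF t] by simp
    show "AE z in f t. (infdist (g (fst z)) ?F)\<^sup>2 \<le> L\<^sup>2 * (err z)\<^sup>2"
      using f_moments(3)[OF t]
    proof eventually_elim
      case (elim z)
      then have "g (X (snd z)) \<in> ?F" using X[of "snd z"] by (auto simp: Pareto_front_def)
      then have "infdist (g (fst z)) ?F \<le> dist (g (fst z)) (g (X (snd z)))" by (rule infdist_le)
      also have "\<dots> \<le> L * err z" using g_diff by (simp add: dist_norm err_def)
      finally have "(infdist (g (fst z)) ?F)\<^sup>2 \<le> (L * err z)\<^sup>2" using infdist_nonneg by (rule power_mono)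
      then show ?case by (simp add: power_mult_distrib)
    qed
    show "AE z in f t. 0 \<le> L\<^sup>2 * (err z)\<^sup>2" by simp
  qed
  also have "\<dots> = L\<^sup>2 * V t" by (simp add: V_def)
  finally have "generational_distance g (\<rho> t) \<le> sqrt (L\<^sup>2 * V t)"
    unfolding generational_distance_def by (rule real_sqrt_le_mono)
  then show ?thesis using L_nonneg by (simp add: real_sqrt_mult)
qed

section \<open>Decay up to the hitting time of the target error\<close>

lemma energy_decay:
  assumes t: "0 \<le> t" and \<nu>: "0 < \<nu>" and \<delta>: "0 \<le> \<delta>"
    and gap: "\<And>r w. r \<in> {0..t} \<Longrightarrow> w \<in> Omega \<Longrightarrow> gap r w \<le> \<delta>"
    and low: "\<And>r. r \<in> {0..t} \<Longrightarrow> \<epsilon> \<le> V r"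
    and slack: "\<And>v. \<epsilon> \<le> v \<Longrightarrow> (2 * lam * \<delta> + 2 * \<kappa> * \<sigma>\<^sup>2 * \<delta> + 2 * \<tau> * M * N) * sqrt v + \<kappa> * \<sigma>\<^sup>2 * \<delta>\<^sup>2
      \<le> (2 * lam - \<kappa> * \<sigma>\<^sup>2 - \<nu>) * v"
  shows "V t \<le> V 0 * exp (- \<nu> * t)"
proof (rule gronwall_integral[OF _ \<nu> t])
  show "continuous_on {0..t} V" using V_continuous by (rule continuous_on_subset) auto
  fix s r assume sr: "0 \<le> s" "s \<le> r" "r \<le> t"
  show "V r - V s \<le> - \<nu> * integral {s..r} V"
  proof (rule energy_step[OF sr(1,2) _ _ slack \<delta>])
    show "norm (consensus u z - X (snd z)) \<le> \<delta>" if "u \<in> {s..r}" "z \<in> phase" for u z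
      using gap[of u "snd z"] that sr by (auto simp: consensus_def)
    show "\<epsilon> \<le> V u" if "u \<in> {s..r}" for u using low[of u] that sr by simp
  qed
qed

text \<open>\<open>S\<close> collects the times up to which both the gap bound and
  \<open>V \<ge> \<epsilon>\<close> have persisted, and its supremum belongs to it. If the energy
  were still above \<epsilon> there, the improved gap bound would extend both conditions a little
  further. The alternative \<open>t = 0\<close> in \<open>improve\<close> starts the argument, when
  no history is available yet.\<close>

lemma bootstrap:
  assumes \<nu>: "0 < \<nu>" and \<delta>: "0 < \<delta>" and \<epsilon>: "\<epsilon> < V 0"
    and slack: "\<And>v. \<epsilon> \<le> v \<Longrightarrow> (2 * lam * \<delta> + 2 * \<kappa> * \<sigma>\<^sup>2 * \<delta> + 2 * \<tau> * M * N) * sqrt v + \<kappa> * \<sigma>\<^sup>2 * \<delta>\<^sup>2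
      \<le> (2 * lam - \<kappa> * \<sigma>\<^sup>2 - \<nu>) * v"
    and b: "0 \<le> b" "V 0 * exp (- \<nu> * b) < \<epsilon>"
    and improve: "\<And>t w. t \<in> {0..b} \<Longrightarrow> V t \<le> V 0 \<Longrightarrow>
      t = 0 \<or> (\<forall>r\<in>{0..t}. \<forall>w\<in>Omega. gap r w \<le> \<delta>) \<Longrightarrow> w \<in> Omega \<Longrightarrow> gap t w \<le> 3 / 4 * \<delta>"
  shows "\<exists>T>0. V T = \<epsilon> \<and> (\<forall>t\<in>{0..T}. V t \<le> V 0 * exp (- \<nu> * t))"
proof -
  define S where "S = {t \<in> {0..b}. (\<forall>r\<in>{0..t}. \<forall>w\<in>Omega. gap r w \<le> \<delta>) \<and> (\<forall>r\<in>{0..t}. \<epsilon> \<le> V r)}"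
  have down: "r \<in> S" if "t \<in> S" "0 \<le> r" "r \<le> t" for r t using that by (auto simp: S_def)
  have decay: "V t \<le> V 0 * exp (- \<nu> * t)" if "t \<in> S" for t
    by (rule energy_decay[OF _ \<nu> less_imp_le[OF \<delta>] _ _ slack]) (use that in \<open>auto simp: S_def\<close>)
  have V_le: "V t \<le> V 0" if "t \<in> S" for t
  proof -
    have "V 0 * exp (- \<nu> * t) \<le> V 0 * 1"
      using V_nonneg[of 0] \<nu> that by (intro mult_left_mono) (auto simp: S_def)
    then show ?thesis using decay[OF that] by simp
  qed
  have S0: "0 \<in> S"
  proof -
    have "gap 0 w \<le> \<delta>" if "w \<in> Omega" for w
      using improve[of 0 w] that b \<delta> by simp
    then show ?thesis using b \<epsilon> by (auto simp: S_def)
  qed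
  have bdd: "bdd_above S" by (auto simp: S_def bdd_above_def)
  define T where "T = Sup S"
  have T: "0 \<le> T" "T \<le> b"
  proof -
    show "0 \<le> T" unfolding T_def by (rule cSup_upper[OF S0 bdd])
    have "S \<noteq> {}" using S0 by blast
    moreover have "t \<le> b" if "t \<in> S" for t using that by (simp add: S_def)
    ultimately show "T \<le> b" unfolding T_def by (rule cSup_least)
  qed
  have below: "r \<in> S" if "0 \<le> r" "r < T" for r
  proof -
    have "S \<noteq> {}" using S0 by blast
    from less_cSup_iff[OF this bdd] that(2) obtain t where "t \<in> S" "r < t" unfolding T_def by blast
    then show ?thesis using down[of t r] that(1) by simp
  qed
  have TS: "T \<in> S"
  proof (cases "T = 0")
    case False
    then have T0: "0 < T" using T by simp
    have gT: "gap T w \<le> \<delta>" if "w \<in> Omega" for w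
    proof (rule gap_closed[OF T0 that])
      show "gap r w \<le> \<delta>" if "0 \<le> r" "r < T" for r
        using below[OF that] that(1) \<open>w \<in> Omega\<close> by (auto simp: S_def)
    qed
    have "continuous_on {0..} (\<lambda>t. - V t)" using V_continuous by (rule continuous_on_minus)
    then have "- V T \<le> - \<epsilon>"
      by (rule continuous_le_left_limit[OF _ T0]) (use below in \<open>fastforce simp: S_def\<close>)
    then have VT: "\<epsilon> \<le> V T" by simp
    show ?thesis
      unfolding S_def
    proof (intro CollectI conjI ballI)
      show "T \<in> {0..b}" using T by simp
      fix r assume r: "r \<in> {0..T}"
      show "\<epsilon> \<le> V r"
        using below[of r] r VT by (cases "r = T") (auto simp: S_def)
      show "gap r w \<le> \<delta>" if "w \<in> Omega" for w
        using below[of r] r gT that by (cases "r = T") (auto simp: S_def)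
    qed
  qed (use S0 in simp)
  have "V T = \<epsilon>"
  proof (rule ccontr)
    assume "V T \<noteq> \<epsilon>"
    then have VT: "\<epsilon> < V T" using TS T by (force simp: S_def)
    \<comment> \<open>At the horizon \<open>b\<close> the decay would already have brought the
      energy below \<epsilon>.\<close>
    have "T \<noteq> b" using decay[OF TS] b(2) VT by auto
    then have Tb: "T < b" using T by simp
    have "gap T w \<le> 3 / 4 * \<delta>" if "w \<in> Omega" for w
      using improve[of T w] V_le[OF TS] TS T that by (auto simp: S_def)
    then obtain d1 where d1: "0 < d1" "\<And>s w. 0 \<le> s \<Longrightarrow> \<bar>s - T\<bar> < d1 \<Longrightarrow> w \<in> Omega \<Longrightarrow> gap s w \<le> \<delta>"
      using gap_open[OF T(1) \<delta>] by blast
    have "\<exists>d>0. \<forall>s\<in>{0..}. dist s T < d \<longrightarrow> dist (V s) (V T) < V T - \<epsilon>"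
      using V_continuous T VT unfolding continuous_on_iff by (auto simp: Ball_def)
    then obtain d2 where d2: "0 < d2" "\<And>s. 0 \<le> s \<Longrightarrow> \<bar>s - T\<bar> < d2 \<Longrightarrow> \<epsilon> \<le> V s"
      by (fastforce simp: dist_real_def abs_less_iff)
    define m where "m = min (min d1 d2) (b - T)"
    have m: "0 < m" "m \<le> d1" "m \<le> d2" "m \<le> b - T" using d1(1) d2(1) Tb by (auto simp: m_def)
    define t where "t = T + m / 2"
    have t: "T < t" "t < T + d1" "t < T + d2" "t \<le> b"
      using m unfolding t_def by linarith+
    have "t \<in> S"
      unfolding S_def
    proof (intro CollectI conjI ballI)
      show "t \<in> {0..b}" using t T by simp
      fix r assume r: "r \<in> {0..t}"
      consider "r \<le> T" | "T < r" by linarith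
      then show "\<epsilon> \<le> V r" 
        using TS r t d2(2)[of r] by cases (auto simp: S_def)
    next
      fix r and w :: "real^2" assume r: "r \<in> {0..t}" and w: "w \<in> Omega"
      consider "r \<le> T" | "T < r" by linarith
      then show "gap r w \<le> \<delta>"
        using TS r t w d1(2)[of r w] by cases (auto simp: S_def)
    qed
    then have "t \<le> T" unfolding T_def by (rule cSup_upper[OF _ bdd])
    then show False using t by simp
  qed
  moreover have "0 < T" using \<open>V T = \<epsilon>\<close> \<epsilon> T by (cases "T = 0") auto
  moreover have "\<forall>t\<in>{0..T}. V t \<le> V 0 * exp (- \<nu> * t)" using decay down[OF TS] by auto
  ultimately show ?thesis by blast
qed

text \<open>Supplies the two inputs of the Laplace principle. The box bump is dominated by the
  indicator of the ball of radius \<open>r\<close>, so its expectation bounds the mass of that ball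
  from below. The first moment about one minimizer is at most the mean error plus the distance
  \<open>2 * D\<close> between minimizers.\<close>

lemma gap_le_of_mass:
  assumes t: "0 \<le> t" and w: "w \<in> Omega" and D: "\<And>w. w \<in> Omega \<Longrightarrow> norm (X w) \<le> D"
    and far: "\<And>x. \<delta> / 2 \<le> norm (x - X w) \<Longrightarrow> m + h \<le> scalarized g x w"
    and near: "\<And>x. norm (x - X w) \<le> r \<Longrightarrow> scalarized g x w \<le> m + h / 2"
    and mass: "c \<le> (\<integral>z. box_bump (X w) r' z \<partial>f t)" and r': "0 < r'" "real CARD('d) * r' \<le> r"
    and VB: "V t \<le> VB"
    and large: "(1 + VB + 2 * D) * exp (- \<alpha> * (h / 2)) \<le> c * (\<delta> / 4)" and \<delta>: "0 < \<delta>"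
  shows "gap t w \<le> 3 / 4 * \<delta>"
proof (rule laplace_principle[OF marginal_prob2[OF t] w far near _ _ large \<delta>])
  interpret prob_space "f t" by (rule f_moments[OF t])
  let ?p = "X w"
  let ?B = "{x. norm (x - ?p) \<le> r}"
  have B: "?B \<in> sets borel" by (intro borel_closed closed_Collect_le continuous_intros)
  have le: "box_bump ?p r' z \<le> indicat_real ?B (fst z)" for z :: "(real^'d) \<times> (real^2)"
  proof (cases "fst z \<in> ?B")
    case True
    then show ?thesis using box_bump_le_1[of ?p r' z] by simp
  next
    case False
    \<comment> \<open>If all coordinates were below \<open>r'\<close>, the sum of their absolute
      values would keep the point within \<open>r\<close>.\<close>
    have "\<exists>l. r' \<le> \<bar>(fst z - ?p) $ l\<bar>"
    proof (rule ccontr)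
      assume "\<not> ?thesis"
      then have "(\<Sum>l\<in>UNIV. \<bar>(fst z - ?p) $ l\<bar>) \<le> (\<Sum>l\<in>(UNIV :: 'd set). r')"
        by (intro sum_mono) (auto simp: not_le less_imp_le)
      then show False using False norm_le_l1_cart[of "fst z - ?p"] r'(2) by simp
    qed
    then obtain l where "1 \<le> \<bar>(fst z $ l - ?p $ l) / r'\<bar>" using r'(1) by (auto simp: abs_divide le_divide_eq)
    then have "box_bump ?p r' z = 0" unfolding box_bump_split[of _ _ _ l] by (simp add: bump_eq_0)
    then show ?thesis using False by simp
  qed
  note g = box_bump_growth[OF r'(1) refl]
  have int: "integrable (f t) (box_bump ?p r')"
    using weak_identity_interval(3)[OF smooth_fun_box_bump g(4) g(1) g(2) g(3) t order_refl] .
  have "(\<integral>z. box_bump ?p r' z \<partial>f t) \<le> (\<integral>z. indicat_real ?B (fst z) \<partial>f t)"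
  proof (rule integral_mono[OF int _ le])
    show "integrable (f t) (\<lambda>z. indicat_real ?B (fst z))"
      using measurable_compose[OF fst_meas[OF t] borel_measurable_indicator[OF B]]
      by (intro integrable_const_bound[of _ 1]) (auto simp: indicator_def)
  qed
  also have "\<dots> = (\<integral>x. indicat_real ?B x \<partial>\<rho> t)"
    using B by (intro marginal_integral[OF t, symmetric] borel_measurable_indicator)
  also have "\<dots> = measure (\<rho> t) ?B"
    using B by (simp add: \<rho>_sets[OF t] x_marginal_def)
  finally show "c \<le> measure (\<rho> t) ?B" using mass by simp
  have "(\<integral>x. norm (x - ?p) \<partial>\<rho> t) = (\<integral>z. norm (fst z - ?p) \<partial>f t)"
    by (rule marginal_integral[OF t]) auto
  also have "\<dots> \<le> (\<integral>z. err z + 2 * D \<partial>f t)"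
  proof (rule integral_mono_AE')
    show "integrable (f t) (\<lambda>z. err z + 2 * D)" using err_integrable(2)[OF t] by simp
    show ae: "AE z in f t. norm (fst z - ?p) \<le> err z + 2 * D"
      using f_moments(3)[OF t]
    proof eventually_elim
      case (elim z)
      then have "norm (X (snd z)) \<le> D" "norm ?p \<le> D" using D w by auto
      moreover have "norm (fst z - ?p) \<le> norm (fst z - X (snd z)) + norm (X (snd z)) + norm ?p" by norm
      ultimately show ?case by (simp add: err_def)
    qed
    show "AE z in f t. 0 \<le> err z + 2 * D"
      using ae by eventually_elim (use norm_ge_zero order_trans in blast)
  qed
  also have "\<dots> = (\<integral>z. err z \<partial>f t) + 2 * D" using err_integrable(2)[OF t] by (simp add: prob_space)
  also have "\<dots> \<le> 1 + VB + 2 * D" using mean_err_le(2)[OF t] VB by simp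
  finally show "(\<integral>x. norm (x - ?p) \<partial>\<rho> t) \<le> 1 + VB + 2 * D" .
qed

end

section \<open>Initial mass, choice of constants and conclusion\<close>

text \<open>With \<open>u = C * \<tau> / sqrt \<epsilon>\<close> the right-hand rate is
  \<open>lam + u\<close>. Since \<open>sqrt v \<le> v / sqrt \<epsilon>\<close> for
  \<open>v \<ge> \<epsilon>\<close>, the transport term \<open>2 * \<tau> * M * N * sqrt v\<close>
  costs at most \<open>sqrt 2 * u * v \<le> 2 * u * v\<close>. What is left,
  \<open>lam - u > 0\<close>, pays for the terms in \<delta>; requiring
  \<open>\<delta> \<le> 1\<close> makes these linear in \<delta>.\<close>

lemma slack_choice:
  fixes lam \<sigma> \<tau> M N \<epsilon> \<kappa> C :: real
  assumes "0 < lam" "0 \<le> \<kappa>" "0 \<le> \<tau>" "0 \<le> M" "0 \<le> N" "0 < \<epsilon>" and C: "C = sqrt 2 * M * N"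
    and rate: "\<kappa> * \<sigma>\<^sup>2 + C * (\<tau> / sqrt \<epsilon>) < lam" and \<nu>: "\<nu> = lam - \<kappa> * \<sigma>\<^sup>2 - C * \<tau> / sqrt \<epsilon>"
  shows "\<exists>\<delta>>0. \<forall>v\<ge>\<epsilon>. (2 * lam * \<delta> + 2 * \<kappa> * \<sigma>\<^sup>2 * \<delta> + 2 * \<tau> * M * N) * sqrt v + \<kappa> * \<sigma>\<^sup>2 * \<delta>\<^sup>2
      \<le> (2 * lam - \<kappa> * \<sigma>\<^sup>2 - \<nu>) * v"
proof -
  define u where "u = C * (\<tau> / sqrt \<epsilon>)"
  have C0: "0 \<le> C" using assms by simp
  have \<kappa>\<sigma>: "0 \<le> \<kappa> * \<sigma>\<^sup>2" using assms(2) by simp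
  have u: "0 \<le> u" "u < lam" "\<nu> = lam - \<kappa> * \<sigma>\<^sup>2 - u"
    using C0 assms(3,6) rate \<kappa>\<sigma> by (auto simp: u_def \<nu>)
  define a where "a = 2 * lam + 2 * (\<kappa> * \<sigma>\<^sup>2)"
  define k where "k = a / sqrt \<epsilon> + \<kappa> * \<sigma>\<^sup>2 / \<epsilon>"
  have a: "0 < a" using assms(1) \<kappa>\<sigma> by (simp add: a_def add_pos_nonneg)
  have k: "0 < k" unfolding k_def using a assms(6) \<kappa>\<sigma> by (intro add_pos_nonneg divide_pos_pos divide_nonneg_pos) auto
  define \<delta> where "\<delta> = min 1 ((lam - u) / k)"
  have \<delta>: "0 < \<delta>" "\<delta> \<le> 1" using u k by (auto simp: \<delta>_def)
  have "\<delta> * k \<le> (lam - u) / k * k" using k by (intro mult_right_mono) (auto simp: \<delta>_def)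
  then have \<delta>k: "\<delta> * k \<le> lam - u" using k by simp
  have "(2 * lam * \<delta> + 2 * \<kappa> * \<sigma>\<^sup>2 * \<delta> + 2 * \<tau> * M * N) * sqrt v + \<kappa> * \<sigma>\<^sup>2 * \<delta>\<^sup>2 \<le> (2 * lam - \<kappa> * \<sigma>\<^sup>2 - \<nu>) * v"
    if v: "\<epsilon> \<le> v" for v
  proof -
    have v0: "0 < v" using v assms(6) by simp
    have "sqrt v * sqrt \<epsilon> \<le> sqrt v * sqrt v" using v v0 by (intro mult_left_mono) auto
    then have sv: "sqrt v \<le> v / sqrt \<epsilon>" using v0 assms(6) by (simp add: le_divide_eq)
    have "\<delta>\<^sup>2 \<le> \<delta> * 1" unfolding power2_eq_square using \<delta> by (intro mult_left_mono) auto
    moreover have "\<delta> * 1 \<le> \<delta> * (v / \<epsilon>)" using \<delta> v assms(6) by (intro mult_left_mono) auto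
    ultimately have d2: "\<kappa> * \<sigma>\<^sup>2 * \<delta>\<^sup>2 \<le> \<kappa> * \<sigma>\<^sup>2 * (\<delta> * (v / \<epsilon>))" using \<kappa>\<sigma> by (intro mult_left_mono) auto
    have "2 * \<tau> * M * N = sqrt 2 * (C * \<tau>)" by (simp add: C)
    then have c: "2 * lam * \<delta> + 2 * \<kappa> * \<sigma>\<^sup>2 * \<delta> + 2 * \<tau> * M * N = a * \<delta> + sqrt 2 * (C * \<tau>)"
      by (simp add: a_def algebra_simps)
    have "(a * \<delta> + sqrt 2 * (C * \<tau>)) * sqrt v \<le> (a * \<delta> + sqrt 2 * (C * \<tau>)) * (v / sqrt \<epsilon>)"
      using sv a \<delta> C0 assms(3) by (intro mult_left_mono) auto
    then have "(a * \<delta> + sqrt 2 * (C * \<tau>)) * sqrt v + \<kappa> * \<sigma>\<^sup>2 * \<delta>\<^sup>2 \<le> (\<delta> * k + sqrt 2 * u) * v"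
      using d2 by (simp add: k_def u_def algebra_simps)
    also have "\<dots> \<le> (lam + u) * v"
    proof (rule mult_right_mono)
      have "sqrt 2 \<le> 2" by (simp add: real_le_lsqrt)
      then have "sqrt 2 * u \<le> 2 * u" using u by (intro mult_right_mono) auto
      then show "\<delta> * k + sqrt 2 * u \<le> lam + u" using \<delta>k by linarith
    qed (use v0 in simp)
    also have "lam + u = 2 * lam - \<kappa> * \<sigma>\<^sup>2 - \<nu>" by (simp add: u(3))
    finally show ?thesis unfolding c .
  qed
  then show ?thesis using \<delta> by blast
qed

text \<open>On the cube of half-side \<open>r / 2\<close> every factor of the bump is at least
  \<open>exp (- (4 / 3))\<close>, because \<open>1 / (1 - 1 / 4) = 4 / 3\<close>. This cube lies in
  \<open>H\<close>, so its probability is its volume divided by that of \<open>H\<close>.\<close>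

lemma initial_mass:
  fixes c :: "real^'d" and f0 :: "((real^'d) \<times> (real^2)) measure"
  assumes f0: "f0 = uniform_measure lborel H \<Otimes>\<^sub>M \<mu>0" and f0': "prob2_on phase f0"
    and H: "bounded H" "open H" "emeasure lborel H > 0" and \<mu>0: "prob_on Omega \<mu>0"
    and r: "0 < r" and box: "\<And>x. (\<And>l. \<bar>x $ l - c $ l\<bar> \<le> r / 2) \<Longrightarrow> x \<in> H"
  shows "exp (- (4 / 3)) ^ CARD('d) * (r ^ CARD('d) / measure lborel H) \<le> (\<integral>z. box_bump c r z \<partial>f0)"
proof -
  note m = prob2_on_moments[OF f0']
  interpret P: prob_space f0 by (rule m)
  interpret \<mu>0: prob_space \<mu>0 using \<mu>0 by (simp add: prob_on_def)
  define B where "B = cbox (\<chi> l. c $ l - r / 2) (\<chi> l. c $ l + r / 2)"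
  have B_iff: "x \<in> B \<longleftrightarrow> (\<forall>l. \<bar>x $ l - c $ l\<bar> \<le> r / 2)" for x
  proof -
    have "c $ l - r / 2 \<le> x $ l \<and> x $ l \<le> c $ l + r / 2 \<longleftrightarrow> \<bar>x $ l - c $ l\<bar> \<le> r / 2" for l
      by linarith
    then show ?thesis by (simp add: B_def mem_box_cart)
  qed
  have BH: "B \<subseteq> H" using box B_iff by blast
  have B: "B \<in> sets borel" by (simp add: B_def)
  have "c \<in> B" using r by (simp add: B_iff)
  then have content: "measure lborel B = r ^ CARD('d)"
    unfolding B_def by (subst content_cbox_cart) auto
  have Hfin: "emeasure lborel H \<noteq> \<infinity>"
    using emeasure_bounded_finite[OF H(1)] by simp
  have Hm: "H \<in> sets lborel" using H(2) by simp
  have sets\<mu>: "sets \<mu>0 = sets borel" "space \<mu>0 = UNIV"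
    using \<mu>0 sets_eq_imp_space_eq[of \<mu>0 borel] by (auto simp: prob_on_def)
  have BU: "B \<times> UNIV \<in> sets f0"
    unfolding m(2) B_def by (intro borel_closed closed_Times closed_cbox closed_UNIV)
  have "emeasure f0 (B \<times> UNIV) = emeasure (uniform_measure lborel H) B * emeasure \<mu>0 (space \<mu>0)"
    unfolding f0 sets\<mu>(2)[symmetric] using B by (intro \<mu>0.emeasure_pair_measure_Times) auto
  then have "measure f0 (B \<times> UNIV) = measure (uniform_measure lborel H) B"
    by (simp add: measure_def \<mu>0.emeasure_space_1)
  also have "\<dots> = measure lborel (H \<inter> B) / measure lborel H"
    using H(3) Hfin B Hm by (intro measure_uniform_measure) auto
  also have "H \<inter> B = B" using BH by blast
  finally have mB: "measure f0 (B \<times> UNIV) = r ^ CARD('d) / measure lborel H" by (simp add: content)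
  have "exp (- (4 / 3)) ^ CARD('d) * indicat_real (B \<times> UNIV) z \<le> box_bump c r z" for z
  proof (cases "z \<in> B \<times> UNIV")
    case True
    then have "\<bar>fst z $ l - c $ l\<bar> \<le> r / 2" for l using B_iff[of "fst z"] by auto
    then have "\<bar>(fst z $ l - c $ l) / r\<bar> \<le> 1 / 2" for l
      using r by (simp add: abs_divide divide_le_eq)
    then have "(\<Prod>l\<in>(UNIV :: 'd set). exp (- (4 / 3))) \<le> box_bump c r z"
      unfolding box_bump_def using bump_half by (intro prod_mono) auto
    then show ?thesis using True by simp
  qed (simp add: box_bump_nonneg)
  then have "(\<integral>z. exp (- (4 / 3)) ^ CARD('d) * indicat_real (B \<times> UNIV) z \<partial>f0) \<le> (\<integral>z. box_bump c r z \<partial>f0)"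
  proof (intro integral_mono)
    show "integrable f0 (\<lambda>z. exp (- (4 / 3)) ^ CARD('d) * indicat_real (B \<times> UNIV) z)"
      using BU by (intro integrable_mult_right integrable_real_indicator) (auto simp: P.emeasure_eq_measure)
    have "box_bump c r \<in> borel_measurable f0"
      using borel_measurable_continuous_onI[OF smooth_fun_continuous[OF smooth_fun_box_bump[of c r]]]
      by (simp add: measurable_cong_sets[OF m(2) refl])
    then show "integrable f0 (box_bump c r)"
      by (rule P.integrable_const_bound[of _ 1, rotated]) (simp add: box_bump_nonneg box_bump_le_1)
  qed
  then show ?thesis using BU mB by simp
qed

theorem corollary4p1:
  fixes g :: "real^'d \<Rightarrow> real^2"
    and U :: "real^2 \<Rightarrow> ereal"
    and xbar :: "real^2 \<Rightarrow> real^'d"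
    and H :: "(real^'d) set"
    and \<mu>0 :: "(real^2) measure"
    and dif :: diffusion
    and lam \<sigma> \<tau> \<epsilon> R p q c1 c2 c3 L \<kappa> C :: real
    and f0 :: "((real^'d) \<times> (real^2)) measure"
  assumes params: "lam > 0" "\<sigma> > 0" "\<tau> \<ge> 0"
    and potential: "is_potential U"
    and unique_min: "\<And>w x. w \<in> Omega \<Longrightarrow>
          is_arg_min (\<lambda>x. scalarized g x w) (\<lambda>_. True) x \<longleftrightarrow> x = xbar w"
    and min_EP: "\<And>w. w \<in> Omega \<Longrightarrow> xbar w \<in> EP_points g"
    and xbar_C1: "C1_on Omega xbar"
    and stability_consts: "R > 0" "p > 2" "q > 1" "c1 > 0" "c2 > 0" "c3 > 0"
    and stability_lower: "\<And>w x. w \<in> Omega \<Longrightarrow> norm (x - xbar w) \<le> R \<Longrightarrow>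
          c1 * norm (x - xbar w) powr p \<le> scalarized g x w - (INF y. scalarized g y w)"
    and stability_upper: "\<And>w x. w \<in> Omega \<Longrightarrow> norm (x - xbar w) \<le> R \<Longrightarrow>
          scalarized g x w - (INF y. scalarized g y w) \<le> c2 * norm (x - xbar w) powr (1 / q)"
    and stability_far: "\<And>w x. w \<in> Omega \<Longrightarrow> norm (x - xbar w) \<ge> R \<Longrightarrow>
          c3 \<le> scalarized g x w - (INF y. scalarized g y w)"
    and H: "bounded H" "open H" "EP_points g \<subseteq> H" "emeasure lborel H > 0"
    and \<mu>0: "prob_on Omega \<mu>0"
    and f0: "f0 = uniform_measure lborel H \<Otimes>\<^sub>M \<mu>0"
    and gradU_Linf: "in_Linf lborel (potential_grad U)"
    and g_lipschitz: "L-lipschitz_on UNIV g"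
    and \<kappa>: "\<kappa> = diffusion_const dif TYPE('d)"
    and C: "C = sqrt 2 * Linf_norm lborel (potential_grad U) * Omega_grad_Linf_norm xbar"
    and \<epsilon>: "0 < \<epsilon>" "\<epsilon> < l2_error xbar f0"
    and rate: "\<kappa> * \<sigma>\<^sup>2 + C * (\<tau> / sqrt \<epsilon>) < lam"
  shows "\<exists>\<alpha>0>0. \<forall>\<alpha>\<ge>\<alpha>0. \<forall>f. mean_field_solution dif g U \<alpha> lam \<sigma> \<tau> f0 f \<longrightarrow>
    (\<exists>T>0. l2_error xbar (f T) = \<epsilon> \<and>
       generational_distance g (x_marginal (f T)) \<le> L * sqrt \<epsilon> \<and>
       (\<forall>t\<in>{0..T}. generational_distance g (x_marginal (f t)) \<le>
          L * sqrt (l2_error xbar f0) * exp (- ((lam - \<kappa> * \<sigma>\<^sup>2 - C * \<tau> / sqrt \<epsilon>) / 2 * t))))"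
proof -
  define M where "M = Linf_norm lborel (potential_grad U)"
  have grad_bound: "norm (potential_grad U y) \<le> M" for y
    unfolding M_def by (rule potential_grad_bound[OF potential gradU_Linf])
  have grad_meas: "potential_grad U \<in> borel_measurable borel"
    using gradU_Linf by (simp add: in_Linf_def)
  define N where "N = Omega_grad_Linf_norm xbar"
  define \<gamma> where "\<gamma> s = xbar (Omega_arc s)" for s
  obtain \<gamma>' where \<gamma>': "continuous_on {0..sqrt 2} \<gamma>'"
    "\<And>s. s \<in> {0..sqrt 2} \<Longrightarrow> (\<gamma> has_vector_derivative \<gamma>' s) (at s within {0..sqrt 2})"
    "\<And>s. s \<in> {0..sqrt 2} \<Longrightarrow> norm (\<gamma>' s) \<le> N"
    using Omega_arc_curve[OF xbar_C1] unfolding \<gamma>_def[abs_def] N_def by auto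
  have N: "0 \<le> N" using order_trans[OF norm_ge_zero \<gamma>'(3)[of 0]] by simp
  have M: "0 \<le> M" using order_trans[OF norm_ge_zero grad_bound] .
  \<comment> \<open>Clamping the arc-length coordinate to its interval extends the curve to the
    whole plane without increasing distances.\<close>
  define X where "X w = \<gamma> (max 0 (min (sqrt 2) (sqrt 2 * w $ 1)))" for w :: "real^2"
  have X_\<gamma>: "X w = \<gamma> (sqrt 2 * w $ 1)" if "w \<in> Omega" for w
    using Omega_arc_inverse(1)[OF that] by (simp add: X_def)
  have X: "X w = xbar w" if "w \<in> Omega" for w
    using X_\<gamma>[OF that] Omega_arc_inverse(2)[OF that] by (simp add: \<gamma>_def)
  have X_lip: "(sqrt 2 * N)-lipschitz_on UNIV X"
  proof (rule lipschitz_onI)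
    fix v w :: "real^2"
    let ?c = "\<lambda>w :: real^2. max 0 (min (sqrt 2) (sqrt 2 * w $ 1))"
    have "norm (\<gamma> (?c v) - \<gamma> (?c w)) \<le> N * \<bar>?c v - ?c w\<bar>"
      by (rule has_vector_derivative_lipschitz[OF \<gamma>'(2,3)]) auto
    also have "\<dots> \<le> N * \<bar>sqrt 2 * v $ 1 - sqrt 2 * w $ 1\<bar>"
      using N by (intro mult_left_mono) linarith+
    also have "\<dots> = sqrt 2 * N * \<bar>(v - w) $ 1\<bar>" by (simp add: right_diff_distrib[symmetric] abs_mult)
    also have "\<dots> \<le> sqrt 2 * N * norm (v - w)"
      using N component_le_norm_cart[of "v - w" 1] by (intro mult_left_mono) auto
    finally show "dist (X v) (X w) \<le> sqrt 2 * N * dist v w" by (simp add: X_def dist_norm)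
  qed (use N in simp)
  have curve: "minimizer_curve \<gamma> \<gamma>' N (sqrt 2 * N) X"
    by unfold_locales (use \<gamma>' X_lip X_\<gamma> in auto)
  have X_cont: "continuous_on Omega X"
    using lipschitz_on_continuous_on[OF X_lip] by (rule continuous_on_subset) simp
  have X_compact: "compact (X ` Omega)"
    using X_cont compact_Omega_2 by (rule compact_continuous_image)
  obtain D where D: "0 \<le> D" "\<And>w. w \<in> Omega \<Longrightarrow> norm (X w) \<le> D"
  proof -
    obtain D where "\<And>w. w \<in> Omega \<Longrightarrow> norm (X w) \<le> D"
      using compact_imp_bounded[OF X_compact] unfolding bounded_iff by (meson imageI)
    then show ?thesis using that[of "\<bar>D\<bar>"] by force
  qed
  define \<nu> where "\<nu> = lam - \<kappa> * \<sigma>\<^sup>2 - C * \<tau> / sqrt \<epsilon>"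
  have \<nu>: "0 < \<nu>" using rate by (simp add: \<nu>_def)
  have \<kappa>0: "0 \<le> \<kappa>" unfolding \<kappa> by (cases dif) auto
  obtain \<delta> where \<delta>: "0 < \<delta>" and slack: "\<And>v. \<epsilon> \<le> v \<Longrightarrow>
      (2 * lam * \<delta> + 2 * \<kappa> * \<sigma>\<^sup>2 * \<delta> + 2 * \<tau> * M * N) * sqrt v + \<kappa> * \<sigma>\<^sup>2 * \<delta>\<^sup>2 \<le> (2 * lam - \<kappa> * \<sigma>\<^sup>2 - \<nu>) * v"
    using slack_choice[OF params(1) \<kappa>0 params(3) M N \<epsilon>(1) _ rate \<nu>_def] C by (auto simp: M_def N_def)
  define V0 where "V0 = l2_error xbar f0"
  have V0: "0 < V0" "\<epsilon> < V0" using \<epsilon> by (auto simp: V0_def)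
  \<comment> \<open>At time \<open>ln (V0 / \<epsilon>) / \<nu>\<close> the decay reaches exactly
    \<epsilon>; the extra unit of time makes the inequality strict.\<close>
  define b where "b = ln (V0 / \<epsilon>) / \<nu> + 1"
  have b: "0 \<le> b" "V0 * exp (- \<nu> * b) < \<epsilon>"
  proof -
    have "0 \<le> ln (V0 / \<epsilon>)" using V0 \<epsilon>(1) by simp
    then show "0 \<le> b" using \<nu> by (simp add: b_def)
    have "- \<nu> * b = - ln (V0 / \<epsilon>) - \<nu>" using \<nu> by (simp add: b_def algebra_simps)
    then have "V0 * exp (- \<nu> * b) < V0 * exp (- ln (V0 / \<epsilon>))" using \<nu> V0 by simp
    also have "\<dots> = \<epsilon>" using V0 \<epsilon>(1) by (simp add: exp_minus)
    finally show "V0 * exp (- \<nu> * b) < \<epsilon>" .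
  qed
  \<comment> \<open>The height by which the objective exceeds its minimum at distance at least
    \<open>\<delta> / 2\<close>: the power bound applies inside radius \<open>R\<close>, the
    constant \<open>c3\<close> outside.\<close>
  define h where "h = min (c1 * (\<delta> / 2) powr p) c3"
  have h: "0 < h" using stability_consts \<delta> by (simp add: h_def)
  define m where "m w = (INF y. scalarized g y w)" for w
  have far: "m w + h \<le> scalarized g x w" if w: "w \<in> Omega" and x: "\<delta> / 2 \<le> norm (x - X w)" for w x
  proof (cases "norm (x - xbar w) \<le> R")
    case True
    have "(\<delta> / 2) powr p \<le> norm (x - xbar w) powr p"
      using x X[OF w] \<delta> stability_consts(2) by (intro powr_mono2) auto
    then have "h \<le> c1 * norm (x - xbar w) powr p"
      using stability_consts(4) by (auto simp: h_def intro!: min.coboundedI1)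
    then show ?thesis using stability_lower[OF w True] by (simp add: m_def)
  next
    case False
    then show ?thesis using stability_far[OF w, of x] by (simp add: m_def h_def min_le_iff_disj)
  qed
  \<comment> \<open>Solves \<open>c2 * r powr (1 / q) = h / 2\<close>, capped at \<open>R\<close>,
    where the upper stability bound holds.\<close>
  define r where "r = min R ((h / (2 * c2)) powr q)"
  have r: "0 < r" using stability_consts h by (simp add: r_def)
  have near: "scalarized g x w \<le> m w + h / 2" if w: "w \<in> Omega" and x: "norm (x - X w) \<le> r" for w x
  proof -
    have "norm (x - xbar w) powr (1 / q) \<le> ((h / (2 * c2)) powr q) powr (1 / q)"
      using x X[OF w] stability_consts(3) by (intro powr_mono2) (auto simp: r_def)
    also have "\<dots> = h / (2 * c2)" using stability_consts h by (simp add: powr_powr)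
    finally have "c2 * norm (x - xbar w) powr (1 / q) \<le> c2 * (h / (2 * c2))"
      using stability_consts(5) by (intro mult_left_mono) auto
    also have "\<dots> = h / 2" using stability_consts(5) by simp
    finally show ?thesis
      using stability_upper[OF w, of x] x X[OF w] by (simp add: m_def r_def)
  qed
  have "X ` Omega \<subseteq> H"
  proof
    fix x assume "x \<in> X ` Omega"
    then show "x \<in> H" using X min_EP H(3) by auto
  qed
  then obtain e where e: "0 < e" "(\<Union>x\<in>X ` Omega. ball x e) \<subseteq> H"
    using compact_subset_open_imp_ball_epsilon_subset[OF X_compact H(2)] by blast
  define nd where "nd = real CARD('d)"
  have nd: "1 \<le> nd" by (simp add: nd_def Suc_le_eq)
  \<comment> \<open>The division by the dimension passes from balls to cubes. The cube has to fit
    into the ball of radius \<open>r\<close>, where the objective is low, and into \<open>H\<close>,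
    where the initial law has mass.\<close>
  define r' where "r' = min r e / nd"
  have r': "0 < r'" "nd * r' \<le> r" "nd * r' \<le> e" using r e nd by (auto simp: r'_def)
  have box: "x \<in> H" if w: "w \<in> Omega" and x: "\<And>l. \<bar>x $ l - X w $ l\<bar> \<le> r' / 2" for w and x :: "real^'d"
  proof -
    have "norm (x - X w) \<le> (\<Sum>l\<in>UNIV. \<bar>(x - X w) $ l\<bar>)" by (rule norm_le_l1_cart)
    also have "\<dots> \<le> (\<Sum>l\<in>(UNIV :: 'd set). r' / 2)" using x by (intro sum_mono) simp
    also have "\<dots> = nd * r' / 2" by (simp add: nd_def)
    also have "\<dots> < e" using r'(3) e(1) by simp
    finally have "x \<in> ball (X w) e" by (simp add: dist_norm norm_minus_commute)
    then show ?thesis using e(2) w by blast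
  qed
  \<comment> \<open>The bump is centred at the minimizer of one fixed weight, while each particle is
    drawn to the attracting point of its own weight; two minimizers are at most \<open>2 * D\<close>
    apart.\<close>
  define E where "E = \<delta> + 2 * D"
  define k where "k = nd * (lam\<^sup>2 / \<sigma>\<^sup>2 + 2500 * \<sigma>\<^sup>2 * (nd * r' + E)\<^sup>2 / r'\<^sup>2)"
  have k: "0 \<le> k" using nd by (simp add: k_def)
  define m0 where "m0 = exp (- (4 / 3)) ^ CARD('d) * (r' ^ CARD('d) / measure lborel H)"
  have m0: "0 < m0"
  proof -
    have "measure lborel H \<noteq> 0"
      using H(4) emeasure_bounded_finite[OF H(1)] by (auto simp: measure_def enn2real_eq_0_iff)
    then have "0 < measure lborel H" using measure_nonneg[of lborel H] by linarith
    then show ?thesis using r'(1) by (simp add: m0_def)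
  qed
  \<comment> \<open>The mass guaranteed at the latest admissible time \<open>b\<close>, hence at all
    earlier ones.\<close>
  define c where "c = m0 * exp (- k * b)"
  have c: "0 < c" using m0 by (simp add: c_def)
  define A where "A = 1 + V0 + 2 * D"
  have A: "0 < A" using V0 D by (simp add: A_def)
  \<comment> \<open>With \<open>exp y \<ge> y\<close> the requirement
    \<open>A * exp (- \<alpha> * (h / 2)) \<le> c * (\<delta> / 4)\<close> follows from
    \<open>8 * A \<le> \<alpha> * (h * c * \<delta>)\<close>. None of these constants depends on the
    solution \<open>f\<close>.\<close>
  define \<alpha>0 where "\<alpha>0 = 8 * A / (h * c * \<delta>) + 1"
  have \<alpha>0: "0 < \<alpha>0" using A h c \<delta> by (auto simp: \<alpha>0_def intro!: add_pos_pos divide_pos_pos mult_pos_pos)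
  show ?thesis
  proof (rule exI[of _ \<alpha>0], rule conjI[OF \<alpha>0], intro allI impI)
    fix \<alpha> f assume \<alpha>_ge: "\<alpha>0 \<le> \<alpha>" and sol: "mean_field_solution dif g U \<alpha> lam \<sigma> \<tau> f0 f"
    have \<alpha>_pos: "0 < \<alpha>" using \<alpha>0 \<alpha>_ge by simp
    interpret minimizer_curve \<gamma> \<gamma>' N "sqrt 2 * N" X by (rule curve)
    interpret mean_field_energy g L \<alpha> dif U lam \<sigma> \<tau> M f0 f \<gamma> \<gamma>' N "sqrt 2 * N" X \<kappa>
      by unfold_locales (use g_lipschitz \<alpha>_pos params sol grad_meas grad_bound \<kappa> in auto)
    have f_0: "f 0 = f0" using sol by (simp add: mean_field_solution_def)
    have V: "l2_error xbar (f t) = V t" if "0 \<le> t" for t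
      by (rule l2_error_eq_V[OF that X])
    have V_0: "V 0 = V0" using V[of 0] by (simp add: f_0 V0_def)
    have large: "A * exp (- \<alpha> * (h / 2)) \<le> c * (\<delta> / 4)"
    proof -
      have "8 * A / (h * c * \<delta>) \<le> \<alpha>" using \<alpha>_ge by (simp add: \<alpha>0_def)
      then have "8 * A \<le> \<alpha> * (h * c * \<delta>)" using h c \<delta> by (simp add: divide_le_eq)
      then have "A \<le> c * (\<delta> / 4) * (\<alpha> * (h / 2))" by (simp add: algebra_simps)
      also have "\<dots> \<le> c * (\<delta> / 4) * exp (\<alpha> * (h / 2))"
      proof (rule mult_left_mono)
        show "\<alpha> * (h / 2) \<le> exp (\<alpha> * (h / 2))"
          using exp_ge_add_one_self[of "\<alpha> * (h / 2)"] by linarith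
      qed (use c \<delta> in simp)
      finally show ?thesis by (simp add: exp_minus divide_inverse[symmetric] pos_divide_le_eq)
    qed
    have mass0: "m0 \<le> (\<integral>z. box_bump (X w) r' z \<partial>f 0)" if "w \<in> Omega" for w
      unfolding m0_def f_0
      using f_prob2[of 0] f_0 box[OF that] by (intro initial_mass[OF f0 _ H(1,2,4) \<mu>0 r'(1)]) auto
    have improve: "gap t w \<le> 3 / 4 * \<delta>"
      if t: "t \<in> {0..b}" and Vt: "V t \<le> V 0" and w: "w \<in> Omega"
        and good: "t = 0 \<or> (\<forall>r\<in>{0..t}. \<forall>w\<in>Omega. gap r w \<le> \<delta>)" for t w
    proof -
      have mass: "c \<le> (\<integral>z. box_bump (X w) r' z \<partial>f t)"
      \<comment> \<open>At time 0 the mass comes directly from the initial law; later the gap bound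
        over \<open>{0..t}\<close> confines the drift and thereby limits the loss of mass.\<close>
      proof (cases "t = 0")
        case True
        have "c \<le> m0 * 1" unfolding c_def using k b m0 by (intro mult_left_mono) auto
        then show ?thesis using mass0[OF w] True by simp
      next
        case False
        have cons: "norm (consensus s z - X w) \<le> E" if s: "s \<in> {0..t}" and z: "z \<in> phase" for s z
        proof -
          have w': "snd z \<in> Omega" using z by auto
          have "norm (consensus s z - X w) \<le> norm (consensus s z - X (snd z)) + norm (X (snd z)) + norm (X w)"
            by norm
          moreover have "norm (consensus s z - X (snd z)) \<le> \<delta>"
            using good False s w' by (simp add: consensus_def)
          ultimately show ?thesis using D(2)[OF w'] D(2)[OF w] by (simp add: E_def)
        qed
        have "c \<le> m0 * exp (- k * t)"
          unfolding c_def using k t m0 by (intro mult_left_mono) (auto intro: mult_left_mono)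
        also have "\<dots> \<le> (\<integral>z. box_bump (X w) r' z \<partial>f 0) * exp (- k * t)"
          using mass0[OF w] by (intro mult_right_mono) auto
        also have "\<dots> \<le> (\<integral>z. box_bump (X w) r' z \<partial>f t)"
        proof -
          have "mass_decay r' E = k" by (simp add: mass_decay_def k_def nd_def)
          moreover have "(\<integral>z. box_bump (X w) r' z \<partial>f 0) * exp (- mass_decay r' E * t) \<le> (\<integral>z. box_bump (X w) r' z \<partial>f t)"
            by (rule mass_lower_bound[OF r'(1)]) (fact cons, use t in simp)
          ultimately show ?thesis by (simp only:)
        qed
        finally show ?thesis .
      qed
      show ?thesis
        using gap_le_of_mass[OF _ w D(2) far[OF w] near[OF w] mass r'(1) _ Vt _ \<delta>] t r'(2) large
        by (simp add: nd_def V_0 A_def)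
    qed
    have "\<exists>T>0. V T = \<epsilon> \<and> (\<forall>t\<in>{0..T}. V t \<le> V 0 * exp (- \<nu> * t))"
      by (rule bootstrap[OF \<nu> \<delta> _ slack b(1) _ improve]) (use V_0 V0 b(2) in auto)
    then obtain T where T: "0 < T" "V T = \<epsilon>" "\<And>t. t \<in> {0..T} \<Longrightarrow> V t \<le> V0 * exp (- \<nu> * t)"
      by (auto simp: V_0)
    have EP: "X w \<in> EP_points g" if "w \<in> Omega" for w using X[OF that] min_EP[OF that] by simp
    have GD: "generational_distance g (x_marginal (f t)) \<le> L * sqrt (V t)" if "0 \<le> t" for t
      by (rule generational_distance_le[OF that EP])
    show "\<exists>T>0. l2_error xbar (f T) = \<epsilon> \<and>
       generational_distance g (x_marginal (f T)) \<le> L * sqrt \<epsilon> \<and>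
       (\<forall>t\<in>{0..T}. generational_distance g (x_marginal (f t)) \<le>
          L * sqrt (l2_error xbar f0) * exp (- ((lam - \<kappa> * \<sigma>\<^sup>2 - C * \<tau> / sqrt \<epsilon>) / 2 * t)))"
    proof (intro exI[of _ T] conjI ballI)
      show "0 < T" by (rule T)
      show "l2_error xbar (f T) = \<epsilon>" using V[of T] T by simp
      show "generational_distance g (x_marginal (f T)) \<le> L * sqrt \<epsilon>" using GD[of T] T by simp
      fix t assume t: "t \<in> {0..T}"
      have "generational_distance g (x_marginal (f t)) \<le> L * sqrt (V t)" using GD[of t] t by simp
      also have "\<dots> \<le> L * sqrt (V0 * exp (- \<nu> * t))"
        using T(3)[OF t] L_nonneg by (intro mult_left_mono real_sqrt_le_mono)
      \<comment> \<open>The square root halves the exponent.\<close>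
      also have "sqrt (V0 * exp (- \<nu> * t)) = sqrt V0 * exp (- (\<nu> / 2 * t))"
      proof -
        have "exp (- \<nu> * t) = (exp (- (\<nu> / 2 * t)))\<^sup>2" by (simp add: exp_double[symmetric])
        then show ?thesis by (simp add: real_sqrt_mult)
      qed
      finally show "generational_distance g (x_marginal (f t)) \<le>
          L * sqrt (l2_error xbar f0) * exp (- ((lam - \<kappa> * \<sigma>\<^sup>2 - C * \<tau> / sqrt \<epsilon>) / 2 * t))"
        by (simp add: V0_def \<nu>_def mult.assoc)
    qed
  qed
qed

end
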